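(* Let $I_1, I_2, \dots$ be an arbitrary (finite or infinite) number of mutually disjoint subsets of $\mathbb{N}$, and for each $i$ let $\varphi_i$ be a given state of $\mathcal{A}(I_i)$. (1) A product state extension of $\varphi_i$, $i=1,2,\dots$, exists if and only if all states $\varphi_i$ except at most one are even. It is unique if it exists. It is even if and only if all $\varphi_i$ are even. (2) Suppose that all $\varphi_i$ are pure. If there exists a joint extension of $\varphi_i$, $i=1,2,\dots$, then all states $\varphi_i$ except at most one have to be even. If this is the case (i.e. all $\varphi_i$ except at most one are even), the joint extension is uniquely given by the product state extension (that is, the product state extension is the one and only joint extension) and it is a pure state.
   Context: $\mathbb{N}=\{1,2,\dots\}$. $\mathcal{A}$ is the CAR (Fermion) algebra: the unital $C^*$-algebra generated by elements $a_i, a_i^*$, $i\in\mathbb{N}$, satisfying $\{a_i^*,a_j\}=\delta_{i,j}\mathbf{1}$ and $\{a_i^*,a_j^*\}=\{a_i,a_j\}=0$ for all $i,j$, where $\{A,B\}=AB+BA$. For $I\subset\mathbb{N}$, $\mathcal{A}(I)$ is the (unital) $C^*$-subalgebra generated by $a_i,a_i^*$, $i\in I$. $\Theta$ is the unique automorphism of $\mathcal{A}$ with $\Theta(a_i)=-a_i$, $\Theta(a_i^* )=-a_i^*$ for all $i$; it preserves each $\mathcal{A}(I)$. A state $\varphi$ of $\mathcal{A}(I)$ is called even if $\varphi(\Theta(A))=\varphi(A)$ for all $A\in\mathcal{A}(I)$. For mutually disjoint $I_1,I_2,\dots$ and states $\varphi_i$ of $\mathcal{A}(I_i)$, a state $\varphi$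 of $\mathcal{A}(\bigcup_i I_i)$ is called a joint extension of the $\varphi_i$ if its restriction to $\mathcal{A}(I_i)$ equals $\varphi_i$ for every $i$; it is called a product state extension if $\varphi(A_1A_2\cdots A_k)=\prod_{i=1}^k\varphi_i(A_i)$ for all $A_i\in\mathcal{A}(I_i)$ and all $k$ (with $k$ at most the number of subsystems if that is finite). *)

theory Defs
  imports "HOL-Analysis.Analysis" "HOL-Library.Extended_Nat"
begin

text \<open>
  Unital C*-algebras. The inherited law \<^prop>\<open>norm 1 = 1\<close> only excludes the zero algebra.
\<close>

class cstar_algebra = banach + real_normed_algebra_1 +
  fixes scaleC :: "complex \<Rightarrow> 'a \<Rightarrow> 'a"  (infixr \<open>*\<^sub>C\<close> 75)
    and star :: "'a \<Rightarrow> 'a"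
  assumes scaleC_of_real: "complex_of_real r *\<^sub>C x = r *\<^sub>R x"
    and scaleC_add_right: "c *\<^sub>C (x + y) = c *\<^sub>C x + c *\<^sub>C y"
    and scaleC_add_left: "(c + d) *\<^sub>C x = c *\<^sub>C x + d *\<^sub>C x"
    and scaleC_scaleC: "c *\<^sub>C d *\<^sub>C x = (c * d) *\<^sub>C x"
    and mult_scaleC_left: "(c *\<^sub>C x) * y = c *\<^sub>C (x * y)"
    and mult_scaleC_right: "x * (c *\<^sub>C y) = c *\<^sub>C (x * y)"
    and norm_scaleC: "norm (c *\<^sub>C x) = cmod c * norm x"
    and star_add: "star (x + y) = star x + star y"
    and star_scaleC: "star (c *\<^sub>C x) = cnj c *\<^sub>C star x"
    and star_mult: "star (x * y) = star y * star x"
    and star_star: "star (star x) = x"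
    and norm_star_mult_self: "norm (star x * x) = (norm x)\<^sup>2"

definition cstar_subalgebra :: "'a::cstar_algebra set \<Rightarrow> bool" where
  "cstar_subalgebra S \<longleftrightarrow>
     1 \<in> S \<and> (\<forall>x\<in>S. \<forall>y\<in>S. x + y \<in> S \<and> x * y \<in> S) \<and>
     (\<forall>c. \<forall>x\<in>S. c *\<^sub>C x \<in> S) \<and> (\<forall>x\<in>S. star x \<in> S) \<and> closed S"

definition cstar_automorphism :: "('a::cstar_algebra \<Rightarrow> 'a) \<Rightarrow> bool" where
  "cstar_automorphism \<theta> \<longleftrightarrow>
     bij \<theta> \<and> (\<forall>x y. \<theta> (x + y) = \<theta> x + \<theta> y) \<and> (\<forall>c x. \<theta> (c *\<^sub>C x) = c *\<^sub>C \<theta> x) \<and>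
     (\<forall>x y. \<theta> (x * y) = \<theta> x * \<theta> y) \<and> (\<forall>x. \<theta> (star x) = star (\<theta> x))"

definition anticommutator :: "'a::cstar_algebra \<Rightarrow> 'a \<Rightarrow> 'a" where
  "anticommutator x y = x * y + y * x"

text \<open>
  The whole type is the CAR algebra with annihilators \<^term>\<open>a\<close>. No universal
  property is required: the relations determine the C*-algebra they generate up to
  a *-isomorphism matching the generators. Modes are labelled from 0.
\<close>

definition car_algebra :: "(nat \<Rightarrow> 'a::cstar_algebra) \<Rightarrow> bool" where
  "car_algebra a \<longleftrightarrow>
     (\<forall>i j. anticommutator (star (a i)) (a j) = (if i = j then 1 else 0)) \<and>
     (\<forall>i j. anticommutator (star (a i)) (star (a j)) = 0) \<and>
     (\<forall>i j. anticommutator (a i) (a j) = 0) \<and>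
     cstar_subalgebra hull (range a) = UNIV"

definition local_algebra :: "(nat \<Rightarrow> 'a::cstar_algebra) \<Rightarrow> nat set \<Rightarrow> 'a set" where
  "local_algebra a I = cstar_subalgebra hull (a ` I)"

text \<open>
  For a CAR algebra the described automorphism exists and is unique: on the modes
  below \<open>n\<close> it is conjugation by the product of the unitaries
  \<open>1 - 2 a\<^sub>i\<^sup>* a\<^sub>i\<close> with \<open>i < n\<close>.
\<close>

definition parity :: "(nat \<Rightarrow> 'a::cstar_algebra) \<Rightarrow> 'a \<Rightarrow> 'a" where
  "parity a = (THE \<theta>. cstar_automorphism \<theta> \<and>
     (\<forall>i. \<theta> (a i) = - a i \<and> \<theta> (star (a i)) = - star (a i)))"

text \<open>
  States of a subalgebra \<^term>\<open>S\<close> are functions on the whole type of which only the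
  values on \<^term>\<open>S\<close> matter; equality of states is therefore equality on \<^term>\<open>S\<close>.
\<close>

definition state_on :: "'a::cstar_algebra set \<Rightarrow> ('a \<Rightarrow> complex) \<Rightarrow> bool" where
  "state_on S \<phi> \<longleftrightarrow>
     (\<forall>x\<in>S. \<forall>y\<in>S. \<phi> (x + y) = \<phi> x + \<phi> y) \<and> (\<forall>c. \<forall>x\<in>S. \<phi> (c *\<^sub>C x) = c * \<phi> x) \<and>
     (\<forall>x\<in>S. \<phi> (star x * x) \<in> \<real>\<^sub>\<ge>\<^sub>0) \<and> \<phi> 1 = 1"

definition states_eq_on :: "'a::cstar_algebra set \<Rightarrow> ('a \<Rightarrow> complex) \<Rightarrow> ('a \<Rightarrow> complex) \<Rightarrow> bool" where
  "states_eq_on S \<phi> \<psi> \<longleftrightarrow> (\<forall>x\<in>S. \<phi> x = \<psi> x)"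

definition pure_on :: "'a::cstar_algebra set \<Rightarrow> ('a \<Rightarrow> complex) \<Rightarrow> bool" where
  "pure_on S \<phi> \<longleftrightarrow> state_on S \<phi> \<and>
     (\<forall>\<psi>\<^sub>1 \<psi>\<^sub>2 t. state_on S \<psi>\<^sub>1 \<and> state_on S \<psi>\<^sub>2 \<and> 0 < t \<and> t < 1 \<and>
        states_eq_on S \<phi> (\<lambda>x. complex_of_real t * \<psi>\<^sub>1 x + complex_of_real (1 - t) * \<psi>\<^sub>2 x) \<longrightarrow>
        states_eq_on S \<psi>\<^sub>1 \<phi> \<and> states_eq_on S \<psi>\<^sub>2 \<phi>)"

definition even_on :: "(nat \<Rightarrow> 'a::cstar_algebra) \<Rightarrow> nat set \<Rightarrow> ('a \<Rightarrow> complex) \<Rightarrow> bool" where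
  "even_on a I \<phi> \<longleftrightarrow> (\<forall>x\<in>local_algebra a I. \<phi> (parity a x) = \<phi> x)"

text \<open>
  A family of \<open>N\<close> subsystems, where \<open>N\<close> may be infinite, is indexed by the naturals below \<open>N\<close>.
\<close>

definition subsystems :: "enat \<Rightarrow> nat set" where
  "subsystems N = {i. enat i < N}"

definition region :: "enat \<Rightarrow> (nat \<Rightarrow> nat set) \<Rightarrow> nat set" where
  "region N I = (\<Union>i\<in>subsystems N. I i)"

definition joint_extension ::
  "(nat \<Rightarrow> 'a::cstar_algebra) \<Rightarrow> enat \<Rightarrow> (nat \<Rightarrow> nat set) \<Rightarrow> (nat \<Rightarrow> 'a \<Rightarrow> complex) \<Rightarrow> ('a \<Rightarrow> complex) \<Rightarrow> bool"
  where
  "joint_extension a N I \<phi> \<psi> \<longleftrightarrow> state_on (local_algebra a (region N I)) \<psi> \<and>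
     (\<forall>i\<in>subsystems N. states_eq_on (local_algebra a (I i)) \<psi> (\<phi> i))"

text \<open>The factors \<open>A\<^sub>0 A\<^sub>1 \<dots> A\<^sub>k\<^sub>-\<^sub>1\<close> are multiplied in this order.\<close>

definition product_extension ::
  "(nat \<Rightarrow> 'a::cstar_algebra) \<Rightarrow> enat \<Rightarrow> (nat \<Rightarrow> nat set) \<Rightarrow> (nat \<Rightarrow> 'a \<Rightarrow> complex) \<Rightarrow> ('a \<Rightarrow> complex) \<Rightarrow> bool"
  where
  "product_extension a N I \<phi> \<psi> \<longleftrightarrow> state_on (local_algebra a (region N I)) \<psi> \<and>
     (\<forall>k A. enat k \<le> N \<and> (\<forall>i<k. A i \<in> local_algebra a (I i)) \<longrightarrow>
        \<psi> (prod_list (map A [0..<k])) = (\<Prod>i<k. \<phi> i (A i)))"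

end

(* Replacing each annihilator x by the Majorana generators x + star x and i (x - star x) turns the CAR
   algebra into a Clifford algebra with one kind of relation. Conjugation by a generator composed with
   the parity flips the sign of this generator alone; averaging over these flips splits off one
   generator after the other, and so gives a slice map phi (x) id for a region with finitely many
   generators. Odd elements of disjoint regions anticommute, but an even state phi vanishes on
   them, so its product with an arbitrary state chi takes the value
   sum_kl phi (star x_k x_l) chi (star y_k y_l) at star z z for z = sum_k x_k y_k and is positive by
   Schur's product theorem. States are contractive, hence products over finite truncations extend
   by continuity.

   For pure states everything follows without representations from perturbing a joint extension
   psi to x |-> psi (star (1 + lambda y) x (1 + lambda y)) with y in another region: for suitable y these
   are positive functionals dominated by a multiple of the given pure state, hence proportional to it. *)

theory Submission
  imports Defs
begin

section \<open>C*-algebras\<close>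

text \<open>The only analytic tool is the binomial series for the square root of
  \<open>1 - h\<close>; contractivity of states and automorphisms and the positivity of perturbed
  functionals in the commuting case come from it. A product functional is prescribed on products
  only, so it must be shown to be well defined, and its positivity must be tested on all elements.
  With finitely many generators in one region every element is an exact finite sum of products whose
  coefficients are recovered by averaging, and both questions become algebra; this is why regions
  are truncated. The truncated products are coherent because a product state is unique at each
  stage. In the pure case the obstacle is the part of the perturbed functional that is linear in the
  parameter. For even pure states it cancels between opposite parameters. For a pure state that is
  not even it is computed from the commuting case, and the parameter is chosen so that a negative
  multiple of the other state composed with the parity appears; this forces the other state to be
  even.\<close>

lemma scaleC_one [simp]: "1 *\<^sub>C x = (x::'a::cstar_algebra)"
  using scaleC_of_real[of 1 x] by simp

lemma scaleC_zero_left [simp]: "0 *\<^sub>C x = (0::'a::cstar_algebra)"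
  using scaleC_of_real[of 0 x] by simp

lemma scaleC_zero_right [simp]: "c *\<^sub>C 0 = (0::'a::cstar_algebra)"
  using scaleC_add_right[of c 0 0] by simp

lemma scaleC_minus_right [simp]: "c *\<^sub>C (- x) = - (c *\<^sub>C (x::'a::cstar_algebra))"
  using scaleC_add_right[of c x "- x"] by (simp add: eq_neg_iff_add_eq_0 add.commute)

lemma scaleC_minus_left [simp]: "(- c) *\<^sub>C x = - (c *\<^sub>C (x::'a::cstar_algebra))"
  using scaleC_add_left[of c "- c" x] by (simp add: eq_neg_iff_add_eq_0 add.commute)

lemma scaleC_diff_right: "c *\<^sub>C (x - y) = c *\<^sub>C x - c *\<^sub>C (y::'a::cstar_algebra)"
  using scaleC_add_right[of c x "- y"] by simp

lemma scaleR_conv_scaleC: "r *\<^sub>R x = complex_of_real r *\<^sub>C (x::'a::cstar_algebra)"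
  by (simp add: scaleC_of_real)

lemma star_minus [simp]: "star (- x) = - star (x::'a::cstar_algebra)"
  using star_scaleC[of "-1" x] by simp

lemma star_zero [simp]: "star (0::'a::cstar_algebra) = 0"
  using star_scaleC[of 0 0] by simp

lemma star_one [simp]: "star (1::'a::cstar_algebra) = 1"
  by (metis mult.right_neutral star_mult star_star)

lemma star_diff: "star (x - y) = star x - star (y::'a::cstar_algebra)"
  using star_add[of x "- y"] by simp

lemma star_scaleR: "star (r *\<^sub>R x) = r *\<^sub>R star (x::'a::cstar_algebra)"
  by (simp add: scaleR_conv_scaleC star_scaleC)

lemma star_power: "star (x ^ n) = star (x::'a::cstar_algebra) ^ n"
  by (induction n) (simp_all add: star_mult power_commutes)

lemma star_sum: "star (\<Sum>i\<in>A. f i) = (\<Sum>i\<in>A. star (f i :: 'a::cstar_algebra))"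
  by (induction A rule: infinite_finite_induct) (simp_all add: star_add)

lemma norm_star [simp]: "norm (star x) = norm (x::'a::cstar_algebra)"
proof -
  have le: "norm y \<le> norm (star y)" for y :: 'a
  proof -
    have "norm y * norm y \<le> norm (star y) * norm y"
      using norm_mult_ineq[of "star y" y] by (simp add: norm_star_mult_self power2_eq_square)
    then show ?thesis
      by (cases "norm y = 0") (simp_all add: mult_le_cancel_right)
  qed
  show ?thesis
    using le[of x] le[of "star x"] by (simp add: star_star)
qed

lemma bounded_linear_star: "bounded_linear (star :: 'a::cstar_algebra \<Rightarrow> 'a)"
  by (rule bounded_linear_intro[of _ 1]) (simp_all add: star_add star_scaleR)

lemma bounded_linear_scaleC: "bounded_linear (\<lambda>x::'a::cstar_algebra. c *\<^sub>C x)"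
  by (rule bounded_linear_intro[of _ "cmod c"])
     (simp_all add: scaleC_add_right scaleR_conv_scaleC scaleC_scaleC norm_scaleC mult.commute)

lemmas tendsto_star = bounded_linear.tendsto[OF bounded_linear_star]
lemmas tendsto_scaleC = bounded_linear.tendsto[OF bounded_linear_scaleC]

lemma norm_isometry:
  fixes u :: "'a::cstar_algebra"
  assumes "star u * u = 1"
  shows "norm u = 1"
proof -
  have "(norm u)\<^sup>2 = 1" using norm_star_mult_self[of u] assms by simp
  then show ?thesis by (simp add: power2_eq_1_iff) (use norm_ge_zero[of u] in linarith)
qed

section \<open>Closed subalgebras and hulls\<close>

lemma cstar_subalgebraI:
  assumes "1 \<in> S" "\<And>x y. x \<in> S \<Longrightarrow> y \<in> S \<Longrightarrow> x + y \<in> S"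
    "\<And>x y. x \<in> S \<Longrightarrow> y \<in> S \<Longrightarrow> x * y \<in> S"
    "\<And>c x. x \<in> S \<Longrightarrow> c *\<^sub>C x \<in> S" "\<And>x. x \<in> S \<Longrightarrow> star x \<in> S" "closed S"
  shows "cstar_subalgebra S"
  using assms by (auto simp: cstar_subalgebra_def)

lemma
  assumes "cstar_subalgebra S"
  shows subalg_one: "1 \<in> S"
    and subalg_add: "x \<in> S \<Longrightarrow> y \<in> S \<Longrightarrow> x + y \<in> S"
    and subalg_mult: "x \<in> S \<Longrightarrow> y \<in> S \<Longrightarrow> x * y \<in> S"
    and subalg_scaleC: "x \<in> S \<Longrightarrow> c *\<^sub>C x \<in> S"
    and subalg_star: "x \<in> S \<Longrightarrow> star x \<in> S"
    and subalg_closed: "closed S"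
  using assms by (auto simp: cstar_subalgebra_def)

lemma subalg_zero: "cstar_subalgebra S \<Longrightarrow> 0 \<in> S"
  by (metis scaleC_zero_left subalg_one subalg_scaleC)

lemma subalg_minus: "cstar_subalgebra S \<Longrightarrow> x \<in> S \<Longrightarrow> - x \<in> S"
  using subalg_scaleC[of S x "-1"] by simp

lemma subalg_diff: "cstar_subalgebra S \<Longrightarrow> x \<in> S \<Longrightarrow> y \<in> S \<Longrightarrow> x - y \<in> S"
  using subalg_add[of S x "- y"] subalg_minus[of S y] by simp

lemma subalg_scaleR: "cstar_subalgebra S \<Longrightarrow> x \<in> S \<Longrightarrow> r *\<^sub>R x \<in> S"
  by (simp add: scaleR_conv_scaleC subalg_scaleC)

lemma subalg_sum: "cstar_subalgebra S \<Longrightarrow> (\<And>i. i \<in> A \<Longrightarrow> f i \<in> S) \<Longrightarrow> (\<Sum>i\<in>A. f i) \<in> S"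
  by (induction A rule: infinite_finite_induct) (auto intro: subalg_zero subalg_add)

lemma subalg_power: "cstar_subalgebra S \<Longrightarrow> x \<in> S \<Longrightarrow> x ^ n \<in> S"
  by (induction n) (auto intro: subalg_one subalg_mult)

lemma subalg_prod_list: "cstar_subalgebra S \<Longrightarrow> set xs \<subseteq> S \<Longrightarrow> prod_list xs \<in> S"
  by (induction xs) (auto intro: subalg_one subalg_mult)

lemmas subalg_intros = subalg_one subalg_add subalg_mult subalg_scaleC subalg_star
  subalg_zero subalg_minus subalg_diff subalg_scaleR subalg_sum subalg_power

lemma cstar_subalgebra_Inter:
  "(\<And>S. S \<in> \<S> \<Longrightarrow> cstar_subalgebra S) \<Longrightarrow> cstar_subalgebra (\<Inter>\<S>)"
  by (auto simp: cstar_subalgebra_def)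

lemma cstar_subalgebra_hull: "cstar_subalgebra (cstar_subalgebra hull X)"
  unfolding hull_def by (rule cstar_subalgebra_Inter) simp

lemma cstar_subalgebra_closure:
  fixes S :: "'a::cstar_algebra set"
  assumes "1 \<in> S" "\<And>x y. x \<in> S \<Longrightarrow> y \<in> S \<Longrightarrow> x + y \<in> S"
    "\<And>x y. x \<in> S \<Longrightarrow> y \<in> S \<Longrightarrow> x * y \<in> S"
    "\<And>c x. x \<in> S \<Longrightarrow> c *\<^sub>C x \<in> S" "\<And>x. x \<in> S \<Longrightarrow> star x \<in> S"
  shows "cstar_subalgebra (closure S)"
proof (rule cstar_subalgebraI)
  show "1 \<in> closure S" using assms(1) closure_subset by blast
  show "closed (closure S)" by simp
  fix x y assume "x \<in> closure S" "y \<in> closure S"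
  then obtain f g where f: "\<And>n. f n \<in> S" "f \<longlonglongrightarrow> x" and g: "\<And>n. g n \<in> S" "g \<longlonglongrightarrow> y"
    by (metis closure_sequential)
  show "x + y \<in> closure S"
    unfolding closure_sequential using f g assms(2)
    by (intro exI[of _ "\<lambda>n. f n + g n"]) (auto intro: tendsto_add)
  show "x * y \<in> closure S"
    unfolding closure_sequential using f g assms(3)
    by (intro exI[of _ "\<lambda>n. f n * g n"]) (auto intro: tendsto_mult)
next
  fix c x assume "x \<in> closure S"
  then obtain f where f: "\<And>n. f n \<in> S" "f \<longlonglongrightarrow> x"
    by (metis closure_sequential)
  show "c *\<^sub>C x \<in> closure S"
    unfolding closure_sequential using f assms(4)
    by (intro exI[of _ "\<lambda>n. c *\<^sub>C f n"]) (auto intro: tendsto_scaleC)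
  show "star x \<in> closure S"
    unfolding closure_sequential using f assms(5)
    by (intro exI[of _ "\<lambda>n. star (f n)"]) (auto intro: tendsto_star)
qed

section \<open>Square roots and automatic contractivity\<close>

lemma abs_half_gchoose_le_1: "\<bar>(1/2::real) gchoose n\<bar> \<le> 1"
proof (induction n)
  case (Suc n)
  have "(real n + 1) * ((1/2::real) gchoose (Suc n)) = (1/2 - real n) * ((1/2) gchoose n)"
    using gbinomial_absorb_comp[of "1/2::real" n] gbinomial_absorption[of n "1/2::real"] by (simp add: add.commute)
  then have "(1/2::real) gchoose (Suc n) = ((1/2) gchoose n) * ((1/2 - real n) / (real n + 1))"
    by (simp add: field_simps)
  moreover have "\<bar>(1/2 - real n) / (real n + 1)\<bar> \<le> 1"
    by (auto simp: abs_le_iff field_simps)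
  ultimately show ?case
    using Suc by (simp only: abs_mult mult_le_one abs_ge_zero)
qed simp

text \<open>The root is the binomial series with exponent 1/2. Its coefficients are at most 1 in
  modulus, so a geometric series dominates it; it converges inside \<open>S\<close> because
  \<open>S\<close> is closed. Finding the root in a prescribed \<open>S\<close> matters later, where
  \<open>S\<close> is a commutant or the even part of a region.\<close>

lemma sqrt_one_minus:
  fixes h :: "'a::cstar_algebra"
  assumes S: "cstar_subalgebra S" and h: "h \<in> S" "star h = h" "norm h < 1"
  obtains k where "k \<in> S" "star k = k" "k * k = 1 - h"
proof -
  define c where "c n = ((1/2::real) gchoose n)" for n
  define f where "f n = c n *\<^sub>R (- h) ^ n" for n
  have bd: "norm (f n) \<le> norm h ^ n" for n
  proof -
    have "norm (f n) = \<bar>c n\<bar> * norm ((- h) ^ n)" by (simp add: f_def)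
    also have "\<dots> \<le> 1 * norm (- h) ^ n"
      by (intro mult_mono norm_power_ineq) (simp_all add: c_def abs_half_gchoose_le_1)
    finally show ?thesis by simp
  qed
  have sn: "summable (\<lambda>n. norm (f n))"
    by (rule summable_comparison_test[OF _ summable_geometric[of "norm h"]])
       (use bd h in \<open>auto intro!: exI[of _ 0]\<close>)
  then have sf: "summable f" by (rule summable_norm_cancel)
  define k where "k = suminf f"
  have fk: "f sums k" using sf by (simp add: k_def summable_sums)
  have "star (f n) = f n" for n
    using h by (simp add: f_def star_scaleR star_power)
  then have "f sums star k"
    using bounded_linear.sums[OF bounded_linear_star fk] by simp
  then have star: "star k = k" using fk sums_unique2 by blast
  have fS: "f n \<in> S" for n
    unfolding f_def using S h by (intro subalg_intros)
  have kS: "k \<in> S"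
    using fk closed_sequentially[OF subalg_closed[OF S], of "\<lambda>n. \<Sum>i<n. f i"] subalg_sum[OF S, of _ f] fS
    unfolding sums_def by simp
  have "(\<lambda>n. \<Sum>i\<le>n. f i * f (n - i)) sums (k * k)"
    unfolding k_def by (rule Cauchy_product_sums[OF sn sn])
  \<comment> \<open>By Vandermonde the coefficients of the squared series are those of exponent 1/2
    + 1/2 = 1, which vanish from the quadratic term on.\<close>
  moreover have "(\<Sum>i\<le>n. f i * f (n - i)) = (if n \<in> {0,1} then ((1::real) gchoose n) *\<^sub>R (- h) ^ n else 0)" for n
  proof -
    have "(\<Sum>i\<le>n. f i * f (n - i)) = (\<Sum>i\<le>n. c i * c (n - i)) *\<^sub>R (- h) ^ n"
      unfolding scaleR_left.sum
    proof (rule sum.cong)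
      fix i assume "i \<in> {..n}"
      then have "(- h) ^ i * (- h) ^ (n - i) = (- h) ^ n"
        by (simp flip: power_add)
      then show "f i * f (n - i) = (c i * c (n - i)) *\<^sub>R (- h) ^ n"
        by (simp add: f_def)
    qed simp
    also have "(\<Sum>i\<le>n. c i * c (n - i)) = ((1::real) gchoose n)"
      using gbinomial_Vandermonde[of "1/2::real" "1/2" n] by (simp add: c_def atMost_atLeast0)
    also have "((1::real) gchoose n) *\<^sub>R (- h) ^ n
      = (if n \<in> {0,1} then ((1::real) gchoose n) *\<^sub>R (- h) ^ n else 0)"
      using binomial_gbinomial[of 1 n, where 'a=real] by (auto simp: binomial_eq_0)
    finally show ?thesis .
  qed
  ultimately have "(\<lambda>n. if n \<in> {0,1} then ((1::real) gchoose n) *\<^sub>R (- h) ^ n else 0) sums (k * k)"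
    by simp
  moreover have "(\<lambda>n. if n \<in> {0,1} then ((1::real) gchoose n) *\<^sub>R (- h) ^ n else 0) sums
      (\<Sum>n\<in>{0,1}. ((1::real) gchoose n) *\<^sub>R (- h) ^ n)"
    by (rule sums_If_finite_set) simp
  ultimately have "k * k = 1 - h"
    by (auto dest: sums_unique2)
  then show ?thesis
    using that kS star by blast
qed

text \<open>For a self-adjoint strict contraction \<open>h\<close> the element \<open>h + i (1 - h\<^sup>2)\<^sup>1\<^sup>/\<^sup>2\<close>
  is unitary, and a unital *-homomorphism maps it to a unitary with real part \<open>\<theta> h\<close>.\<close>

lemma cstar_automorphism_contractive:
  fixes \<theta> :: "'a::cstar_algebra \<Rightarrow> 'a"
  assumes "cstar_automorphism \<theta>"
  shows "norm (\<theta> x) \<le> norm x"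
proof -
  have add: "\<theta> (x + y) = \<theta> x + \<theta> y" and scale: "\<theta> (c *\<^sub>C x) = c *\<^sub>C \<theta> x"
    and mult: "\<theta> (x * y) = \<theta> x * \<theta> y" and star: "\<theta> (star x) = star (\<theta> x)"
    and "surj \<theta>" for x y c
    using assms by (auto simp: cstar_automorphism_def bij_def)
  then have one: "\<theta> 1 = 1"
    by (metis mult.left_neutral mult.right_neutral surjD)
  have sa: "norm (\<theta> h) \<le> 1" if h: "star h = h" "norm h < 1" for h
  proof -
    \<comment> \<open>Taking the root inside the commutant of \<open>h\<close> makes it commute with
      \<open>h\<close>, so the cross terms of \<open>star w * w\<close> cancel below.\<close>
    let ?S = "{z. z * h = h * z}"
    have S: "cstar_subalgebra ?S"
    proof (rule cstar_subalgebraI)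
      show "closed ?S" by (intro closed_Collect_eq continuous_intros)
      show "star z \<in> ?S" if "z \<in> ?S" for z
        using that h by simp (metis star_mult)
      show "x * y \<in> ?S" if "x \<in> ?S" "y \<in> ?S" for x y
        using that by simp (metis mult.assoc)
    qed (simp_all add: algebra_simps mult_scaleC_left mult_scaleC_right)
    have "norm (h * h) < 1"
      using norm_mult_ineq[of h h] h mult_strict_mono'[of "norm h" 1 "norm h" 1] by simp
    then obtain k where k: "star k = k" "k * k = 1 - h * h" "k * h = h * k"
      using sqrt_one_minus[OF S, of "h * h"] h by (auto simp: star_mult mult.assoc)
    define g l where "g = \<theta> h" and "l = \<theta> k"
    have gl: "star g = g" "star l = l" "g * g + l * l = 1" "l * g = g * l"
      unfolding g_def l_def using h k add mult star one
      by (metis diff_add_cancel add.commute)+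
    define w where "w = g + \<i> *\<^sub>C l"
    have sw: "star w = g - \<i> *\<^sub>C l"
      by (simp add: w_def star_add star_scaleC gl)
    have "star w * w = g * g + l * l"
      unfolding sw unfolding w_def using gl(4)
      by (simp add: algebra_simps mult_scaleC_left mult_scaleC_right scaleC_scaleC scaleC_diff_right scaleC_add_right)
    then have "star w * w = 1" by (simp add: gl)
    then have w: "norm w = 1" by (rule norm_isometry)
    have "2 *\<^sub>R g = w + star w"
      unfolding sw by (simp add: w_def scaleR_2)
    then have "2 * norm g \<le> 2"
      using norm_triangle_ineq[of w "star w"] w by (metis norm_scaleR norm_star abs_numeral one_add_one)
    then show ?thesis by (simp add: g_def)
  qed
  have sa': "norm (\<theta> h) \<le> norm h" if h: "star h = h" for h
  proof (rule field_le_epsilon)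
    fix e :: real assume e: "e > 0"
    define r where "r = norm h + e"
    have r: "r > 0" "norm h < r" using e by (auto simp: r_def add_nonneg_pos)
    have "norm (\<theta> (inverse r *\<^sub>R h)) \<le> 1"
      using r h by (intro sa) (simp_all add: star_scaleR field_simps)
    then have "norm (\<theta> h) \<le> r"
      using r by (simp add: scaleR_conv_scaleC scale norm_scaleC norm_divide field_simps)
    then show "norm (\<theta> h) \<le> norm h + e" by (simp add: r_def)
  qed
  have "(norm (\<theta> x))\<^sup>2 = norm (\<theta> (star x * x))"
    by (simp add: mult star norm_star_mult_self)
  also have "\<dots> \<le> norm (star x * x)"
    by (rule sa') (simp add: star_mult star_star)
  finally show ?thesis
    by (simp add: norm_star_mult_self)
qed

section \<open>States\<close>

text \<open>States without normalisation: perturbing or rescaling a state leaves the set of states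
  but not the cone of positive functionals.\<close>

definition positive_on :: "'a::cstar_algebra set \<Rightarrow> ('a \<Rightarrow> complex) \<Rightarrow> bool" where
  "positive_on S F \<longleftrightarrow>
     (\<forall>x\<in>S. \<forall>y\<in>S. F (x + y) = F x + F y) \<and> (\<forall>c. \<forall>x\<in>S. F (c *\<^sub>C x) = c * F x) \<and>
     (\<forall>x\<in>S. F (star x * x) \<in> \<real>\<^sub>\<ge>\<^sub>0)"

lemma state_on_iff_positive_on: "state_on S F \<longleftrightarrow> positive_on S F \<and> F 1 = 1"
  by (auto simp: state_on_def positive_on_def)

lemma
  assumes "positive_on S F"
  shows positive_on_add: "x \<in> S \<Longrightarrow> y \<in> S \<Longrightarrow> F (x + y) = F x + F y"
    and positive_on_scaleC: "x \<in> S \<Longrightarrow> F (c *\<^sub>C x) = c * F x"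
    and positive_on_star_mult: "x \<in> S \<Longrightarrow> F (star x * x) \<in> \<real>\<^sub>\<ge>\<^sub>0"
  using assms by (auto simp: positive_on_def)

lemma positive_on_minus: "positive_on S F \<Longrightarrow> x \<in> S \<Longrightarrow> F (- x) = - F x"
  using positive_on_scaleC[of S F x "-1"] by simp

lemma
  assumes "cstar_subalgebra S" "positive_on S F"
  shows positive_on_diff: "x \<in> S \<Longrightarrow> y \<in> S \<Longrightarrow> F (x - y) = F x - F y"
    and positive_on_zero: "F 0 = 0"
  using assms positive_on_add[of S F x "- y"] positive_on_minus[of S F y] subalg_minus[of S y]
    positive_on_scaleC[of S F 1 0] subalg_one[of S]
  by auto

lemma positive_on_sum:
  assumes "cstar_subalgebra S" "positive_on S F"
  shows "(\<And>i. i \<in> A \<Longrightarrow> f i \<in> S) \<Longrightarrow> F (\<Sum>i\<in>A. f i) = (\<Sum>i\<in>A. F (f i))"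
proof (induction A rule: infinite_finite_induct)
  case (insert i A)
  then show ?case
    using assms by (simp add: positive_on_add subalg_sum)
qed (use assms in \<open>simp_all add: positive_on_zero\<close>)

lemma state_on_positive: "state_on S F \<Longrightarrow> positive_on S F"
  and state_on_one: "state_on S F \<Longrightarrow> F 1 = 1"
  by (auto simp: state_on_iff_positive_on)

lemma state_on_subset: "state_on S F \<Longrightarrow> T \<subseteq> S \<Longrightarrow> state_on T F"
  unfolding state_on_def by (meson subsetD)

text \<open>Polarisation: the value at \<open>star (1 + c *\<^sub>C x) * (1 + c *\<^sub>C x)\<close>
  is real, and the choices 1 and \<i> for \<open>c\<close> determine the imaginary and the real part
  of the difference.\<close>

lemma positive_on_star:
  assumes S: "cstar_subalgebra S" and F: "positive_on S F" and x: "x \<in> S"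
  shows "F (star x) = cnj (F x)"
proof -
  have exp: "F (star (1 + c *\<^sub>C x) * (1 + c *\<^sub>C x))
      = F 1 + c * F x + cnj c * F (star x) + cnj c * c * F (star x * x)" for c
  proof -
    have "star (1 + c *\<^sub>C x) * (1 + c *\<^sub>C x)
      = 1 + c *\<^sub>C x + cnj c *\<^sub>C star x + (cnj c * c) *\<^sub>C (star x * x)"
      by (simp add: star_add star_scaleC mult_scaleC_left mult_scaleC_right scaleC_scaleC
          algebra_simps scaleC_add_right)
    then show ?thesis
      using S F x by (simp add: positive_on_add positive_on_scaleC subalg_intros)
  qed
  have mem: "1 + c *\<^sub>C x \<in> S" for c using S x by (intro subalg_intros)
  have xx: "Im (F (star x * x)) = 0" and one: "Im (F 1) = 0"
    using positive_on_star_mult[OF F x] positive_on_star_mult[OF F subalg_one[OF S]]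
    by (auto simp: complex_nonneg_Reals_iff)
  have "Im (F (star (1 + c *\<^sub>C x) * (1 + c *\<^sub>C x))) = 0" for c
    using positive_on_star_mult[OF F mem] by (auto simp: complex_nonneg_Reals_iff)
  from this[of 1] this[of \<i>] show ?thesis
    unfolding exp using xx one by (simp add: complex_eq_iff)
qed

lemma positive_on_selfadjoint:
  assumes "cstar_subalgebra S" "positive_on S F" "x \<in> S" "star x = x"
  shows "F x \<in> \<real>"
  using positive_on_star[OF assms(1-3)] assms(4) by (metis Reals_cnj_iff)

text \<open>The variance of \<open>x\<close>, that is the value at \<open>star y * y\<close> with
  \<open>y = x - F x *\<^sub>C 1\<close>, is nonnegative.\<close>

lemma norm_state_on_square_le:
  assumes S: "cstar_subalgebra S" and F: "state_on S F" and x: "x \<in> S"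
  shows "(cmod (F x))\<^sup>2 \<le> Re (F (star x * x))"
proof -
  define c where "c = F x"
  note P = state_on_positive[OF F]
  have "star (x - c *\<^sub>C 1) * (x - c *\<^sub>C 1)
      = star x * x - c *\<^sub>C star x - cnj c *\<^sub>C x + (cnj c * c) *\<^sub>C 1"
    by (simp add: star_diff star_scaleC mult_scaleC_left mult_scaleC_right scaleC_scaleC
        algebra_simps scaleC_diff_right)
  then have "F (star (x - c *\<^sub>C 1) * (x - c *\<^sub>C 1))
      = F (star x * x) - c * cnj c - cnj c * c + cnj c * c"
    using S P x F by (simp add: positive_on_add[OF P] positive_on_diff[OF S P] c_def
        positive_on_scaleC[OF P] positive_on_star[OF S P] subalg_intros state_on_one)
  moreover have "F (star (x - c *\<^sub>C 1) * (x - c *\<^sub>C 1)) \<in> \<real>\<^sub>\<ge>\<^sub>0"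
    using S x by (intro positive_on_star_mult[OF P] subalg_intros)
  ultimately have "0 \<le> Re (F (star x * x) - c * cnj c)"
    by (simp add: complex_nonneg_Reals_iff)
  then show ?thesis
    unfolding c_def by (simp flip: complex_norm_square)
qed

text \<open>For a strict contraction \<open>y\<close> the element \<open>1 - star y * y\<close> is
  the square of a self-adjoint \<open>k\<close>, so \<open>F (star y * y)\<close> is at most 1, and
  the variance inequality bounds \<open>F y\<close>. The slack \<open>e\<close> turns
  \<open>x\<close> into a strict contraction after scaling.\<close>

lemma norm_state_on_le:
  assumes S: "cstar_subalgebra S" and F: "state_on S F" and x: "x \<in> S"
  shows "cmod (F x) \<le> norm x"
proof (rule field_le_epsilon)
  fix e :: real assume e: "e > 0"
  note P = state_on_positive[OF F]
  define r where "r = norm x + e"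
  have r: "r > 0" "norm x < r" using e by (auto simp: r_def add_nonneg_pos)
  define y where "y = inverse r *\<^sub>R x"
  have y: "y \<in> S" "norm y < 1"
    using S x r by (auto simp: y_def subalg_scaleR field_simps)
  have "norm (star y * y) < 1"
    using y by (simp add: norm_star_mult_self power_less_one_iff)
  then obtain k where k: "k \<in> S" "star k = k" "k * k = 1 - star y * y"
    using sqrt_one_minus[OF S, of "star y * y"] y S by (auto simp: star_mult star_star subalg_intros)
  have "F (k * k) \<in> \<real>\<^sub>\<ge>\<^sub>0"
    using positive_on_star_mult[OF P k(1)] k by simp
  then have "Re (F (star y * y)) \<le> 1"
    using S y F by (simp add: k positive_on_diff[OF S P] subalg_intros state_on_one
        complex_nonneg_Reals_iff)
  then have "(cmod (F y))\<^sup>2 \<le> 1"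
    using norm_state_on_square_le[OF S F y(1)] by linarith
  then have "cmod (F y) \<le> 1" by (simp add: abs_square_le_1)
  then have "cmod (F x) \<le> r"
    using r x by (simp add: y_def scaleR_conv_scaleC positive_on_scaleC[OF P] norm_mult norm_divide field_simps)
  then show "cmod (F x) \<le> norm x + e" by (simp add: r_def)
qed

lemma state_on_tendsto:
  assumes S: "cstar_subalgebra S" and F: "state_on S F" and f: "\<And>n. f n \<in> S" "f \<longlonglongrightarrow> x"
  shows "(\<lambda>n. F (f n)) \<longlonglongrightarrow> F x"
proof -
  have x: "x \<in> S" using f closed_sequentially[OF subalg_closed[OF S]] by blast
  have "(\<lambda>n. norm (f n - x)) \<longlonglongrightarrow> 0"
    using f(2) by (simp add: LIM_zero_iff tendsto_norm_zero_iff)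
  then have "(\<lambda>n. F (f n) - F x) \<longlonglongrightarrow> 0"
  proof (rule Lim_null_comparison[rotated])
    show "\<forall>\<^sub>F n in sequentially. norm (F (f n) - F x) \<le> norm (f n - x)"
      using norm_state_on_le[OF S F, of "f _ - x"] f(1) x S
      by (simp add: positive_on_diff[OF S state_on_positive[OF F]] subalg_intros)
  qed
  then show ?thesis by (simp add: LIM_zero_iff)
qed

text \<open>The value at \<open>star x * x\<close> is that of \<open>F\<close> at
  \<open>star (x * z) * (x * z)\<close>. Here \<open>z\<close> may lie outside \<open>S\<close>,
  typically in another region, so positivity on the larger algebra \<open>R\<close> is what
  counts.\<close>

lemma positive_on_conjugate:
  assumes R: "cstar_subalgebra R" and F: "positive_on R F" and "S \<subseteq> R" "z \<in> R"
  shows "positive_on S (\<lambda>x. F (star z * x * z))"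
  unfolding positive_on_def
proof (intro conjI ballI allI)
  fix x y assume "x \<in> S" "y \<in> S"
  then have "x \<in> R" "y \<in> R" using assms by auto
  then show "F (star z * (x + y) * z) = F (star z * x * z) + F (star z * y * z)"
    using assms by (simp add: algebra_simps positive_on_add[OF F] subalg_intros)
next
  fix c x assume "x \<in> S"
  then have "x \<in> R" using assms by auto
  then show "F (star z * (c *\<^sub>C x) * z) = c * F (star z * x * z)"
    using assms by (simp add: mult_scaleC_left mult_scaleC_right positive_on_scaleC[OF F] subalg_intros)
next
  fix x assume "x \<in> S"
  then have "x \<in> R" using assms by auto
  then have "F (star (x * z) * (x * z)) \<in> \<real>\<^sub>\<ge>\<^sub>0"
    using assms by (intro positive_on_star_mult[OF F] subalg_intros)
  then show "F (star z * (star x * x) * z) \<in> \<real>\<^sub>\<ge>\<^sub>0"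
    by (simp add: star_mult mult.assoc)
qed

section \<open>Perturbing a state whose restriction is pure\<close>

lemma positive_on_scale:
  assumes "cstar_subalgebra S" "positive_on S F" "r \<ge> 0"
  shows "positive_on S (\<lambda>x. complex_of_real r * F x)"
  using assms unfolding positive_on_def
  by (simp add: algebra_simps nonneg_Reals_mult_I)

text \<open>A positive functional dominated by a multiple of a pure state is proportional to it.
  Dividing \<open>F\<close> and \<open>G\<close> by their values \<open>p\<close> and
  \<open>q\<close> at 1 exhibits \<open>\<phi>\<close> as a convex combination of two states with
  weight \<open>p / (p + q)\<close>, to which extremality applies.\<close>

lemma pure_on_dominated:
  assumes S: "cstar_subalgebra S" and pure: "pure_on S \<phi>"
    and F: "positive_on S F" and G: "positive_on S G"
    and sum: "\<And>x. x \<in> S \<Longrightarrow> F x + G x = c * \<phi> x"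
    and pos: "Re (F 1) > 0" "Re (G 1) > 0" and x: "x \<in> S"
  shows "F x = F 1 * \<phi> x"
proof -
  have real: "H 1 = complex_of_real (Re (H 1))" if "positive_on S H" for H
    using positive_on_star_mult[OF that subalg_one[OF S]]
    by (simp add: complex_nonneg_Reals_iff complex_eq_iff)
  define p q where "p = Re (F 1)" and "q = Re (G 1)"
  have pq: "F 1 = of_real p" "G 1 = of_real q" "p > 0" "q > 0"
    using real F G pos by (auto simp: p_def q_def)
  have \<phi>: "state_on S \<phi>" using pure by (simp add: pure_on_def)
  have c: "c = of_real (p + q)"
    using sum[OF subalg_one[OF S]] pq state_on_one[OF \<phi>] by simp
  have st: "state_on S (\<lambda>x. of_real (inverse p) * F x)" "state_on S (\<lambda>x. of_real (inverse q) * G x)"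
    unfolding state_on_iff_positive_on using pq positive_on_scale[OF S F, of "inverse p"]
      positive_on_scale[OF S G, of "inverse q"] by auto
  have t: "0 < p / (p + q)" "p / (p + q) < 1" using pq by auto
  have "states_eq_on S \<phi> (\<lambda>x. complex_of_real (p / (p + q)) * (of_real (inverse p) * F x)
      + complex_of_real (1 - p / (p + q)) * (of_real (inverse q) * G x))"
    unfolding states_eq_on_def
  proof
    fix x assume x: "x \<in> S"
    have one: "complex_of_real (p / (p + q)) * of_real (inverse p) = of_real (inverse (p + q))"
      using pq by (simp add: field_simps flip: of_real_mult)
    have "1 - p / (p + q) = q / (p + q)" using pq by (simp add: field_simps)
    then have two: "complex_of_real (1 - p / (p + q)) * of_real (inverse q) = of_real (inverse (p + q))"
      using pq by (simp add: field_simps flip: of_real_mult)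
    have "of_real (inverse (p + q)) * F x + of_real (inverse (p + q)) * G x
       = of_real (inverse (p + q)) * (c * \<phi> x)"
      using sum[OF x] by (simp flip: distrib_left)
    also have "\<dots> = \<phi> x"
    proof -
      have "inverse (p + q) * (p + q) = 1" using pq by simp
      then have "complex_of_real (inverse (p + q)) * of_real (p + q) = 1"
        by (simp only: flip: of_real_mult) simp
      then show ?thesis unfolding c mult.assoc[symmetric] by simp
    qed
    finally show "\<phi> x = complex_of_real (p / (p + q)) * (of_real (inverse p) * F x)
      + complex_of_real (1 - p / (p + q)) * (of_real (inverse q) * G x)"
      using one two by (simp only: mult.assoc[symmetric])
  qed
  then have "states_eq_on S (\<lambda>x. of_real (inverse p) * F x) \<phi>"
    using pure st t unfolding pure_on_def by blast
  then show ?thesis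
    using x pq by (auto simp: states_eq_on_def field_simps)
qed

text \<open>For a self-adjoint strict contraction \<open>h \<in> T\<close> the functionals
  \<open>x \<mapsto> \<psi> (x (1 \<plusminus> h))\<close> on \<open>S\<close> are positive and sum to \<open>2 \<phi>\<close>.\<close>

lemma pure_on_product_commuting:
  assumes R: "cstar_subalgebra R" and S: "cstar_subalgebra S" "S \<subseteq> R"
    and T: "cstar_subalgebra T" "T \<subseteq> R"
    and comm: "\<And>x y. x \<in> S \<Longrightarrow> y \<in> T \<Longrightarrow> x * y = y * x"
    and \<psi>: "state_on R \<psi>" and \<phi>: "pure_on S \<phi>" "states_eq_on S \<psi> \<phi>"
    and x: "x \<in> S" and y: "y \<in> T"
  shows "\<psi> (x * y) = \<phi> x * \<psi> y"
proof -
  note P = state_on_positive[OF \<psi>]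
  have sa: "\<psi> (x * h) = \<phi> x * \<psi> h" if h: "h \<in> T" "star h = h" "norm h < 1" for h
  proof -
    \<comment> \<open>The roots lie in \<open>T\<close> and hence commute with \<open>x\<close>;
      this rewrites \<open>x * (1 - h)\<close> as the conjugate \<open>star k * x * k\<close>, whose
      positivity is known.\<close>
    obtain k where k: "k \<in> T" "star k = k" "k * k = 1 - h"
      using sqrt_one_minus[OF T(1) h] .
    obtain l where l: "l \<in> T" "star l = l" "l * l = 1 + h"
      using sqrt_one_minus[OF T(1), of "- h"] h T(1) by (auto simp: subalg_intros)
    have move: "\<psi> (star k * x * k) = \<psi> (x * (k * k))" if "x \<in> S" "k \<in> T" "star k = k" for x k
      using comm[OF that(1,2)] that(3) by (metis mult.assoc)
    have kF: "\<psi> (star k * x * k) = \<psi> x - \<psi> (x * h)" if "x \<in> S" for x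
      unfolding move[OF that k(1,2)] k(3) using that h S T R
      by (simp add: algebra_simps positive_on_diff[OF R P] subalg_intros subset_eq)
    have lF: "\<psi> (star l * x * l) = \<psi> x + \<psi> (x * h)" if "x \<in> S" for x
      unfolding move[OF that l(1,2)] l(3) using that h S T R
      by (simp add: algebra_simps positive_on_add[OF P] subalg_intros subset_eq)
    have bd: "cmod (\<psi> h) < 1"
      using norm_state_on_le[OF R \<psi>, of h] h T by fastforce
    then have bd': "\<bar>Re (\<psi> h)\<bar> < 1"
      using abs_Re_le_cmod[of "\<psi> h"] by linarith
    have "\<psi> (star k * x * k) = \<psi> (star k * 1 * k) * \<phi> x"
    proof (rule pure_on_dominated[OF S(1) \<phi>(1) _ _ _ _ _ x, where c = 2])
      show "positive_on S (\<lambda>x. \<psi> (star k * x * k))" "positive_on S (\<lambda>x. \<psi> (star l * x * l))"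
        using positive_on_conjugate[OF R P S(2), of k] positive_on_conjugate[OF R P S(2), of l] k(1) l(1) T(2)
        by blast+
      show "\<psi> (star k * x * k) + \<psi> (star l * x * l) = 2 * \<phi> x" if "x \<in> S" for x
        using that \<phi>(2) by (simp add: kF lF states_eq_on_def)
      show "0 < Re (\<psi> (star k * 1 * k))" "0 < Re (\<psi> (star l * 1 * l))"
        using bd' state_on_one[OF \<psi>] kF[OF subalg_one[OF S(1)]] lF[OF subalg_one[OF S(1)]] by auto
    qed
    then have "\<psi> x - \<psi> (x * h) = (\<psi> 1 - \<psi> (1 * h)) * \<phi> x"
      unfolding kF[OF x] kF[OF subalg_one[OF S(1)]] .
    then show ?thesis
      using x \<phi>(2) state_on_one[OF \<psi>]
      by (simp add: algebra_simps states_eq_on_def)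
  qed
  \<comment> \<open>The factor \<open>r\<close> makes the real and imaginary parts \<open>h1\<close>
    and \<open>h2\<close> of \<open>r *\<^sub>R y\<close> strict contractions, as the self-adjoint
    case requires.\<close>
  define r where "r = inverse (norm y + 1)"
  have r: "r > 0" "r * norm y < 1"
    by (auto simp: r_def field_simps add_pos_nonneg add_nonneg_pos)
  define h1 h2 where "h1 = (r/2) *\<^sub>R (y + star y)" and "h2 = (r/2) *\<^sub>R (\<i> *\<^sub>C (star y - y))"
  have hT: "h1 \<in> T" "h2 \<in> T"
    using T y by (auto simp: h1_def h2_def intro!: subalg_intros)
  have hs: "star h1 = h1" "star h2 = h2"
    by (simp_all add: h1_def h2_def star_scaleR star_add star_diff star_scaleC star_star
        add.commute flip: scaleC_minus_right)
  have "norm h1 \<le> r * norm y" "norm h2 \<le> r * norm y"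
    using norm_triangle_ineq[of y "star y"] norm_triangle_ineq4[of "star y" y] r(1)
    by (simp_all add: h1_def h2_def norm_scaleC mult.commute mult_left_mono)
  then have hn: "norm h1 < 1" "norm h2 < 1" using r by linarith+
  have "\<i> *\<^sub>C (\<i> *\<^sub>C w) = - w" for w :: 'a by (simp add: scaleC_scaleC)
  then have "h1 + \<i> *\<^sub>C h2 = r *\<^sub>R y"
    by (simp add: h1_def h2_def scaleR_conv_scaleC scaleC_scaleC scaleC_add_right scaleC_diff_right
        flip: scaleC_add_left) (simp add: algebra_simps flip: scaleC_add_left)
  then have ry: "h1 + \<i> *\<^sub>C h2 = of_real r *\<^sub>C y" by (simp add: scaleR_conv_scaleC)
  have mem: "x \<in> R" "y \<in> R" "h1 \<in> R" "h2 \<in> R" using x y hT S T by auto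
  have "of_real r * \<psi> (x * y) = \<psi> (x * (of_real r *\<^sub>C y))"
    using R mem by (simp add: mult_scaleC_right positive_on_scaleC[OF P] subalg_intros)
  also have "\<dots> = \<psi> (x * h1) + \<i> * \<psi> (x * h2)"
    using R mem by (simp add: algebra_simps mult_scaleC_right positive_on_scaleC[OF P]
        positive_on_add[OF P] subalg_intros flip: ry)
  also have "\<dots> = \<phi> x * (\<psi> h1 + \<i> * \<psi> h2)"
    using sa[OF hT(1) hs(1) hn(1)] sa[OF hT(2) hs(2) hn(2)] by (simp add: algebra_simps)
  also have "\<psi> h1 + \<i> * \<psi> h2 = \<psi> (of_real r *\<^sub>C y)"
    using R mem by (simp add: positive_on_scaleC[OF P] positive_on_add[OF P] subalg_intros flip: ry)
  also have "\<dots> = of_real r * \<psi> y"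
    using mem by (simp add: positive_on_scaleC[OF P])
  finally show ?thesis using r by simp
qed

text \<open>For even \<open>\<phi>\<close> and odd \<open>y\<close> the functionals
  \<open>x \<mapsto> \<psi> ((1 \<plusminus> \<kappa> y)\<^sup>* x (1 \<plusminus> \<kappa> y))\<close> sum to a multiple of \<open>\<phi>\<close>, because their terms
  linear in \<open>\<kappa>\<close> cancel.\<close>

lemma pure_on_product_anticommuting:
  assumes R: "cstar_subalgebra R" and S: "cstar_subalgebra S" "S \<subseteq> R"
    and \<psi>: "state_on R \<psi>" and \<phi>: "pure_on S \<phi>" "states_eq_on S \<psi> \<phi>"
    and y: "y \<in> R" "star y = y"
    and conj: "\<And>x. x \<in> S \<Longrightarrow> \<psi> (y * x * y) = c * \<phi> x"
    and x: "x \<in> S"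
  shows "\<psi> (x * y) = \<phi> x * \<psi> y"
proof -
  note P = state_on_positive[OF \<psi>]
  obtain p where p: "\<psi> y = complex_of_real p"
    using positive_on_selfadjoint[OF R P y] by (auto elim: Reals_cases)
  have "c = \<psi> (y * y)"
    using conj[OF subalg_one[OF S(1)]] \<phi>(1) state_on_one[of S \<phi>] by (simp add: pure_on_def)
  then have c: "c = of_real (Re c)" "Re c \<ge> 0"
    using positive_on_star_mult[OF P y(1)] y(2)
    by (auto simp: complex_nonneg_Reals_iff complex_eq_iff)
  \<comment> \<open>The smallness condition keeps the values of both perturbed functionals at 1
    positive. Proportionality to \<open>\<phi>\<close> then fixes the part linear in the
    parameter.\<close>
  have key: "\<kappa> * \<psi> (x * y) + cnj \<kappa> * \<psi> (y * x) = of_real (2 * Re \<kappa> * p) * \<phi> x"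
    if \<kappa>: "2 * \<bar>Re \<kappa> * p\<bar> < 1" for \<kappa>
  proof -
    define z where "z \<mu> = 1 + \<mu> *\<^sub>C y" for \<mu>
    have zR: "z \<mu> \<in> R" for \<mu> using R y by (auto simp: z_def intro!: subalg_intros)
    have F: "\<psi> (star (z \<mu>) * x * z \<mu>)
        = \<phi> x + \<mu> * \<psi> (x * y) + cnj \<mu> * \<psi> (y * x) + cnj \<mu> * \<mu> * (c * \<phi> x)" if "x \<in> S" for \<mu> x
    proof -
      have xR: "x \<in> R" using that S by auto
      have "star (z \<mu>) * x * z \<mu>
        = x + \<mu> *\<^sub>C (x * y) + cnj \<mu> *\<^sub>C (y * x) + (cnj \<mu> * \<mu>) *\<^sub>C (y * x * y)"
        by (simp add: z_def star_add star_scaleC y mult_scaleC_left mult_scaleC_right scaleC_scaleC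
            algebra_simps scaleC_add_right)
      then show ?thesis
        using R xR y that conj[OF that] \<phi>(2)
        by (simp add: positive_on_add[OF P] positive_on_scaleC[OF P] subalg_intros states_eq_on_def)
    qed
    have one: "\<psi> (star (z \<mu>) * 1 * z \<mu>) = of_real (1 + 2 * Re \<mu> * p + (cmod \<mu>)\<^sup>2 * Re c)" for \<mu>
    proof -
      have "\<psi> (star (z \<mu>) * 1 * z \<mu>) = 1 + (\<mu> + cnj \<mu>) * of_real p + (\<mu> * cnj \<mu>) * c"
        unfolding F[OF subalg_one[OF S(1)]]
        using \<phi>(1) p state_on_one[of S \<phi>] by (simp add: pure_on_def algebra_simps)
      also have "\<dots> = of_real (1 + 2 * Re \<mu> * p + (cmod \<mu>)\<^sup>2 * Re c)"
        unfolding complex_add_cnj complex_norm_square[symmetric]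
        by (subst c) simp
      finally show ?thesis .
    qed
    have nn: "(cmod \<kappa>)\<^sup>2 * Re c \<ge> 0" using c by simp
    have "\<psi> (star (z \<kappa>) * x * z \<kappa>) = \<psi> (star (z \<kappa>) * 1 * z \<kappa>) * \<phi> x"
    proof (rule pure_on_dominated[OF S(1) \<phi>(1) _ _ _ _ _ x])
      show "positive_on S (\<lambda>x. \<psi> (star (z \<kappa>) * x * z \<kappa>))"
        "positive_on S (\<lambda>x. \<psi> (star (z (- \<kappa>)) * x * z (- \<kappa>)))"
        using positive_on_conjugate[OF R P S(2) zR] by auto
      show "\<psi> (star (z \<kappa>) * x * z \<kappa>) + \<psi> (star (z (- \<kappa>)) * x * z (- \<kappa>))
          = (2 * (1 + cnj \<kappa> * \<kappa> * c)) * \<phi> x" if "x \<in> S" for x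
        unfolding F[OF that] by (simp add: algebra_simps)
      show "0 < Re (\<psi> (star (z \<kappa>) * 1 * z \<kappa>))" "0 < Re (\<psi> (star (z (- \<kappa>)) * 1 * z (- \<kappa>)))"
        unfolding one using nn \<kappa> by (auto simp: abs_less_iff)
    qed
    moreover have "of_real (1 + 2 * Re \<kappa> * p + (cmod \<kappa>)\<^sup>2 * Re c)
        = 1 + of_real (2 * Re \<kappa> * p) + cnj \<kappa> * \<kappa> * c"
      by (subst (2) c) (simp add: mult.commute[of "cnj \<kappa>"] flip: complex_norm_square)
    ultimately show ?thesis
      unfolding F[OF x] one by (simp add: algebra_simps)
  qed
  \<comment> \<open>Any small positive \<open>e\<close> would do. The parameter \<open>e\<close>
    gives the sum of \<open>\<psi> (x * y)\<close> and \<open>\<psi> (y * x)\<close>; the parameter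
    \<i> times \<open>e\<close> shows that the two are equal.\<close>
  define e where "e = 1 / (4 * (\<bar>p\<bar> + 1))"
  have e: "e > 0" by (simp add: e_def add_nonneg_pos)
  have "2 * \<bar>e * p\<bar> < 1"
    by (simp add: e_def abs_mult field_simps add_nonneg_pos)
  then have 1: "of_real e * \<psi> (x * y) + of_real e * \<psi> (y * x) = of_real (2 * e * p) * \<phi> x"
    using key[of "of_real e"] by simp
  have 2: "\<i> * of_real e * \<psi> (x * y) - \<i> * of_real e * \<psi> (y * x) = 0"
    using key[of "\<i> * of_real e"] by simp
  have "complex_of_real e * (\<i> * (\<psi> (x * y) - \<psi> (y * x))) = 0"
    using 2 by (simp add: algebra_simps)
  then have "\<psi> (x * y) = \<psi> (y * x)" using e by simp
  then have "of_real e * (2 * \<psi> (x * y)) = of_real e * (2 * (\<phi> x * \<psi> y))"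
    using 1 by (simp add: p algebra_simps)
  then show ?thesis using e by simp
qed

section \<open>Clifford algebras\<close>

locale clifford =
  fixes m :: "nat \<Rightarrow> 'a::cstar_algebra"
  assumes star_m: "star (m i) = m i"
    and m_square: "m i * m i = 1"
    and m_anticommute: "i \<noteq> j \<Longrightarrow> m i * m j = - (m j * m i)"
    and hull_m: "cstar_subalgebra hull (range m) = UNIV"
begin

definition Cl :: "nat set \<Rightarrow> 'a set" where
  "Cl G = cstar_subalgebra hull (m ` G)"

lemma Cl_subalgebra: "cstar_subalgebra (Cl G)"
  unfolding Cl_def by (rule cstar_subalgebra_hull)

lemmas Cl_intros = subalg_intros[OF Cl_subalgebra]

lemma Cl_minimal: "cstar_subalgebra S \<Longrightarrow> (\<And>j. j \<in> G \<Longrightarrow> m j \<in> S) \<Longrightarrow> Cl G \<subseteq> S"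
  unfolding Cl_def by (rule hull_minimal) auto

lemma Cl_generator: "j \<in> G \<Longrightarrow> m j \<in> Cl G"
  unfolding Cl_def by (rule hull_inc) auto

lemma Cl_mono: "G \<subseteq> H \<Longrightarrow> Cl G \<subseteq> Cl H"
  unfolding Cl_def by (intro hull_mono) auto

lemma Cl_UNIV: "Cl UNIV = UNIV"
  by (simp add: Cl_def hull_m)

lemma m_mult_self: "m j * (m j * x) = x"
  by (simp flip: mult.assoc add: m_square)

subsection \<open>The parity automorphism\<close>

text \<open>Conjugation by one generator changes the sign of all the others; by a pair, it changes
  exactly the signs of these two. So \<open>u n\<close> implements the parity on the generators
  below \<open>2 * n\<close>. For Majorana generators each pair is, up to a phase, one of the
  unitaries \<open>1 - 2 a\<^sub>i\<^sup>* a\<^sub>i\<close>.\<close>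

primrec u :: "nat \<Rightarrow> 'a" where
  "u 0 = 1"
| "u (Suc n) = u n * (m (2 * n) * m (2 * n + 1))"

lemma pair_mult_m:
  assumes "k \<noteq> l"
  shows "m k * m l * m j = (if j = k \<or> j = l then - (m j * (m k * m l)) else m j * (m k * m l))"
proof -
  consider "j = k" | "j = l" "j \<noteq> k" | "j \<noteq> k" "j \<noteq> l" by blast
  then show ?thesis
  proof cases
    case 1
    then show ?thesis
      using assms m_anticommute[of l k] by (simp add: mult.assoc m_mult_self)
  next
    case 2
    then show ?thesis
      using m_anticommute[OF assms] by (simp add: mult.assoc m_square m_mult_self)
  next
    case 3
    have "m k * m l * m j = m k * (m l * m j)" by (rule mult.assoc)
    also have "\<dots> = - (m k * m j * m l)" using 3 m_anticommute[of l j] by (simp add: mult.assoc)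
    also have "\<dots> = m j * (m k * m l)" using 3 m_anticommute[of k j] by (simp add: mult.assoc)
    finally show ?thesis using 3 by simp
  qed
qed

lemma u_mult_m: "u n * m j = (if j < 2 * n then - (m j * u n) else m j * u n)"
proof (induction n)
  case (Suc n)
  have "u (Suc n) * m j = u n * (m (2 * n) * m (2 * n + 1) * m j)"
    by (simp add: mult.assoc)
  also have "\<dots> = (if j = 2 * n \<or> j = 2 * n + 1 then - (u n * m j * (m (2 * n) * m (2 * n + 1)))
      else u n * m j * (m (2 * n) * m (2 * n + 1)))"
    by (subst pair_mult_m) (simp_all add: mult.assoc)
  also have "\<dots> = (if j < 2 * Suc n then - (m j * u (Suc n)) else m j * u (Suc n))"
    unfolding Suc by (auto simp: mult.assoc)
  finally show ?case .
qed simp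

lemma u_unitary: "star (u n) * u n = 1" "u n * star (u n) = 1"
proof (induction n)
  case (Suc n)
  {
    case 1
    have "star (u (Suc n)) * u (Suc n)
        = m (2 * n + 1) * (m (2 * n) * (star (u n) * u n) * m (2 * n)) * m (2 * n + 1)"
      by (simp add: star_mult star_m mult.assoc)
    then show ?case by (simp add: Suc m_square)
  next
    case 2
    have "u (Suc n) * star (u (Suc n))
        = u n * (m (2 * n) * (m (2 * n + 1) * m (2 * n + 1)) * m (2 * n)) * star (u n)"
      by (simp add: star_mult star_m mult.assoc)
    then show ?case by (simp add: Suc m_square)
  }
qed simp_all

lemma norm_u: "norm (u n) = 1"
  by (rule norm_isometry) (rule u_unitary)

definition cv :: "nat \<Rightarrow> 'a \<Rightarrow> 'a" where
  "cv n x = u n * x * star (u n)"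

lemma cv_add: "cv n (x + y) = cv n x + cv n y"
  and cv_diff: "cv n (x - y) = cv n x - cv n y"
  and cv_scaleC: "cv n (c *\<^sub>C x) = c *\<^sub>C cv n x"
  and cv_star: "cv n (star x) = star (cv n x)"
  and cv_one: "cv n 1 = 1"
  by (simp_all add: cv_def algebra_simps mult_scaleC_left mult_scaleC_right star_mult star_star u_unitary)

lemma cv_mult: "cv n (x * y) = cv n x * cv n y"
proof -
  have "cv n x * cv n y = u n * x * (star (u n) * u n) * y * star (u n)"
    by (simp add: cv_def mult.assoc)
  then show ?thesis by (simp add: u_unitary cv_def mult.assoc)
qed

lemma norm_cv: "norm (cv n x) \<le> norm x"
proof -
  have "norm (cv n x) \<le> norm (u n * x) * norm (star (u n))"
    unfolding cv_def by (rule norm_mult_ineq)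
  also have "\<dots> \<le> norm (u n) * norm x * norm (star (u n))"
    by (intro mult_right_mono norm_mult_ineq) auto
  finally show ?thesis by (simp add: norm_u)
qed

lemma cv_m: "j < 2 * n \<Longrightarrow> cv n (m j) = - m j"
  by (simp add: cv_def u_mult_m mult.assoc u_unitary)

text \<open>On a generator the sequence is eventually constant. The elements with convergent
  sequence form a subalgebra, and it is closed by an e/3 argument since all \<open>cv n\<close> are
  contractive.\<close>

lemma convergent_cv: "convergent (\<lambda>n. cv n x)"
proof -
  let ?S = "{x. convergent (\<lambda>n. cv n x)}"
  have "cstar_subalgebra ?S"
  proof (rule cstar_subalgebraI)
    show "x + y \<in> ?S" "x * y \<in> ?S" if "x \<in> ?S" "y \<in> ?S" for x y
      using that unfolding convergent_def mem_Collect_eq cv_add cv_mult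
      by (auto intro: tendsto_add tendsto_mult)
    show "c *\<^sub>C x \<in> ?S" "star x \<in> ?S" if "x \<in> ?S" for x c
      using that unfolding convergent_def mem_Collect_eq cv_scaleC cv_star
      by (auto intro: tendsto_scaleC tendsto_star)
    show "1 \<in> ?S" by (simp add: cv_one convergent_const)
    show "closed ?S"
      unfolding closed_sequential_limits
    proof safe
      fix f x assume f: "\<forall>k. f k \<in> ?S" "f \<longlonglongrightarrow> x"
      have "Cauchy (\<lambda>n. cv n x)"
      proof (rule metric_CauchyI)
        fix e :: real assume e: "e > 0"
        then obtain k where k: "norm (f k - x) < e / 3"
          using LIMSEQ_D[OF f(2), of "e / 3"] by auto
        have "Cauchy (\<lambda>n. cv n (f k))" using f(1) by (simp add: Cauchy_convergent_iff)
        then obtain M where M: "\<And>p q. p \<ge> M \<Longrightarrow> q \<ge> M \<Longrightarrow> dist (cv p (f k)) (cv q (f k)) < e / 3"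
          using metric_CauchyD[of _ "e / 3"] e by (metis divide_pos_pos zero_less_numeral)
        have near: "dist (cv p x) (cv p (f k)) < e / 3" for p
          using norm_cv[of p "f k - x"] k by (simp add: cv_diff dist_norm norm_minus_commute)
        have "dist (cv p x) (cv q x) < e" if "p \<ge> M" "q \<ge> M" for p q
        proof -
          have "dist (cv p x) (cv q x) \<le> dist (cv p x) (cv p (f k)) + dist (cv p (f k)) (cv q (f k))
              + dist (cv q (f k)) (cv q x)"
            using dist_triangle[of "cv p x" "cv q x" "cv p (f k)"]
              dist_triangle[of "cv p (f k)" "cv q x" "cv q (f k)"] by linarith
          then show ?thesis using near[of p] near[of q] M[OF that] by (simp add: dist_commute)
        qed
        then show "\<exists>M. \<forall>p\<ge>M. \<forall>q\<ge>M. dist (cv p x) (cv q x) < e" by blast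
      qed
      then show "convergent (\<lambda>n. cv n x)" by (simp add: Cauchy_convergent_iff)
    qed
  qed
  moreover have "m j \<in> ?S" for j
  proof -
    have "\<forall>\<^sub>F n in sequentially. cv n (m j) = - m j"
      using eventually_gt_at_top[of j] by eventually_elim (rule cv_m, simp)
    then show ?thesis unfolding convergent_def by (auto intro: tendsto_eventually)
  qed
  ultimately show ?thesis
    using Cl_minimal[of ?S UNIV] Cl_UNIV by blast
qed

definition theta :: "'a \<Rightarrow> 'a" where
  "theta x = lim (\<lambda>n. cv n x)"

lemma tendsto_theta: "(\<lambda>n. cv n x) \<longlonglongrightarrow> theta x"
  using convergent_cv unfolding theta_def by (simp add: convergent_LIMSEQ_iff)

lemma theta_eqI: "(\<lambda>n. cv n x) \<longlonglongrightarrow> y \<Longrightarrow> theta x = y"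
  using LIMSEQ_unique tendsto_theta by blast

lemma theta_add: "theta (x + y) = theta x + theta y"
  by (rule theta_eqI) (simp add: cv_add tendsto_add tendsto_theta)

lemma theta_mult: "theta (x * y) = theta x * theta y"
  by (rule theta_eqI) (simp add: cv_mult tendsto_mult tendsto_theta)

lemma theta_scaleC: "theta (c *\<^sub>C x) = c *\<^sub>C theta x"
  by (rule theta_eqI) (simp add: cv_scaleC tendsto_scaleC tendsto_theta)

lemma theta_star: "theta (star x) = star (theta x)"
  by (rule theta_eqI) (simp add: cv_star tendsto_star tendsto_theta)

lemma theta_one [simp]: "theta 1 = 1"
  by (rule theta_eqI) (simp add: cv_one)

lemma theta_minus: "theta (- x) = - theta x"
  using theta_scaleC[of "-1" x] by simp

lemma theta_diff: "theta (x - y) = theta x - theta y"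
  using theta_add[of x "- y"] by (simp add: theta_minus)

lemma theta_m [simp]: "theta (m j) = - m j"
proof (rule theta_eqI[OF tendsto_eventually])
  show "\<forall>\<^sub>F n in sequentially. cv n (m j) = - m j"
    using eventually_gt_at_top[of j] by eventually_elim (rule cv_m, simp)
qed

lemma norm_theta: "norm (theta x) \<le> norm x"
  by (rule Lim_bounded[OF tendsto_norm[OF tendsto_theta]]) (simp add: norm_cv)

lemma bounded_linear_theta: "bounded_linear theta"
  by (rule bounded_linear_intro[of _ 1])
     (simp_all add: theta_add scaleR_conv_scaleC theta_scaleC norm_theta)

lemma continuous_on_theta: "continuous_on A theta"
  by (rule linear_continuous_on[OF bounded_linear_theta])

lemma theta_theta [simp]: "theta (theta x) = x"
proof -
  let ?S = "{x. theta (theta x) = x}"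
  have "cstar_subalgebra ?S"
  proof (rule cstar_subalgebraI)
    show "closed ?S"
      by (intro closed_Collect_eq continuous_intros
          continuous_on_compose2[OF continuous_on_theta[of UNIV] continuous_on_theta subset_UNIV])
  qed (simp_all add: theta_add theta_mult theta_scaleC theta_star)
  then have "Cl UNIV \<subseteq> ?S"
    by (rule Cl_minimal) (simp add: theta_minus)
  then show ?thesis using Cl_UNIV by blast
qed

lemma cstar_automorphism_theta: "cstar_automorphism theta"
  unfolding cstar_automorphism_def
  by (simp add: theta_add theta_mult theta_scaleC theta_star o_bij[of theta theta] fun_eq_iff)

lemma theta_Cl: "x \<in> Cl G \<Longrightarrow> theta x \<in> Cl G"
proof -
  have "Cl G \<subseteq> {x. theta x \<in> Cl G}"
  proof (rule Cl_minimal[OF cstar_subalgebraI])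
    show "closed {x. theta x \<in> Cl G}"
      using continuous_closed_vimage[OF subalg_closed[OF Cl_subalgebra] , of theta]
        bounded_linear_theta by (simp add: vimage_def linear_continuous_at)
  qed (simp_all add: theta_add theta_mult theta_scaleC theta_star Cl_intros Cl_generator)
  then show "x \<in> Cl G \<Longrightarrow> theta x \<in> Cl G" by blast
qed

subsection \<open>Adjoining a generator\<close>

text \<open>The automorphism that changes the sign of the generator \<open>m j\<close> only.\<close>

definition flip :: "nat \<Rightarrow> 'a \<Rightarrow> 'a" where
  "flip j x = m j * theta x * m j"

lemma flip_add: "flip j (x + y) = flip j x + flip j y"
  and flip_scaleC: "flip j (c *\<^sub>C x) = c *\<^sub>C flip j x"
  and flip_star: "flip j (star x) = star (flip j x)"
  and flip_one: "flip j 1 = 1"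
  by (simp_all add: flip_def theta_add theta_scaleC theta_star algebra_simps mult_scaleC_left
      mult_scaleC_right star_mult star_m m_square)

lemma flip_mult: "flip j (x * y) = flip j x * flip j y"
  by (simp add: flip_def theta_mult mult.assoc m_mult_self)

lemma flip_m: "flip j (m i) = (if i = j then - m i else m i)"
  using m_anticommute[of i j] by (auto simp: flip_def mult.assoc m_mult_self m_square)

lemma bounded_linear_flip: "bounded_linear (flip j)"
  unfolding flip_def
  by (intro bounded_linear_compose[OF bounded_linear_mult_left]
      bounded_linear_compose[OF bounded_linear_mult_right] bounded_linear_theta)

section \<open>Graded commutation of disjoint regions\<close>

lemma flip_Cl: "x \<in> Cl G \<Longrightarrow> j \<notin> G \<Longrightarrow> flip j x = x"
proof -
  assume j: "j \<notin> G"
  have "Cl G \<subseteq> {x. flip j x = x}"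
  proof (rule Cl_minimal[OF cstar_subalgebraI])
    show "closed {x. flip j x = x}"
      by (intro closed_Collect_eq continuous_intros linear_continuous_on bounded_linear_flip)
  qed (use j in \<open>auto simp: flip_add flip_mult flip_scaleC flip_star flip_one flip_m\<close>)
  then show "x \<in> Cl G \<Longrightarrow> flip j x = x" by blast
qed

text \<open>This is \<open>flip j x = x\<close> multiplied by \<open>m j\<close> from the
  right.\<close>

lemma Cl_mult_m: "x \<in> Cl G \<Longrightarrow> j \<notin> G \<Longrightarrow> x * m j = m j * theta x"
  using flip_Cl[of x G j] by (metis flip_def mult.assoc m_square mult.right_neutral)

text \<open>The commutant of \<open>x\<close> alone need not be closed under \<open>star\<close>;
  that of \<open>x\<close> and \<open>star x\<close> together is, and it contains the generators of
  \<open>H\<close> because they pass through an even \<open>x\<close> without a sign.\<close>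

lemma Cl_commute:
  assumes "x \<in> Cl G" "theta x = x" "y \<in> Cl H" "G \<inter> H = {}"
  shows "x * y = y * x"
proof -
  have "Cl H \<subseteq> {y. x * y = y * x \<and> star x * y = y * star x}"
  proof (rule Cl_minimal[OF cstar_subalgebraI])
    show "closed {y. x * y = y * x \<and> star x * y = y * star x}"
      by (intro closed_Collect_conj closed_Collect_eq continuous_intros)
  next
    fix y assume "y \<in> {y. x * y = y * x \<and> star x * y = y * star x}"
    then show "star y \<in> {y. x * y = y * x \<and> star x * y = y * star x}"
      by (metis (mono_tags, lifting) mem_Collect_eq star_mult star_star)
  next
    fix y z assume "y \<in> {y. x * y = y * x \<and> star x * y = y * star x}"
      "z \<in> {y. x * y = y * x \<and> star x * y = y * star x}"
    then show "y * z \<in> {y. x * y = y * x \<and> star x * y = y * star x}"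
      by simp (metis mult.assoc)
  next
    fix j assume "j \<in> H"
    then have "j \<notin> G" using assms by auto
    then show "m j \<in> {y. x * y = y * x \<and> star x * y = y * star x}"
      using Cl_mult_m[of x G j] Cl_mult_m[of "star x" G j] assms
      by (simp add: theta_star subalg_star[OF Cl_subalgebra])
  qed (simp_all add: algebra_simps mult_scaleC_left mult_scaleC_right)
  then show ?thesis using assms(3) by blast
qed

lemma Cl_commute_odd:
  assumes "x \<in> Cl G" "theta x = - x" "y \<in> Cl H" "G \<inter> H = {}"
  shows "x * y = theta y * x"
proof -
  let ?S = "{y. x * y = theta y * x \<and> star x * y = theta y * star x}"
  have sx: "theta (star x) = - star x" using assms by (simp add: theta_star)
  have "Cl H \<subseteq> ?S"
  proof (rule Cl_minimal[OF cstar_subalgebraI])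
    show "closed ?S"
      by (intro closed_Collect_conj closed_Collect_eq continuous_intros continuous_on_theta)
  next
    fix y assume y: "y \<in> ?S"
    \<comment> \<open>Taking adjoints reverses the products, so the relation for
      \<open>star y\<close> is the adjoint of a relation for \<open>theta y\<close>; applying
      \<open>theta\<close> to the assumption supplies the latter.\<close>
    have "theta (x * y) = theta (theta y * x)" "theta (star x * y) = theta (theta y * star x)"
      using y by simp_all
    then have "x * theta y = y * x" "star x * theta y = y * star x"
      using assms(2) sx by (simp_all add: theta_mult)
    then show "star y \<in> ?S"
      by simp (metis star_mult star_star theta_star)
  next
    fix y z assume "y \<in> ?S" "z \<in> ?S"
    then show "y * z \<in> ?S"
      by (simp add: theta_mult) (metis mult.assoc)
  next
    fix j assume "j \<in> H"
    then have "j \<notin> G" using assms by auto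
    then show "m j \<in> ?S"
      using Cl_mult_m[of x G j] Cl_mult_m[of "star x" G j] assms
      by (simp add: theta_star subalg_star[OF Cl_subalgebra])
  qed (simp_all add: algebra_simps mult_scaleC_left mult_scaleC_right theta_add theta_scaleC)
  then show ?thesis using assms(3) by blast
qed

text \<open>The conditional expectation onto the fixed points of \<open>flip j\<close>. Applied to
  \<open>z\<close> and to \<open>m j * z\<close> it reads off the two coefficients of
  \<open>z = x + m j * y\<close>.\<close>

definition fixpart :: "nat \<Rightarrow> 'a \<Rightarrow> 'a" where
  "fixpart j x = (1/2) *\<^sub>C (x + flip j x)"

lemma fixpart_add: "fixpart j (x + y) = fixpart j x + fixpart j y"
  and fixpart_scaleC: "fixpart j (c *\<^sub>C x) = c *\<^sub>C fixpart j x"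
  by (simp_all add: fixpart_def flip_add flip_scaleC scaleC_add_right scaleC_scaleC mult.commute)

lemma half_add_half: "(1/2) *\<^sub>C (x + x) = (x::'b::cstar_algebra)"
  using scaleC_add_left[of "1/2" "1/2" x] by (simp add: scaleC_add_right)

lemma fixpart_decompose:
  assumes "x \<in> Cl G" "y \<in> Cl G" "j \<notin> G"
  shows "fixpart j (x + m j * y) = x" "fixpart j (m j * (x + m j * y)) = y"
  using assms
  by (simp_all add: fixpart_def flip_add flip_mult flip_m flip_Cl half_add_half algebra_simps m_mult_self)

text \<open>The elements of this form are an algebra by graded commutation. What needs an argument
  is closedness: the coefficients are continuous functions of \<open>z\<close>, so the set is an
  intersection of two preimages of the closed set \<open>Cl G\<close>, and no limits have to be
  added.\<close>

lemma Cl_insert: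
  assumes "j \<notin> G" "z \<in> Cl (insert j G)"
  obtains x y where "x \<in> Cl G" "y \<in> Cl G" "z = x + m j * y"
proof -
  let ?S = "{z. \<exists>x\<in>Cl G. \<exists>y\<in>Cl G. z = x + m j * y}"
  have S: "?S = {z. fixpart j z \<in> Cl G \<and> fixpart j (m j * z) \<in> Cl G}"
  proof safe
    fix x y assume "x \<in> Cl G" "y \<in> Cl G"
    then show "fixpart j (x + m j * y) \<in> Cl G" "fixpart j (m j * (x + m j * y)) \<in> Cl G"
      using fixpart_decompose assms(1) by simp_all
  next
    fix z assume z: "fixpart j z \<in> Cl G" "fixpart j (m j * z) \<in> Cl G"
    have "z = fixpart j z + m j * fixpart j (m j * z)"
      by (simp add: fixpart_def mult_scaleC_right flip_mult flip_m distrib_left right_diff_distrib m_mult_self half_add_half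
          flip: scaleC_add_right)
    then show "\<exists>x\<in>Cl G. \<exists>y\<in>Cl G. z = x + m j * y" using z by blast
  qed
  have mem: "x + m j * y \<in> ?S" if "x \<in> Cl G" "y \<in> Cl G" for x y
    using that by blast
  have bl: "bounded_linear (fixpart j)"
    unfolding fixpart_def
    by (intro bounded_linear_compose[OF bounded_linear_scaleC] bounded_linear_add
        bounded_linear_flip bounded_linear_ident)
  have "Cl (insert j G) \<subseteq> ?S"
  proof (rule Cl_minimal[OF cstar_subalgebraI])
    have "closed {z. fixpart j z \<in> Cl G}" "closed {z. fixpart j (m j * z) \<in> Cl G}"
      using continuous_closed_vimage[OF subalg_closed[OF Cl_subalgebra], of "fixpart j"]
        continuous_closed_vimage[OF subalg_closed[OF Cl_subalgebra], of "\<lambda>z. fixpart j (m j * z)"]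
        bl bounded_linear_compose[OF bl bounded_linear_mult_right[of "m j"]]
      by (simp_all add: vimage_def linear_continuous_at)
    then show "closed ?S" unfolding S by (rule closed_Collect_conj)
    have "1 + m j * 0 \<in> ?S" by (intro mem Cl_intros)
    then show "1 \<in> ?S" by simp
    show "m i \<in> ?S" if "i \<in> insert j G" for i
    proof (cases "i = j")
      case True
      have "0 + m j * 1 \<in> ?S" by (intro mem Cl_intros)
      then show ?thesis using True by simp
    next
      case False
      then have "m i + m j * 0 \<in> ?S" using that by (intro mem Cl_intros Cl_generator) auto
      then show ?thesis by simp
    qed
  next
    fix z z' assume "z \<in> ?S" "z' \<in> ?S"
    then obtain x y x' y' where xy: "x \<in> Cl G" "y \<in> Cl G" "x' \<in> Cl G" "y' \<in> Cl G"
      and z: "z = x + m j * y" "z' = x' + m j * y'" by blast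
    have eq: "z + z' = (x + x') + m j * (y + y')"
      by (simp add: z algebra_simps)
    show "z + z' \<in> ?S" unfolding eq by (intro mem Cl_intros xy)
    have eq: "z * z' = (x * x' + theta y * y') + m j * (theta x * y' + y * x')"
      using Cl_mult_m[OF xy(1) assms(1)] Cl_mult_m[OF xy(2) assms(1)]
      by (simp add: z distrib_left distrib_right m_mult_self add_ac flip: mult.assoc)
        (simp add: mult.assoc m_mult_self)
    show "z * z' \<in> ?S" unfolding eq by (intro mem Cl_intros theta_Cl xy)
  next
    fix z c assume "z \<in> ?S"
    then obtain x y where xy: "x \<in> Cl G" "y \<in> Cl G" and z: "z = x + m j * y" by blast
    have eq: "c *\<^sub>C z = c *\<^sub>C x + m j * (c *\<^sub>C y)"
      by (simp add: z scaleC_add_right mult_scaleC_right)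
    show "c *\<^sub>C z \<in> ?S" unfolding eq by (intro mem Cl_intros xy)
    have eq: "star z = star x + m j * theta (star y)"
      using Cl_mult_m[OF subalg_star[OF Cl_subalgebra xy(2)] assms(1)]
      by (simp add: z star_add star_mult star_m)
    show "star z \<in> ?S" unfolding eq by (intro mem Cl_intros theta_Cl xy)
  qed
  then show ?thesis using assms(2) that by blast
qed

end

section \<open>The Schur product of positive semidefinite matrices\<close>

definition psd :: "'i set \<Rightarrow> ('i \<Rightarrow> 'i \<Rightarrow> complex) \<Rightarrow> bool" where
  "psd A K \<longleftrightarrow> (\<forall>i\<in>A. \<forall>j\<in>A. K j i = cnj (K i j)) \<and>
     (\<forall>c. (\<Sum>i\<in>A. \<Sum>j\<in>A. cnj (c i) * c j * K i j) \<in> \<real>\<^sub>\<ge>\<^sub>0)"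

lemma sum_insert_square:
  fixes f :: "'i \<Rightarrow> 'i \<Rightarrow> 'b::comm_monoid_add"
  assumes "finite A" "k \<notin> A"
  shows "(\<Sum>i\<in>insert k A. \<Sum>j\<in>insert k A. f i j)
    = f k k + (\<Sum>j\<in>A. f k j) + (\<Sum>i\<in>A. f i k) + (\<Sum>i\<in>A. \<Sum>j\<in>A. f i j)"
  using assms by (simp add: sum.distrib add_ac)

lemma psd_insertD:
  assumes "finite A" "k \<notin> A" "psd (insert k A) K"
  shows "psd A K"
  unfolding psd_def
proof (intro conjI ballI allI)
  fix c :: "'a \<Rightarrow> complex"
  have eq: "(\<Sum>j\<in>A. cnj ((c(k := 0)) i) * (c(k := 0)) j * K i j) = (\<Sum>j\<in>A. cnj (c i) * c j * K i j)"
    if "i \<in> A" for i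
    using that assms by (intro sum.cong) auto
  have "(\<Sum>i\<in>insert k A. \<Sum>j\<in>insert k A. cnj ((c(k := 0)) i) * (c(k := 0)) j * K i j) \<in> \<real>\<^sub>\<ge>\<^sub>0"
    using assms(3) unfolding psd_def by blast
  then show "(\<Sum>i\<in>A. \<Sum>j\<in>A. cnj (c i) * c j * K i j) \<in> \<real>\<^sub>\<ge>\<^sub>0"
    unfolding sum_insert_square[OF assms(1,2)] by (simp add: eq del: fun_upd_apply) simp
next
  fix i j assume "i \<in> A" "j \<in> A"
  then show "K j i = cnj (K i j)" using assms(3) unfolding psd_def by blast
qed

lemma psd_diagonal:
  assumes "finite A" "psd A K" "k \<in> A"
  shows "K k k \<in> \<real>\<^sub>\<ge>\<^sub>0"
proof -
  have "\<forall>c. (\<Sum>i\<in>A. \<Sum>j\<in>A. cnj (c i) * c j * K i j) \<in> \<real>\<^sub>\<ge>\<^sub>0"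
    using assms(2) unfolding psd_def by blast
  from spec[OF this, of "\<lambda>i. if i = k then 1 else 0"]
  have "(\<Sum>i\<in>A. \<Sum>j\<in>A. cnj (if i = k then 1 else 0) * (if j = k then 1 else 0) * K i j) \<in> \<real>\<^sub>\<ge>\<^sub>0" .
  also have "(\<Sum>i\<in>A. \<Sum>j\<in>A. cnj (if i = k then 1 else 0) * (if j = k then 1 else 0) * K i j)
      = (\<Sum>i\<in>A. if i = k then (\<Sum>j\<in>A. if j = k then K i j else 0) else 0)"
    by (intro sum.cong) (auto intro!: sum.cong)
  finally show ?thesis using assms by simp
qed

text \<open>The test vector with entry 1 at \<open>j\<close> and \<open>- s * K k j\<close> at
  \<open>k\<close> gives the value \<open>K j j - 2 * s * w\<close>, where \<open>w\<close> is the
  squared modulus of \<open>K k j\<close>. For large \<open>s\<close> this is negative unless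
  \<open>w\<close> vanishes.\<close>

lemma psd_zero_diagonal:
  assumes A: "finite A" "k \<notin> A" and K: "psd (insert k A) K" and zero: "K k k = 0" and j: "j \<in> A"
  shows "K k j = 0"
proof -
  have herm: "K j k = cnj (K k j)" using K j unfolding psd_def by blast
  define w where "w = (cmod (K k j))\<^sup>2"
  have le: "2 * s * w \<le> Re (K j j)" for s :: real
  proof -
    define c where "c i = (if i = k then - of_real s * K k j else if i = j then 1 else 0)" for i
    have cA: "c i = (if i = j then 1 else 0)" if "i \<in> A" for i
      using A that by (auto simp: c_def)
    have "(\<Sum>i\<in>A. f i * c i) = f j" "(\<Sum>i\<in>A. f i * cnj (c i)) = f j" for f
    proof -
      have "(\<Sum>i\<in>A. f i * c i) = (\<Sum>i\<in>A. if i = j then f i else 0)"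
        "(\<Sum>i\<in>A. f i * cnj (c i)) = (\<Sum>i\<in>A. if i = j then f i else 0)"
        using cA by (intro sum.cong refl; simp)+
      then show "(\<Sum>i\<in>A. f i * c i) = f j" "(\<Sum>i\<in>A. f i * cnj (c i)) = f j" using A j by simp_all
    qed
    note del = this
    have "(\<Sum>l\<in>A. cnj (c k) * c l * K k l) = cnj (c k) * K k j"
      using del(1)[of "\<lambda>l. cnj (c k) * K k l"] by (simp add: mult_ac)
    moreover have "(\<Sum>i\<in>A. cnj (c i) * c k * K i k) = c k * K j k"
      using del(2)[of "\<lambda>i. c k * K i k"] by (simp add: mult_ac)
    moreover have "(\<Sum>i\<in>A. \<Sum>l\<in>A. cnj (c i) * c l * K i l) = K j j"
    proof -
      have "(\<Sum>l\<in>A. cnj (c i) * c l * K i l) = K i j * cnj (c i)" for i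
        using del(1)[of "\<lambda>l. cnj (c i) * K i l"] by (simp add: mult_ac)
      then show ?thesis using del(2)[of "\<lambda>i. K i j"] by simp
    qed
    ultimately have "(\<Sum>i\<in>insert k A. \<Sum>l\<in>insert k A. cnj (c i) * c l * K i l)
        = cnj (c k) * K k j + c k * K j k + K j j"
      unfolding sum_insert_square[OF A] by (simp add: zero)
    also have "\<dots> = K j j - of_real (2 * s * w)"
    proof -
      have "of_real w = K k j * cnj (K k j)" unfolding w_def by (rule complex_norm_square)
      then show ?thesis by (simp add: c_def herm algebra_simps)
    qed
    finally have form: "(\<Sum>i\<in>insert k A. \<Sum>l\<in>insert k A. cnj (c i) * c l * K i l) = K j j - of_real (2 * s * w)" .
    have "(\<Sum>i\<in>insert k A. \<Sum>l\<in>insert k A. cnj (c i) * c l * K i l) \<in> \<real>\<^sub>\<ge>\<^sub>0"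
      using K unfolding psd_def by blast
    then have "K j j - of_real (2 * s * w) \<in> \<real>\<^sub>\<ge>\<^sub>0" unfolding form .
    then show ?thesis by (simp add: complex_nonneg_Reals_iff)
  qed
  have "w = 0"
  proof (rule ccontr)
    assume "w \<noteq> 0"
    then show False using le[of "(\<bar>Re (K j j)\<bar> + 1) / (2 * w)"] by (simp add: abs_if split: if_splits)
  qed
  then show ?thesis by (simp add: w_def)
qed

text \<open>The inductive step splits off a rank-one matrix, as in a Cholesky decomposition.\<close>

lemma schur_product:
  assumes "finite A" "psd A K" "psd A L"
  shows "(\<Sum>i\<in>A. \<Sum>j\<in>A. K i j * L i j) \<in> \<real>\<^sub>\<ge>\<^sub>0"
  using assms
proof (induction A arbitrary: K)
  case (insert k A)
  note LA = psd_insertD[OF insert.hyps insert.prems(2)]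
  have herm: "K j i = cnj (K i j)" if "i \<in> insert k A" "j \<in> insert k A" for i j
    using insert.prems(1) that unfolding psd_def by blast
  show ?case
  proof (cases "K k k = 0")
    case True
    have z: "K k j = 0" "K j k = 0" if "j \<in> A" for j
      using psd_zero_diagonal[OF insert.hyps insert.prems(1) True that] herm[of k j] that by auto
    have "(\<Sum>i\<in>insert k A. \<Sum>j\<in>insert k A. K i j * L i j) = (\<Sum>i\<in>A. \<Sum>j\<in>A. K i j * L i j)"
      unfolding sum_insert_square[OF insert.hyps] by (simp add: z True)
    then show ?thesis
      using insert.IH[OF psd_insertD[OF insert.hyps insert.prems(1)] LA] by simp
  next
    case False
    define d where "d = K k k"
    have d: "d \<in> \<real>\<^sub>\<ge>\<^sub>0" "d \<noteq> 0" "cnj d = d"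
      using psd_diagonal[OF _ insert.prems(1), of k] insert.hyps False herm[of k k] by (auto simp: d_def)
    define K' where "K' i j = K i j - K i k * K k j / d" for i j
    have "psd A K'"
      unfolding psd_def
    proof (intro conjI ballI allI)
      fix i j assume "i \<in> A" "j \<in> A"
      then show "K' j i = cnj (K' i j)"
        using herm[of i j] herm[of k j] herm[of i k] d by (simp add: K'_def)
    next
      fix c :: "'a \<Rightarrow> complex"
      define t where "t = (\<Sum>j\<in>A. c j * K k j)"
      define Q where "Q = (\<Sum>i\<in>A. \<Sum>j\<in>A. cnj (c i) * c j * K i j)"
      \<comment> \<open>Completing the square: this entry at \<open>k\<close> minimises the
        quadratic form of \<open>K\<close> for the given entries on \<open>A\<close>, and the
        minimum is the form of the Schur complement \<open>K'\<close>.\<close>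
      define c' where "c' = c(k := - t / d)"
      have cA: "c' i = c i" if "i \<in> A" for i using that insert.hyps by (auto simp: c'_def)
      have ck: "c' k = - t / d" by (simp add: c'_def)
      have ct: "(\<Sum>i\<in>A. cnj (c i) * K i k) = cnj t"
        unfolding t_def cnj_sum using herm[of k] by (intro sum.cong) auto
      have "(\<Sum>j\<in>A. cnj (c' k) * c' j * K k j) = cnj (c' k) * t"
        unfolding t_def sum_distrib_left using cA by (intro sum.cong) auto
      moreover have "(\<Sum>i\<in>A. cnj (c' i) * c' k * K i k) = c' k * cnj t"
        unfolding ct[symmetric] sum_distrib_left using cA by (intro sum.cong) auto
      moreover have "(\<Sum>i\<in>A. \<Sum>j\<in>A. cnj (c' i) * c' j * K i j) = Q"
        unfolding Q_def using cA by (intro sum.cong) auto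
      ultimately have "(\<Sum>i\<in>insert k A. \<Sum>j\<in>insert k A. cnj (c' i) * c' j * K i j)
          = cnj (c' k) * c' k * d + cnj (c' k) * t + c' k * cnj t + Q"
        unfolding sum_insert_square[OF insert.hyps] by (simp add: d_def)
      also have "\<dots> = Q - cnj t * t / d"
        using d by (simp add: ck field_simps)
      finally have form: "(\<Sum>i\<in>insert k A. \<Sum>j\<in>insert k A. cnj (c' i) * c' j * K i j) = Q - cnj t * t / d" .
      have "(\<Sum>i\<in>insert k A. \<Sum>j\<in>insert k A. cnj (c' i) * c' j * K i j) \<in> \<real>\<^sub>\<ge>\<^sub>0"
        using insert.prems(1) unfolding psd_def by blast
      then have nn: "Q - cnj t * t / d \<in> \<real>\<^sub>\<ge>\<^sub>0" unfolding form .
      have "(\<Sum>i\<in>A. \<Sum>j\<in>A. cnj (c i) * c j * K' i j)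
          = Q - (\<Sum>i\<in>A. \<Sum>j\<in>A. (cnj (c i) * K i k) * (c j * K k j)) / d"
        by (simp add: Q_def K'_def sum_divide_distrib sum_subtractf[symmetric] algebra_simps)
      also have "(\<Sum>i\<in>A. \<Sum>j\<in>A. (cnj (c i) * K i k) * (c j * K k j)) = cnj t * t"
        unfolding sum_product[symmetric] ct t_def ..
      finally show "(\<Sum>i\<in>A. \<Sum>j\<in>A. cnj (c i) * c j * K' i j) \<in> \<real>\<^sub>\<ge>\<^sub>0"
        using nn by simp
    qed
    then have 1: "(\<Sum>i\<in>A. \<Sum>j\<in>A. K' i j * L i j) \<in> \<real>\<^sub>\<ge>\<^sub>0"
      using insert.IH LA by blast
    \<comment> \<open>The rank-one part contributes the quadratic form of \<open>L\<close> at the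
      vector \<open>K k\<close>.\<close>
    have "(\<Sum>i\<in>insert k A. \<Sum>j\<in>insert k A. cnj (K k i) * K k j * L i j) \<in> \<real>\<^sub>\<ge>\<^sub>0"
      using insert.prems(2) unfolding psd_def by blast
    also have "(\<Sum>i\<in>insert k A. \<Sum>j\<in>insert k A. cnj (K k i) * K k j * L i j)
       = (\<Sum>i\<in>insert k A. \<Sum>j\<in>insert k A. K i k * K k j * L i j)"
      using herm[of k] by (intro sum.cong) auto
    finally have 2: "(\<Sum>i\<in>insert k A. \<Sum>j\<in>insert k A. K i k * K k j * L i j) / d \<in> \<real>\<^sub>\<ge>\<^sub>0"
      using d by (auto intro: nonneg_Reals_divide_I)
    have "(\<Sum>i\<in>insert k A. \<Sum>j\<in>insert k A. K i j * L i j)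
      = (\<Sum>i\<in>insert k A. \<Sum>j\<in>insert k A. K' i j * L i j + K i k * K k j * L i j / d)"
      by (intro sum.cong refl) (simp add: K'_def algebra_simps)
    also have "\<dots> = (\<Sum>i\<in>insert k A. \<Sum>j\<in>insert k A. K' i j * L i j)
        + (\<Sum>i\<in>insert k A. \<Sum>j\<in>insert k A. K i k * K k j * L i j) / d"
      by (simp only: sum.distrib sum_divide_distrib)
    \<comment> \<open>Row and column \<open>k\<close> of the Schur complement vanish, so the
      induction hypothesis on \<open>A\<close> covers the whole sum.\<close>
    also have "(\<Sum>i\<in>insert k A. \<Sum>j\<in>insert k A. K' i j * L i j) = (\<Sum>i\<in>A. \<Sum>j\<in>A. K' i j * L i j)"
      unfolding sum_insert_square[OF insert.hyps] using d by (simp add: K'_def d_def)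
    finally show ?thesis using 1 2 by simp
  qed
qed simp

text \<open>The quadratic form at \<open>c\<close> is \<open>F (star s * s)\<close> for the linear
  combination \<open>s\<close> of the \<open>x i\<close> with coefficients
  \<open>c i\<close>.\<close>

lemma psd_gram:
  assumes S: "cstar_subalgebra S" and F: "positive_on S F" and x: "\<And>i. i \<in> A \<Longrightarrow> x i \<in> S"
  shows "psd A (\<lambda>i j. F (star (x i) * x j))"
  unfolding psd_def
proof (intro conjI ballI allI)
  fix i j assume "i \<in> A" "j \<in> A"
  then show "F (star (x j) * x i) = cnj (F (star (x i) * x j))"
    using positive_on_star[OF S F, of "star (x i) * x j"] S x
    by (simp add: star_mult star_star subalg_intros)
next
  fix c
  define s where "s = (\<Sum>i\<in>A. c i *\<^sub>C x i)"
  have sS: "s \<in> S" unfolding s_def using S x by (intro subalg_intros)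
  have "star s * s = (\<Sum>i\<in>A. \<Sum>j\<in>A. (cnj (c i) * c j) *\<^sub>C (star (x i) * x j))"
    by (simp add: s_def star_sum star_scaleC sum_product mult_scaleC_left mult_scaleC_right scaleC_scaleC mult.commute)
  then have "F (star s * s) = (\<Sum>i\<in>A. \<Sum>j\<in>A. cnj (c i) * c j * F (star (x i) * x j))"
    using S x by (simp add: positive_on_sum[OF S F] positive_on_scaleC[OF F] subalg_intros)
  then show "(\<Sum>i\<in>A. \<Sum>j\<in>A. cnj (c i) * c j * F (star (x i) * x j)) \<in> \<real>\<^sub>\<ge>\<^sub>0"
    using positive_on_star_mult[OF F sS] by simp
qed

section \<open>Products of two states\<close>

context clifford
begin

text \<open>Repetitions and any order are allowed: the words only have to span a dense subspace and
  to be even or odd, so no basis is singled out.\<close>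

inductive_set words :: "nat set \<Rightarrow> 'a set" for G where
  words_one: "1 \<in> words G"
| words_mult: "j \<in> G \<Longrightarrow> w \<in> words G \<Longrightarrow> m j * w \<in> words G"

lemma words_subset: "w \<in> words G \<Longrightarrow> w \<in> Cl G"
  by (induction rule: words.induct) (auto intro: subalg_one[OF Cl_subalgebra]
      subalg_mult[OF Cl_subalgebra] Cl_generator)

lemma words_homogeneous: "w \<in> words G \<Longrightarrow> theta w = w \<or> theta w = - w"
  by (induction rule: words.induct) (auto simp: theta_mult)

lemma words_mono: "w \<in> words G \<Longrightarrow> G \<subseteq> H \<Longrightarrow> w \<in> words H"
  by (induction rule: words.induct) (auto intro: words.intros)

inductive_set wspan :: "nat set \<Rightarrow> 'a set" for G where
  wspan_word: "w \<in> words G \<Longrightarrow> w \<in> wspan G"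
| wspan_add: "x \<in> wspan G \<Longrightarrow> y \<in> wspan G \<Longrightarrow> x + y \<in> wspan G"
| wspan_scaleC: "x \<in> wspan G \<Longrightarrow> c *\<^sub>C x \<in> wspan G"

lemma wspan_generator_mult: "x \<in> wspan G \<Longrightarrow> j \<in> G \<Longrightarrow> m j * x \<in> wspan G"
  by (induction rule: wspan.induct)
     (auto simp: distrib_left mult_scaleC_right intro: wspan.intros words_mult)

lemma wspan_mult:
  assumes "x \<in> wspan G" "y \<in> wspan G"
  shows "x * y \<in> wspan G"
  using assms(1)
proof (induction rule: wspan.induct)
  case (wspan_word w)
  then show ?case
    by (induction rule: words.induct) (auto simp: assms(2) mult.assoc intro: wspan_generator_mult)
qed (auto simp: distrib_right mult_scaleC_left intro: wspan_add wspan_scaleC)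

lemma wspan_star: "x \<in> wspan G \<Longrightarrow> star x \<in> wspan G"
proof (induction rule: wspan.induct)
  case (wspan_word w)
  then show ?case
  proof (induction rule: words.induct)
    case (words_mult j w)
    have "m j * 1 \<in> wspan G"
      by (rule wspan.wspan_word[OF words.words_mult[OF words_mult(1) words_one]])
    then show ?case using words_mult by (simp add: star_mult star_m wspan_mult)
  qed (simp add: wspan.wspan_word words.words_one)
qed (auto simp: star_add star_scaleC intro: wspan_add wspan_scaleC)

lemma Cl_subset_closure_wspan: "Cl G \<subseteq> closure (wspan G)"
proof (rule Cl_minimal)
  show "cstar_subalgebra (closure (wspan G))"
    by (rule cstar_subalgebra_closure) (auto intro: wspan.intros words_one wspan_mult wspan_star)
  fix j assume "j \<in> G"
  then have "m j * 1 \<in> wspan G" by (intro wspan_word words.intros)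
  then show "m j \<in> closure (wspan G)" using closure_subset by auto
qed

lemma wspan_subset: "x \<in> wspan G \<Longrightarrow> x \<in> Cl G"
  by (induction rule: wspan.induct) (auto intro: words_subset subalg_add[OF Cl_subalgebra]
      subalg_scaleC[OF Cl_subalgebra])

text \<open>Linear combinations of words are dense, and states are norm continuous.\<close>

lemma states_eq_on_words:
  assumes \<psi>: "state_on (Cl G) \<psi>" "state_on (Cl G) \<psi>'" and eq: "\<And>w. w \<in> words G \<Longrightarrow> \<psi> w = \<psi>' w"
  shows "states_eq_on (Cl G) \<psi> \<psi>'"
  unfolding states_eq_on_def
proof
  fix x assume "x \<in> Cl G"
  then obtain f where f: "\<And>n. f n \<in> wspan G" "f \<longlonglongrightarrow> x"
    using Cl_subset_closure_wspan closure_sequential by (metis subsetD)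
  have eq': "z \<in> wspan G \<Longrightarrow> \<psi> z = \<psi>' z" for z
    by (induction rule: wspan.induct)
       (simp_all add: eq wspan_subset \<psi>[THEN state_on_positive, THEN positive_on_add]
         \<psi>[THEN state_on_positive, THEN positive_on_scaleC])
  have "(\<lambda>n. \<psi> (f n)) \<longlonglongrightarrow> \<psi> x" "(\<lambda>n. \<psi>' (f n)) \<longlonglongrightarrow> \<psi>' x"
    using state_on_tendsto[OF Cl_subalgebra \<psi>(1)] state_on_tendsto[OF Cl_subalgebra \<psi>(2)]
      f wspan_subset by blast+
  then show "\<psi> x = \<psi>' x"
    using eq'[OF f(1)] LIMSEQ_unique by simp
qed

text \<open>Splitting off the finitely many generators of \<open>G\<close> one by one gives an exact
  finite sum, with no limit, although \<open>H\<close> may be infinite. The left factors are words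
  and therefore even or odd, as the positivity proof requires.\<close>

lemma Cl_union_decompose:
  assumes "finite G" "G \<inter> H = {}" "z \<in> Cl (G \<union> H)"
  shows "\<exists>ps. set ps \<subseteq> words G \<times> Cl H \<and> z = sum_list (map (\<lambda>(x, y). x * y) ps)"
  using assms
proof (induction G arbitrary: z rule: finite_induct)
  case empty
  then show ?case by (intro exI[of _ "[(1, z)]"]) (simp add: words_one)
next
  case (insert j G)
  then have "j \<notin> G \<union> H" "z \<in> Cl (insert j (G \<union> H))" by auto
  then obtain x y where xy: "x \<in> Cl (G \<union> H)" "y \<in> Cl (G \<union> H)" and z: "z = x + m j * y"
    by (rule Cl_insert)
  obtain ps where ps: "set ps \<subseteq> words G \<times> Cl H" "x = sum_list (map (\<lambda>(x, y). x * y) ps)"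
    using insert.IH[OF _ xy(1)] insert.prems by auto
  obtain qs where qs: "set qs \<subseteq> words G \<times> Cl H" "y = sum_list (map (\<lambda>(x, y). x * y) qs)"
    using insert.IH[OF _ xy(2)] insert.prems by auto
  have "m j * sum_list (map (\<lambda>(x, y). x * y) qs) = sum_list (map (\<lambda>(x, y). x * y) (map (\<lambda>(x, y). (m j * x, y)) qs))"
    by (induction qs) (auto simp: distrib_left mult.assoc)
  moreover have "set (ps @ map (\<lambda>(x, y). (m j * x, y)) qs) \<subseteq> words (insert j G) \<times> Cl H"
    using ps(1) qs(1) words_mono[of _ G "insert j G"] by (auto intro!: words_mult)
  ultimately show ?case
    using z ps(2) qs(2) by (intro exI[of _ "ps @ map (\<lambda>(x, y). (m j * x, y)) qs"]) simp
qed

text \<open>The multiples of 1 are an isometric image of the complex plane, hence complete and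
  already closed.\<close>

lemma Cl_empty:
  assumes "x \<in> Cl {}"
  obtains c where "x = c *\<^sub>C 1"
proof -
  let ?S = "range (\<lambda>c. c *\<^sub>C (1::'a))"
  have bl: "bounded_linear (\<lambda>c. c *\<^sub>C (1::'a))"
    by (rule bounded_linear_intro[of _ 1])
       (simp_all add: scaleC_add_left scaleR_conv_scaleC scaleC_scaleC norm_scaleC flip: scaleR_conv_of_real)
  have "complete ?S"
    by (rule complete_isometric_image[of 1 _ "\<lambda>c. c *\<^sub>C (1::'a)"])
       (use bl in \<open>auto simp: norm_scaleC complete_UNIV\<close>)
  have "Cl {} \<subseteq> ?S"
  proof (rule Cl_minimal[OF cstar_subalgebraI])
    show "closed ?S" using \<open>complete ?S\<close> by (rule complete_imp_closed)
    show "1 \<in> ?S" by (auto intro: image_eqI[of _ _ 1])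
  qed (auto simp: mult_scaleC_left scaleC_scaleC star_scaleC simp flip: scaleC_add_left)
  then show ?thesis using assms that by blast
qed

text \<open>Decompositions into products are not unique, so the slice map cannot simply be defined
  by them. The coefficients with respect to a single generator are unique; induction applies the
  hypothesis to \<open>F\<close> and to \<open>F\<close> after multiplication by \<open>m j\<close>,
  hence the general \<open>F\<close>, and combines both maps through \<open>fixpart\<close>.\<close>

lemma slice_map:
  assumes "finite G" "G \<inter> H = {}"
    and "\<And>x y. x \<in> Cl G \<Longrightarrow> y \<in> Cl G \<Longrightarrow> F (x + y) = F x + F y"
    and "\<And>c x. x \<in> Cl G \<Longrightarrow> F (c *\<^sub>C x) = c * F x"
  shows "\<exists>E. (\<forall>x y. E (x + y) = E x + E y) \<and> (\<forall>c x. E (c *\<^sub>C x) = c *\<^sub>C E x) \<and>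
    (\<forall>x\<in>Cl G. \<forall>y\<in>Cl H. E (x * y) = F x *\<^sub>C y)"
  using assms
proof (induction G arbitrary: F rule: finite_induct)
  case empty
  have "F x *\<^sub>C y = F 1 *\<^sub>C (x * y)" if x: "x \<in> Cl {}" for x y
  proof -
    obtain c where c: "x = c *\<^sub>C 1" using x by (rule Cl_empty)
    have "F x = c * F 1" using empty(3)[OF subalg_one[OF Cl_subalgebra]] by (simp add: c)
    then show ?thesis by (simp add: c mult_scaleC_left scaleC_scaleC mult.commute)
  qed
  then show ?case
    by (intro exI[of _ "\<lambda>z. F 1 *\<^sub>C z"]) (simp add: scaleC_add_right scaleC_scaleC mult.commute)
next
  case (insert j G)
  have sub: "x \<in> Cl (insert j G)" if "x \<in> Cl G" for x using that Cl_mono[of G "insert j G"] by blast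
  have jx: "m j * x \<in> Cl (insert j G)" if "x \<in> Cl G" for x
    using sub[OF that] by (intro Cl_intros Cl_generator) auto
  have GH: "G \<inter> H = {}" and j: "j \<notin> G \<union> H" using insert by auto
  have "\<exists>E. (\<forall>x y. E (x + y) = E x + E y) \<and> (\<forall>c x. E (c *\<^sub>C x) = c *\<^sub>C E x) \<and>
      (\<forall>x\<in>Cl G. \<forall>y\<in>Cl H. E (x * y) = F x *\<^sub>C y)"
    by (rule insert.IH[OF GH]) (simp_all add: insert.prems(2,3) sub)
  then obtain E where E: "\<forall>x y. E (x + y) = E x + E y" "\<forall>c x. E (c *\<^sub>C x) = c *\<^sub>C E x"
    "\<forall>x\<in>Cl G. \<forall>y\<in>Cl H. E (x * y) = F x *\<^sub>C y"
    by (elim exE conjE)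
  have "F (m j * (x + y)) = F (m j * x) + F (m j * y)" "F (m j * (c *\<^sub>C x)) = c * F (m j * x)"
    if "x \<in> Cl G" "y \<in> Cl G" for x y c
    using insert.prems(2)[OF jx[OF that(1)] jx[OF that(2)]] insert.prems(3)[OF jx[OF that(1)]]
    by (simp_all add: distrib_left mult_scaleC_right)
  then have "\<exists>E. (\<forall>x y. E (x + y) = E x + E y) \<and> (\<forall>c x. E (c *\<^sub>C x) = c *\<^sub>C E x) \<and>
      (\<forall>x\<in>Cl G. \<forall>y\<in>Cl H. E (x * y) = F (m j * x) *\<^sub>C y)"
    by (intro insert.IH[OF GH, of "\<lambda>x. F (m j * x)"]) auto
  then obtain E' where E': "\<forall>x y. E' (x + y) = E' x + E' y" "\<forall>c x. E' (c *\<^sub>C x) = c *\<^sub>C E' x"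
    "\<forall>x\<in>Cl G. \<forall>y\<in>Cl H. E' (x * y) = F (m j * x) *\<^sub>C y"
    by (elim exE conjE)
  define E'' where "E'' z = E (fixpart j z) + E' (fixpart j (m j * z))" for z
  have "E'' (x * y) = F x *\<^sub>C y" if x: "x \<in> Cl (insert j G)" and y: "y \<in> Cl H" for x y
  proof -
    obtain x0 x1 where x01: "x0 \<in> Cl G" "x1 \<in> Cl G" and x: "x = x0 + m j * x1"
      using Cl_insert[OF insert.hyps(2) x] by blast
    have mem: "x0 * y \<in> Cl (G \<union> H)" "x1 * y \<in> Cl (G \<union> H)"
      using x01 y Cl_mono[of G "G \<union> H"] Cl_mono[of H "G \<union> H"] by (auto intro!: subalg_mult[OF Cl_subalgebra])
    have "x * y = x0 * y + m j * (x1 * y)" by (simp add: x distrib_right mult.assoc)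
    then have "E'' (x * y) = E (x0 * y) + E' (x1 * y)"
      using fixpart_decompose[OF mem j] by (simp add: E''_def)
    also have "\<dots> = (F x0 + F (m j * x1)) *\<^sub>C y"
      using x01 y by (simp add: E E' scaleC_add_left)
    also have "F x0 + F (m j * x1) = F x"
      using insert.prems(2) sub jx x01 by (simp add: x)
    finally show ?thesis .
  qed
  moreover have "E'' (x + y) = E'' x + E'' y" "E'' (c *\<^sub>C x) = c *\<^sub>C E'' x" for x y c
    by (simp_all add: E''_def fixpart_add fixpart_scaleC distrib_left mult_scaleC_right E E' scaleC_add_right add_ac)
  ultimately show ?case by (intro exI[of _ E'']) simp
qed

definition even_state :: "nat set \<Rightarrow> ('a \<Rightarrow> complex) \<Rightarrow> bool" where
  "even_state H \<phi> \<longleftrightarrow> (\<forall>x\<in>Cl H. \<phi> (theta x) = \<phi> x)"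

text \<open>Positivity: since \<open>\<phi>\<close> vanishes on odd elements, the value of the product functional at
  \<open>z\<^sup>* z\<close>, \<open>z = \<Sum>\<^sub>k x\<^sub>k y\<^sub>k\<close> with homogeneous \<open>x\<^sub>k\<close>, is the sum of the entries of the
  Schur product of two Gram matrices.\<close>

lemma product_state_exists:
  assumes G: "finite G" and GH: "G \<inter> H = {}"
    and \<phi>: "state_on (Cl G) \<phi>" and even: "even_state G \<phi>"
    and \<omega>: "state_on (Cl H) \<omega>"
  shows "\<exists>\<psi>. state_on (Cl (G \<union> H)) \<psi> \<and>
    (\<forall>x\<in>Cl G. \<forall>y\<in>Cl H. \<psi> (x * y) = \<phi> x * \<omega> y \<and> \<psi> (y * x) = \<phi> x * \<omega> y)"
proof -
  note P = state_on_positive[OF \<phi>] and Q = state_on_positive[OF \<omega>]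
  obtain E where E': "\<forall>x y. E (x + y) = E x + E y" "\<forall>c x. E (c *\<^sub>C x) = c *\<^sub>C E x"
    "\<forall>x\<in>Cl G. \<forall>y\<in>Cl H. E (x * y) = \<phi> x *\<^sub>C y"
  proof -
    have "\<exists>E. (\<forall>x y. E (x + y) = E x + E y) \<and> (\<forall>c x. E (c *\<^sub>C x) = c *\<^sub>C E x) \<and>
      (\<forall>x\<in>Cl G. \<forall>y\<in>Cl H. E (x * y) = \<phi> x *\<^sub>C y)"
      by (rule slice_map[OF G GH]) (simp_all add: positive_on_add[OF P] positive_on_scaleC[OF P])
    then show ?thesis using that by (elim exE conjE)
  qed
  then have Eadd: "\<And>x y. E (x + y) = E x + E y" and Escale: "\<And>c x. E (c *\<^sub>C x) = c *\<^sub>C E x"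
    and E: "\<And>x y. x \<in> Cl G \<Longrightarrow> y \<in> Cl H \<Longrightarrow> E (x * y) = \<phi> x *\<^sub>C y"
    by simp_all
  have E0: "E 0 = 0" using Eadd[of 0 0] by simp
  have Esum: "E (\<Sum>i\<in>A. f i) = (\<Sum>i\<in>A. E (f i))" for f :: "nat \<Rightarrow> 'a" and A
    by (induction A rule: infinite_finite_induct) (simp_all add: Eadd E0)
  \<comment> \<open>Evenness of \<open>\<phi>\<close> enters here. An even \<open>a\<close> commutes
    with \<open>b\<close>; moving an odd \<open>a\<close> to the left turns \<open>b\<close> into
    \<open>theta b\<close>, but then \<open>\<phi> a = 0\<close> and both sides vanish.\<close>
  have Ebac: "E (b * a * c) = \<phi> a *\<^sub>C (b * c)"
    if a: "a \<in> Cl G" "theta a = a \<or> theta a = - a" and b: "b \<in> Cl H" and c: "c \<in> Cl H" for a b c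
    using a(2)
  proof
    assume "theta a = a"
    then have "a * b = b * a" using Cl_commute[OF a(1) _ b GH] by blast
    then have "b * a * c = a * (b * c)" by (metis mult.assoc)
    moreover have "b * c \<in> Cl H" using b c by (intro Cl_intros)
    ultimately show ?thesis by (simp only: E[OF a(1)])
  next
    assume odd: "theta a = - a"
    have "\<phi> (theta a) = \<phi> a" using even a(1) by (simp add: even_state_def)
    then have "\<phi> a = 0" using positive_on_minus[OF P a(1)] by (simp add: odd)
    moreover have "a * theta b = b * a"
      using Cl_commute_odd[OF a(1) odd theta_Cl[OF b] GH] by (simp only: theta_theta)
    then have "b * a * c = a * (theta b * c)" by (metis mult.assoc)
    moreover have "theta b * c \<in> Cl H" using b c by (intro Cl_intros theta_Cl)
    ultimately show ?thesis by (simp only: E[OF a(1)] scaleC_zero_left)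
  qed
  have decomp: "\<exists>(n::nat) x y. (\<forall>k<n. x k \<in> words G \<and> y k \<in> Cl H) \<and> z = (\<Sum>k<n. x k * y k)"
    if z: "z \<in> Cl (G \<union> H)" for z
  proof -
    obtain ps where ps: "set ps \<subseteq> words G \<times> Cl H" "z = sum_list (map (\<lambda>(x, y). x * y) ps)"
      using Cl_union_decompose[OF G GH z] by (elim exE conjE)
    have A: "z = (\<Sum>k<length ps. fst (ps ! k) * snd (ps ! k))"
      by (simp add: ps(2) sum_list_sum_nth case_prod_beta atLeast0LessThan)
    have B: "fst (ps ! k) \<in> words G \<and> snd (ps ! k) \<in> Cl H" if "k < length ps" for k
      using ps(1) nth_mem[OF that] by auto
    show ?thesis
      by (rule exI[of _ "length ps"], rule exI[of _ "\<lambda>k. fst (ps ! k)"], rule exI[of _ "\<lambda>k. snd (ps ! k)"])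
         (use A B in simp)
  qed
  \<comment> \<open>The slice map must land in \<open>Cl H\<close>, since \<open>\<omega>\<close> is
    known to be linear only there.\<close>
  have EH: "E z \<in> Cl H" if zGH: "z \<in> Cl (G \<union> H)" for z
  proof -
    obtain n :: nat and x y where xy: "\<forall>k<n. x k \<in> words G \<and> y k \<in> Cl H" and z: "z = (\<Sum>k<n. x k * y k)"
      using decomp[OF zGH] by (elim exE conjE)
    have "E z = (\<Sum>k<n. E (x k * y k))" unfolding z by (rule Esum)
    also have "\<dots> \<in> Cl H"
    proof (rule subalg_sum[OF Cl_subalgebra])
      fix k assume "k \<in> {..<n}"
      then have "x k \<in> Cl G" "y k \<in> Cl H" using xy words_subset by auto
      then show "E (x k * y k) \<in> Cl H" by (simp add: E subalg_scaleC[OF Cl_subalgebra])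
    qed
    finally show ?thesis .
  qed
  define \<psi> where "\<psi> z = \<omega> (E z)" for z
  have xy: "\<psi> (x * y) = \<phi> x * \<omega> y" if "x \<in> Cl G" "y \<in> Cl H" for x y
    using that by (simp add: \<psi>_def E positive_on_scaleC[OF Q])
  have "\<psi> (star z * z) \<in> \<real>\<^sub>\<ge>\<^sub>0" if zGH: "z \<in> Cl (G \<union> H)" for z
  proof -
    obtain n :: nat and x y where xy': "\<forall>k<n. x k \<in> words G \<and> y k \<in> Cl H"
      and z: "z = (\<Sum>k<n. x k * y k)"
      using decomp[OF zGH] by (elim exE conjE)
    have xy: "x k \<in> words G" "y k \<in> Cl H" if "k < n" for k using xy' that by simp_all
    have xG: "x k \<in> Cl G" if "k < n" for k using xy that words_subset by blast
    have "star z * z = (\<Sum>k<n. \<Sum>l<n. star (y k) * (star (x k) * x l) * y l)"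
      by (simp add: z star_sum star_mult sum_product mult.assoc)
    moreover have "E (star (y k) * (star (x k) * x l) * y l) = \<phi> (star (x k) * x l) *\<^sub>C (star (y k) * y l)"
      if "k < n" "l < n" for k l
    proof (rule Ebac)
      show "theta (star (x k) * x l) = star (x k) * x l \<or> theta (star (x k) * x l) = - (star (x k) * x l)"
        using words_homogeneous[OF xy(1)[OF that(1)]] words_homogeneous[OF xy(1)[OF that(2)]]
        by (auto simp: theta_mult theta_star)
    qed (use that xG xy in \<open>simp_all add: Cl_intros\<close>)
    ultimately have "E (star z * z) = (\<Sum>k<n. \<Sum>l<n. \<phi> (star (x k) * x l) *\<^sub>C (star (y k) * y l))"
      by (simp only: Esum) (intro sum.cong refl, simp)
    then have "\<psi> (star z * z) = \<omega> (\<Sum>k<n. \<Sum>l<n. \<phi> (star (x k) * x l) *\<^sub>C (star (y k) * y l))"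
      by (simp add: \<psi>_def)
    moreover have yy: "star (y k) * y l \<in> Cl H" if "k < n" "l < n" for k l
      using xy(2)[OF that(1)] xy(2)[OF that(2)]
      by (rule subalg_mult[OF Cl_subalgebra subalg_star[OF Cl_subalgebra]])
    have "\<omega> (\<Sum>k<n. \<Sum>l<n. \<phi> (star (x k) * x l) *\<^sub>C (star (y k) * y l))
        = (\<Sum>k<n. \<omega> (\<Sum>l<n. \<phi> (star (x k) * x l) *\<^sub>C (star (y k) * y l)))"
      using yy by (intro positive_on_sum[OF Cl_subalgebra Q] subalg_sum[OF Cl_subalgebra]
          subalg_scaleC[OF Cl_subalgebra]) simp
    moreover have "\<omega> (\<Sum>l<n. \<phi> (star (x k) * x l) *\<^sub>C (star (y k) * y l))
        = (\<Sum>l<n. \<phi> (star (x k) * x l) * \<omega> (star (y k) * y l))" if "k < n" for k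
    proof -
      have "\<omega> (\<Sum>l<n. \<phi> (star (x k) * x l) *\<^sub>C (star (y k) * y l))
        = (\<Sum>l<n. \<omega> (\<phi> (star (x k) * x l) *\<^sub>C (star (y k) * y l)))"
        using yy[OF that] by (intro positive_on_sum[OF Cl_subalgebra Q] subalg_scaleC[OF Cl_subalgebra]) simp
      also have "\<dots> = (\<Sum>l<n. \<phi> (star (x k) * x l) * \<omega> (star (y k) * y l))"
        using yy[OF that] by (intro sum.cong refl positive_on_scaleC[OF Q]) simp
      finally show ?thesis .
    qed
    ultimately have "\<psi> (star z * z) = (\<Sum>k<n. \<Sum>l<n. \<phi> (star (x k) * x l) * \<omega> (star (y k) * y l))"
      by simp
    moreover have "\<dots> \<in> \<real>\<^sub>\<ge>\<^sub>0"
      using psd_gram[OF Cl_subalgebra P, of "{..<n}" x] psd_gram[OF Cl_subalgebra Q, of "{..<n}" y] xG xy(2)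
      by (intro schur_product) auto
    ultimately show ?thesis by simp
  qed
  moreover have "\<psi> 1 = 1"
    using xy[of 1 1] state_on_one[OF \<phi>] state_on_one[OF \<omega>] by (simp add: Cl_intros)
  ultimately have st: "state_on (Cl (G \<union> H)) \<psi>"
    unfolding state_on_def using EH
    by (simp add: \<psi>_def Eadd Escale positive_on_add[OF Q] positive_on_scaleC[OF Q])
  \<comment> \<open>The opposite order follows by taking adjoints, as positive functionals are
    hermitian.\<close>
  have "\<psi> (y * x) = \<phi> x * \<omega> y" if x: "x \<in> Cl G" and y: "y \<in> Cl H" for x y
  proof -
    have "star x * star y \<in> Cl (G \<union> H)"
      using x y Cl_mono[of G "G \<union> H"] Cl_mono[of H "G \<union> H"] by (intro Cl_intros) auto
    then have "\<psi> (star (star x * star y)) = cnj (\<psi> (star x * star y))"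
      by (rule positive_on_star[OF Cl_subalgebra state_on_positive[OF st]])
    also have "\<dots> = \<phi> x * \<omega> y"
      using x y by (simp add: xy Cl_intros positive_on_star[OF Cl_subalgebra P] positive_on_star[OF Cl_subalgebra Q])
    finally show ?thesis by (simp add: star_mult star_star)
  qed
  then show ?thesis by (intro exI[of _ \<psi>] conjI ballI st xy)
qed

section \<open>Product states of arbitrarily many subsystems\<close>

text \<open>The sets \<open>G i\<close> consist of generator indices and need not be unions of pairs
  belonging to a mode, so regions can be truncated at any index.\<close>

definition product_state ::
  "enat \<Rightarrow> (nat \<Rightarrow> nat set) \<Rightarrow> (nat \<Rightarrow> 'a \<Rightarrow> complex) \<Rightarrow> ('a \<Rightarrow> complex) \<Rightarrow> bool" where
  "product_state N G \<phi> \<psi> \<longleftrightarrow> state_on (Cl (region N G)) \<psi> \<and>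
     (\<forall>k A. enat k \<le> N \<and> (\<forall>i<k. A i \<in> Cl (G i)) \<longrightarrow>
        \<psi> (prod_list (map A [0..<k])) = (\<Prod>i<k. \<phi> i (A i)))"

lemma product_stateD:
  assumes "product_state N G \<phi> \<psi>"
  shows "state_on (Cl (region N G)) \<psi>"
    and "enat k \<le> N \<Longrightarrow> (\<And>i. i < k \<Longrightarrow> A i \<in> Cl (G i)) \<Longrightarrow>
      \<psi> (prod_list (map A [0..<k])) = (\<Prod>i<k. \<phi> i (A i))"
  using assms unfolding product_state_def by blast+

section \<open>Ordered factorisation of words and uniqueness\<close>

lemma subsystems_enat: "subsystems (enat k) = {..<k}"
  by (auto simp: subsystems_def)

lemma mem_subsystems_less: "enat k \<le> N \<Longrightarrow> i < k \<Longrightarrow> i \<in> subsystems N"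
  unfolding subsystems_def by (metis enat_ord_simps(2) mem_Collect_eq order_less_le_trans)

lemma subset_region: "i \<in> subsystems N \<Longrightarrow> G i \<subseteq> region N G"
  by (auto simp: region_def)

lemma prod_list_eq_one: "(\<And>i. i \<in> set xs \<Longrightarrow> A i = 1) \<Longrightarrow> prod_list (map A xs) = (1::'a)"
  by (induction xs) auto

lemma prod_list_pad:
  assumes "k \<le> k'"
  shows "prod_list (map (\<lambda>i. if i < k then A i else 1) [0..<k']) = (prod_list (map A [0..<k]) :: 'a)"
proof -
  have "[0..<k'] = [0..<k] @ [k..<k']" using assms by (metis le0 le_Suc_ex upt_add_eq_append)
  then have "prod_list (map (\<lambda>i. if i < k then A i else 1) [0..<k'])
      = prod_list (map (\<lambda>i. if i < k then A i else 1) [0..<k]) * prod_list (map (\<lambda>i. if i < k then A i else 1) [k..<k'])"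
    by (simp only: map_append prod_list.append)
  also have "prod_list (map (\<lambda>i. if i < k then A i else 1) [k..<k']) = (1::'a)"
    by (rule prod_list_eq_one) auto
  also have "map (\<lambda>i. if i < k then A i else 1) [0..<k] = map A [0..<k]"
    by (rule map_cong) auto
  finally show ?thesis by simp
qed

lemma m_mult_prod_list:
  assumes "\<And>i. i \<in> set xs \<Longrightarrow> A i \<in> Cl (G i) \<and> j \<notin> G i"
  shows "m j * prod_list (map A xs) = prod_list (map (\<lambda>i. theta (A i)) xs) * m j"
  using assms
proof (induction xs)
  case (Cons i xs)
  have "theta (A i) * m j = m j * A i"
    using Cl_mult_m[of "theta (A i)" "G i" j] Cons.prems by (simp add: theta_Cl)
  then have "m j * prod_list (map A (i # xs)) = theta (A i) * (m j * prod_list (map A xs))"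
    by (simp flip: mult.assoc)
  then show ?case using Cons by (simp add: mult.assoc)
qed simp

text \<open>A further generator \<open>m j\<close> with \<open>j\<close> in \<open>G p\<close> is
  moved to the right past the factors before \<open>p\<close>, each of which is replaced by its
  image under \<open>theta\<close>, and is then absorbed into factor \<open>p\<close>.\<close>

lemma words_factorize:
  assumes disj: "disjoint_family_on G (subsystems N)" and w: "w \<in> words (region N G)"
  shows "\<exists>k A. enat k \<le> N \<and> (\<forall>i<k. A i \<in> Cl (G i)) \<and> w = prod_list (map A [0..<k])"
  using w
proof (induction rule: words.induct)
  case words_one
  show ?case by (rule exI[of _ 0]) (auto simp: zero_enat_def[symmetric])
next
  case (words_mult j w)
  obtain k A where kA: "enat k \<le> N" "\<forall>i<k. A i \<in> Cl (G i)" "w = prod_list (map A [0..<k])"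
    using words_mult.IH by (elim exE conjE)
  obtain p where p: "p \<in> subsystems N" "j \<in> G p" using words_mult.hyps(1) by (auto simp: region_def)
  \<comment> \<open>Factor \<open>p\<close> may not exist yet; padding with 1 up to
    \<open>k'\<close> provides it.\<close>
  define k' where "k' = max k (Suc p)"
  define A' where "A' i = (if i < k then A i else 1)" for i
  have k': "k \<le> k'" "p < k'" by (auto simp: k'_def)
  have k'N: "enat k' \<le> N"
    using kA(1) p(1) unfolding k'_def subsystems_def by (simp add: max_def Suc_ile_eq)
  have A': "A' i \<in> Cl (G i)" for i using kA(2) by (simp add: A'_def subalg_one[OF Cl_subalgebra])
  have "j \<notin> G i" if "i < p" for i
    using disj p that mem_subsystems_less[OF k'N, of i] k'(2)
    by (force simp: disjoint_family_on_def)
  then have past: "m j * prod_list (map A' [0..<p]) = prod_list (map (\<lambda>i. theta (A' i)) [0..<p]) * m j"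
    using A' by (intro m_mult_prod_list) auto
  define B where "B i = (if i < p then theta (A' i) else if i = p then m j * A' i else A' i)" for i
  have split: "[0..<k'] = [0..<p] @ p # [Suc p..<k']"
    using k'(2) by (metis le0 less_imp_add_positive less_imp_le_nat upt_add_eq_append upt_conv_Cons le_add_diff_inverse)
  have "m j * w = m j * prod_list (map A' [0..<k'])"
    using prod_list_pad[OF k'(1), of A] by (simp add: kA(3) A'_def[abs_def])
  also have "\<dots> = m j * prod_list (map A' [0..<p]) * (A' p * prod_list (map A' [Suc p..<k']))"
    unfolding split by (simp add: mult.assoc)
  also have "\<dots> = prod_list (map (\<lambda>i. theta (A' i)) [0..<p]) * (m j * A' p * prod_list (map A' [Suc p..<k']))"
    unfolding past by (simp add: mult.assoc)
  also have "map (\<lambda>i. theta (A' i)) [0..<p] = map B [0..<p]" by (simp add: B_def)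
  also have "map A' [Suc p..<k'] = map B [Suc p..<k']" by (simp add: B_def)
  also have "m j * A' p = B p" by (simp add: B_def)
  also have "prod_list (map B [0..<p]) * (B p * prod_list (map B [Suc p..<k'])) = prod_list (map B [0..<k'])"
    unfolding split by simp
  finally have eq: "m j * w = prod_list (map B [0..<k'])" .
  have "B i \<in> Cl (G i)" for i
    using A' p(2) by (auto simp: B_def intro: theta_Cl Cl_generator subalg_mult[OF Cl_subalgebra])
  then show ?case
    using k'N eq by (intro exI[of _ k'] exI[of _ B]) simp
qed

lemma product_state_unique:
  assumes disj: "disjoint_family_on G (subsystems N)"
    and \<psi>: "product_state N G \<phi> \<psi>" "product_state N G \<phi> \<psi>'"
  shows "states_eq_on (Cl (region N G)) \<psi> \<psi>'"
proof (rule states_eq_on_words[OF \<psi>[THEN product_stateD(1)]])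
  fix w assume "w \<in> words (region N G)"
  then obtain k A where kA: "enat k \<le> N" "\<forall>i<k. A i \<in> Cl (G i)" "w = prod_list (map A [0..<k])"
    using words_factorize[OF disj] by blast
  then show "\<psi> w = \<psi>' w"
    using product_stateD(2)[OF \<psi>(1), of k A] product_stateD(2)[OF \<psi>(2), of k A] by simp
qed

lemma theta_prod_list: "theta (prod_list (map A xs)) = prod_list (map (\<lambda>i. theta (A i)) xs)"
  by (induction xs) (simp_all add: theta_mult)

lemma state_on_theta:
  assumes "state_on (Cl G) \<phi>"
  shows "state_on (Cl G) (\<lambda>x. \<phi> (theta x))"
proof -
  note P = state_on_positive[OF assms]
  have "\<phi> (theta (star x * x)) \<in> \<real>\<^sub>\<ge>\<^sub>0" if "x \<in> Cl G" for x
    using positive_on_star_mult[OF P theta_Cl[OF that]] by (simp only: theta_mult theta_star)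
  then show ?thesis
    unfolding state_on_def
    by (simp add: theta_add theta_scaleC theta_Cl positive_on_add[OF P] positive_on_scaleC[OF P]
        state_on_one[OF assms])
qed

text \<open>Composed with \<open>theta\<close>, the state is again a product state of the same even
  factors, so uniqueness applies.\<close>

lemma product_state_even:
  assumes disj: "disjoint_family_on G (subsystems N)" and \<psi>: "product_state N G \<phi> \<psi>"
    and even: "\<And>i. i \<in> subsystems N \<Longrightarrow> even_state (G i) (\<phi> i)"
  shows "even_state (region N G) \<psi>"
proof -
  have "product_state N G \<phi> (\<lambda>x. \<psi> (theta x))"
    unfolding product_state_def
  proof (intro conjI allI impI)
    show "state_on (Cl (region N G)) (\<lambda>x. \<psi> (theta x))"
      using product_stateD(1)[OF \<psi>] by (rule state_on_theta)
    fix k A assume kA: "enat k \<le> N \<and> (\<forall>i<k. A i \<in> Cl (G i))"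
    then have "\<psi> (theta (prod_list (map A [0..<k]))) = (\<Prod>i<k. \<phi> i (theta (A i)))"
      unfolding theta_prod_list by (intro product_stateD(2)[OF \<psi>]) (auto intro: theta_Cl)
    also have "\<dots> = (\<Prod>i<k. \<phi> i (A i))"
      using kA even mem_subsystems_less[of k N] by (intro prod.cong) (auto simp: even_state_def)
    finally show "\<psi> (theta (prod_list (map A [0..<k]))) = (\<Prod>i<k. \<phi> i (A i))" .
  qed
  then show ?thesis
    using product_state_unique[OF disj \<psi>] by (auto simp: states_eq_on_def even_state_def)
qed

lemma product_state_restrict:
  assumes \<psi>: "product_state N G \<phi> \<psi>" and \<phi>: "\<And>i. i \<in> subsystems N \<Longrightarrow> state_on (Cl (G i)) (\<phi> i)"
    and i: "i \<in> subsystems N"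
  shows "states_eq_on (Cl (G i)) \<psi> (\<phi> i)"
  unfolding states_eq_on_def
proof
  fix x assume x: "x \<in> Cl (G i)"
  define A where "A l = (if l = i then x else 1)" for l
  have iN: "enat (Suc i) \<le> N" using i by (simp add: subsystems_def Suc_ile_eq)
  have "\<psi> (prod_list (map A [0..<Suc i])) = (\<Prod>l<Suc i. \<phi> l (A l))"
    by (rule product_stateD(2)[OF \<psi> iN]) (auto simp: A_def x subalg_one[OF Cl_subalgebra])
  moreover have "prod_list (map A [0..<i]) = 1" by (rule prod_list_eq_one) (auto simp: A_def)
  moreover have "(\<Prod>l<i. \<phi> l (A l)) = 1"
  proof (rule prod.neutral, rule ballI)
    fix l assume l: "l \<in> {..<i}"
    then have "l \<in> subsystems N" using mem_subsystems_less[OF iN] by simp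
    then show "\<phi> l (A l) = 1" using l state_on_one[OF \<phi>] by (simp add: A_def)
  qed
  moreover have "A i = x" by (simp add: A_def)
  ultimately show "\<psi> x = \<phi> i x" by simp
qed

text \<open>Serves as the empty product, the start of the induction over subsystems.\<close>

lemma state_on_Cl_empty: "\<exists>\<psi>. state_on (Cl {}) \<psi>"
proof
  define f where "f x = (THE c. x = c *\<^sub>C (1::'a))" for x
  have f: "f (c *\<^sub>C 1) = c" for c
    unfolding f_def
  proof (rule the_equality)
    fix d assume "c *\<^sub>C (1::'a) = d *\<^sub>C 1"
    then have "(c - d) *\<^sub>C (1::'a) = 0"
      using scaleC_add_left[of c "- d" "1::'a"] by simp
    then have "cmod (c - d) * norm (1::'a) = 0" unfolding norm_scaleC[symmetric] by simp
    then show "d = c" by simp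
  qed simp
  show "state_on (Cl {}) f"
    unfolding state_on_def
  proof (intro conjI ballI allI)
    fix x y :: 'a and c assume "x \<in> Cl {}" "y \<in> Cl {}"
    then obtain a b where ab: "x = a *\<^sub>C 1" "y = b *\<^sub>C 1" using Cl_empty by metis
    show "f (x + y) = f x + f y" by (simp add: ab f flip: scaleC_add_left)
  next
    fix x :: 'a and c assume "x \<in> Cl {}"
    then obtain a where a: "x = a *\<^sub>C 1" using Cl_empty by metis
    show "f (c *\<^sub>C x) = c * f x" by (simp add: a f scaleC_scaleC)
    have "star x * x = of_real ((cmod a)\<^sup>2) *\<^sub>C 1"
      by (simp only: a complex_norm_square) (simp add: star_scaleC mult_scaleC_left scaleC_scaleC mult.commute)
    then show "f (star x * x) \<in> \<real>\<^sub>\<ge>\<^sub>0" by (simp only: f) simp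
  next
    show "f 1 = 1" using f[of 1] by simp
  qed
qed

lemma prod_list_mem_Cl:
  assumes "\<And>i. i \<in> set xs \<Longrightarrow> A i \<in> Cl (G i)" "\<And>i. i \<in> set xs \<Longrightarrow> G i \<subseteq> H"
  shows "prod_list (map A xs) \<in> Cl H"
proof (rule subalg_prod_list[OF Cl_subalgebra])
  show "set (map A xs) \<subseteq> Cl H" using assms(1) Cl_mono[OF assms(2)] by auto
qed

text \<open>When subsystem \<open>k\<close> is adjoined, at least one side is even: either
  \<open>\<phi> k\<close>, or all earlier states and with them their product. Both roles in the
  two-factor construction are possible because it asks only for an even state on a finite region and
  controls both orders of multiplication.\<close>

lemma product_state_exists_finite:
  assumes "disjoint_family_on G {..<k}" "\<And>i. i < k \<Longrightarrow> finite (G i)"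
    and "\<And>i. i < k \<Longrightarrow> state_on (Cl (G i)) (\<phi> i)"
    and "\<And>i l. i < k \<Longrightarrow> l < k \<Longrightarrow> i \<noteq> l \<Longrightarrow> even_state (G i) (\<phi> i) \<or> even_state (G l) (\<phi> l)"
  shows "\<exists>\<psi>. product_state (enat k) G \<phi> \<psi>"
  using assms
proof (induction k)
  case 0
  obtain \<psi> where "state_on (Cl {}) \<psi>" using state_on_Cl_empty by blast
  then have "product_state (enat 0) G \<phi> \<psi>"
    by (auto simp: product_state_def region_def subsystems_enat state_on_one)
  then show ?case by blast
next
  case (Suc k)
  have disj: "disjoint_family_on G (subsystems (enat k))"
    using Suc.prems(1) by (auto simp: subsystems_enat disjoint_family_on_def)
  have "\<exists>\<psi>. product_state (enat k) G \<phi> \<psi>"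
    using Suc.prems by (intro Suc.IH) (auto simp: disjoint_family_on_def)
  then obtain \<psi> where \<psi>: "product_state (enat k) G \<phi> \<psi>" by blast
  define R where "R = region (enat k) G"
  have R: "R = (\<Union>i<k. G i)" by (simp add: R_def region_def subsystems_enat)
  have RS: "region (enat (Suc k)) G = R \<union> G k"
    by (auto simp: R region_def subsystems_enat less_Suc_eq)
  have fin: "finite R" "finite (G k)" using Suc.prems(2) by (auto simp: R)
  have "G i \<inter> G k = {}" if "i < k" for i
    using Suc.prems(1) that by (simp add: disjoint_family_on_def)
  then have dR: "R \<inter> G k = {}" "G k \<inter> R = {}" by (auto simp: R)
  have \<psi>R: "state_on (Cl R) \<psi>" using product_stateD(1)[OF \<psi>] by (simp add: R_def)
  have \<phi>k: "state_on (Cl (G k)) (\<phi> k)" using Suc.prems(3) by simp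
  have "\<exists>\<psi>'. state_on (Cl (R \<union> G k)) \<psi>' \<and> (\<forall>y\<in>Cl R. \<forall>x\<in>Cl (G k). \<psi>' (y * x) = \<psi> y * \<phi> k x)"
  proof (cases "even_state (G k) (\<phi> k)")
    case True
    from product_state_exists[OF fin(2) dR(2) \<phi>k True \<psi>R] obtain \<psi>'
      where "state_on (Cl (G k \<union> R)) \<psi>'" "\<forall>x\<in>Cl (G k). \<forall>y\<in>Cl R. \<psi>' (x * y) = \<phi> k x * \<psi> y \<and> \<psi>' (y * x) = \<phi> k x * \<psi> y"
      by (elim exE conjE)
    then show ?thesis by (intro exI[of _ \<psi>']) (simp add: Un_commute mult.commute[of "\<phi> k _"])
  next
    case False
    then have "even_state (G i) (\<phi> i)" if "i < k" for i
      using Suc.prems(4)[of i k] that by auto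
    then have evR: "even_state R \<psi>"
      using product_state_even[OF disj \<psi>] by (auto simp: subsystems_enat R_def)
    from product_state_exists[OF fin(1) dR(1) \<psi>R evR \<phi>k] obtain \<psi>'
      where "state_on (Cl (R \<union> G k)) \<psi>'" "\<forall>x\<in>Cl R. \<forall>y\<in>Cl (G k). \<psi>' (x * y) = \<psi> x * \<phi> k y \<and> \<psi>' (y * x) = \<psi> x * \<phi> k y"
      by (elim exE conjE)
    then show ?thesis by (intro exI[of _ \<psi>']) simp
  qed
  then obtain \<psi>' where \<psi>': "state_on (Cl (R \<union> G k)) \<psi>'"
    and mult: "\<And>y x. y \<in> Cl R \<Longrightarrow> x \<in> Cl (G k) \<Longrightarrow> \<psi>' (y * x) = \<psi> y * \<phi> k x" by blast
  have "product_state (enat (Suc k)) G \<phi> \<psi>'"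
    unfolding product_state_def RS
  proof (intro conjI allI impI)
    show "state_on (Cl (R \<union> G k)) \<psi>'" by (fact \<psi>')
    fix k' A assume kA: "enat k' \<le> enat (Suc k) \<and> (\<forall>i<k'. A i \<in> Cl (G i))"
    have mem: "prod_list (map A [0..<l]) \<in> Cl R" if "l \<le> k" "l \<le> k'" for l
    proof (rule prod_list_mem_Cl[of _ A G])
      fix i assume "i \<in> set [0..<l]"
      then have i: "i < k" "i < k'" using that by auto
      then show "A i \<in> Cl (G i)" using kA by blast
      show "G i \<subseteq> R" using i by (auto simp: R)
    qed
    show "\<psi>' (prod_list (map A [0..<k'])) = (\<Prod>i<k'. \<phi> i (A i))"
    proof (cases "k' \<le> k")
      case True
      then have "\<psi>' (prod_list (map A [0..<k']) * 1) = \<psi> (prod_list (map A [0..<k'])) * \<phi> k 1"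
        by (intro mult mem) (auto simp: subalg_one[OF Cl_subalgebra])
      then show ?thesis
        using product_stateD(2)[OF \<psi>, of k' A] True kA state_on_one[OF \<phi>k] by simp
    next
      case False
      then have k': "k' = Suc k" using kA by simp
      have "\<psi>' (prod_list (map A [0..<k]) * A k) = \<psi> (prod_list (map A [0..<k])) * \<phi> k (A k)"
        using k' kA by (intro mult mem) auto
      then show ?thesis
        using product_stateD(2)[OF \<psi>, of k A] kA by (simp add: k')
    qed
  qed
  then show ?case by blast
qed

lemma Cl_directed_Union:
  assumes mono: "\<And>n p. n \<le> p \<Longrightarrow> H n \<subseteq> H (p::nat)"
  shows "closure (\<Union>n. Cl (H n)) = Cl (\<Union>n. H n)"
proof
  have "(\<Union>n. Cl (H n)) \<subseteq> Cl (\<Union>n. H n)" using Cl_mono by blast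
  then show "closure (\<Union>n. Cl (H n)) \<subseteq> Cl (\<Union>n. H n)"
    using subalg_closed[OF Cl_subalgebra] by (rule closure_minimal)
  have common: "\<exists>n. x \<in> Cl (H n) \<and> y \<in> Cl (H n)" if xy: "x \<in> (\<Union>n. Cl (H n))" "y \<in> (\<Union>n. Cl (H n))" for x y
  proof -
    obtain n p where "x \<in> Cl (H n)" "y \<in> Cl (H p)" using xy by auto
    then have "x \<in> Cl (H (max n p))" "y \<in> Cl (H (max n p))"
      using Cl_mono[OF mono[of n "max n p"]] Cl_mono[OF mono[of p "max n p"]] by auto
    then show ?thesis by blast
  qed
  show "Cl (\<Union>n. H n) \<subseteq> closure (\<Union>n. Cl (H n))"
  proof (rule Cl_minimal)
    show "cstar_subalgebra (closure (\<Union>n. Cl (H n)))"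
    proof (rule cstar_subalgebra_closure)
      fix x y assume "x \<in> (\<Union>n. Cl (H n))" "y \<in> (\<Union>n. Cl (H n))"
      then obtain n where "x \<in> Cl (H n)" "y \<in> Cl (H n)" using common by blast
      then have "x + y \<in> Cl (H n)" "x * y \<in> Cl (H n)"
        by (simp_all add: subalg_add[OF Cl_subalgebra] subalg_mult[OF Cl_subalgebra])
      then show "x + y \<in> (\<Union>n. Cl (H n))" "x * y \<in> (\<Union>n. Cl (H n))" by auto
    qed (blast intro: subalg_one[OF Cl_subalgebra] subalg_star[OF Cl_subalgebra] subalg_scaleC[OF Cl_subalgebra])+
    show "m j \<in> closure (\<Union>n. Cl (H n))" if "j \<in> (\<Union>n. H n)" for j
      using that Cl_generator closure_subset[of "\<Union>n. Cl (H n)"] by blast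
  qed
qed

text \<open>By contractivity the common functional on the union is uniformly continuous.\<close>

lemma state_on_directed_Union:
  assumes mono: "\<And>n p. n \<le> p \<Longrightarrow> H n \<subseteq> H (p::nat)"
    and \<psi>: "\<And>n. state_on (Cl (H n)) (\<psi> n)"
    and coh: "\<And>n p x. n \<le> p \<Longrightarrow> x \<in> Cl (H n) \<Longrightarrow> \<psi> p x = \<psi> n x"
  obtains g where "state_on (Cl (\<Union>n. H n)) g" "\<And>n x. x \<in> Cl (H n) \<Longrightarrow> g x = \<psi> n x"
proof -
  define X where "X = (\<Union>n. Cl (H n))"
  have clX: "closure X = Cl (\<Union>n. H n)" unfolding X_def by (rule Cl_directed_Union) (rule mono)
  define f where "f x = \<psi> (LEAST n. x \<in> Cl (H n)) x" for x
  have f: "f x = \<psi> n x" if x: "x \<in> Cl (H n)" for x n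
    unfolding f_def using coh[of "LEAST n. x \<in> Cl (H n)" n x] Least_le[of "\<lambda>n. x \<in> Cl (H n)" n]
      LeastI[of "\<lambda>n. x \<in> Cl (H n)" n] x by simp
  have common: "\<exists>n. x \<in> Cl (H n) \<and> y \<in> Cl (H n)" if xy: "x \<in> X" "y \<in> X" for x y
  proof -
    obtain n p where "x \<in> Cl (H n)" "y \<in> Cl (H p)" using xy by (auto simp: X_def)
    then have "x \<in> Cl (H (max n p))" "y \<in> Cl (H (max n p))"
      using Cl_mono[OF mono[of n "max n p"]] Cl_mono[OF mono[of p "max n p"]] by auto
    then show ?thesis by blast
  qed
  note P = state_on_positive[OF \<psi>]
  have uc: "uniformly_continuous_on X f"
    unfolding uniformly_continuous_on_def
  proof (intro allI impI)
    fix e :: real assume e: "e > 0"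
    have "dist (f x) (f y) \<le> dist x y" if xy: "x \<in> X" "y \<in> X" for x y
    proof -
      obtain n where n: "x \<in> Cl (H n)" "y \<in> Cl (H n)" using common[OF xy] by blast
      have "f x - f y = \<psi> n (x - y)"
        using n by (simp add: f positive_on_diff[OF Cl_subalgebra P])
      also have "cmod \<dots> \<le> norm (x - y)"
        using n by (intro norm_state_on_le[OF Cl_subalgebra \<psi>] Cl_intros)
      finally show ?thesis by (simp add: dist_norm)
    qed
    then show "\<exists>d>0. \<forall>x\<in>X. \<forall>x'\<in>X. dist x' x < d \<longrightarrow> dist (f x') (f x) < e"
      using e by (meson order_le_less_trans)
  qed
  then obtain g where g: "uniformly_continuous_on (closure X) g" and gf: "\<And>x. x \<in> X \<Longrightarrow> f x = g x"
    using uniformly_continuous_on_extension_on_closure[OF uc] by metis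
  have lim: "(\<lambda>n. f (s n)) \<longlonglongrightarrow> g x" if s: "\<And>n. s n \<in> X" "s \<longlonglongrightarrow> x" for s x
  proof -
    have cl: "s n \<in> closure X" for n using s(1) closure_subset by blast
    then have "x \<in> closure X" using s(2) closed_sequentially[OF closed_closure] by blast
    then have "(\<lambda>n. g (s n)) \<longlonglongrightarrow> g x"
      using uniformly_continuous_imp_continuous[OF g] cl s(2)
      by (intro continuous_on_tendsto_compose[of "closure X" g]) auto
    then show ?thesis using gf[OF s(1)] by simp
  qed
  have fadd: "x + y \<in> X \<and> f (x + y) = f x + f y" if xy: "x \<in> X" "y \<in> X" for x y
  proof -
    obtain n where n: "x \<in> Cl (H n)" "y \<in> Cl (H n)" using common[OF xy] by blast
    then have "x + y \<in> Cl (H n)" by (intro Cl_intros)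
    then show ?thesis using n by (auto simp: f positive_on_add[OF P] X_def)
  qed
  have fscale: "c *\<^sub>C x \<in> X \<and> f (c *\<^sub>C x) = c * f x" if x: "x \<in> X" for x c
  proof -
    obtain n where n: "x \<in> Cl (H n)" using x by (auto simp: X_def)
    then have "c *\<^sub>C x \<in> Cl (H n)" by (intro Cl_intros)
    then show ?thesis using n by (auto simp: f positive_on_scaleC[OF P] X_def)
  qed
  have fpos: "star x * x \<in> X \<and> f (star x * x) \<in> \<real>\<^sub>\<ge>\<^sub>0" if x: "x \<in> X" for x
  proof -
    obtain n where n: "x \<in> Cl (H n)" using x by (auto simp: X_def)
    then have "star x * x \<in> Cl (H n)" by (intro Cl_intros)
    then show ?thesis using n by (auto simp: f positive_on_star_mult[OF P] X_def)
  qed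
  have approx: "\<exists>s. (\<forall>n. s n \<in> X) \<and> s \<longlonglongrightarrow> x" if "x \<in> closure X" for x
    using that by (simp add: closure_sequential)
  have "state_on (closure X) g"
    unfolding state_on_def
  proof (intro conjI ballI allI)
    fix x y assume "x \<in> closure X" "y \<in> closure X"
    then obtain s t where s: "\<And>n. s n \<in> X" "s \<longlonglongrightarrow> x" and t: "\<And>n. t n \<in> X" "t \<longlonglongrightarrow> y"
      using approx by metis
    have "(\<lambda>n. f (s n + t n)) \<longlonglongrightarrow> g (x + y)"
      using fadd s t by (intro lim tendsto_add) auto
    moreover have "(\<lambda>n. f (s n + t n)) \<longlonglongrightarrow> g x + g y"
      using fadd[OF s(1) t(1)] tendsto_add[OF lim[OF s] lim[OF t]] by simp
    ultimately show "g (x + y) = g x + g y" by (rule LIMSEQ_unique)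
  next
    fix x and c :: complex assume "x \<in> closure X"
    then obtain s where s: "\<And>n. s n \<in> X" "s \<longlonglongrightarrow> x" using approx by metis
    have "(\<lambda>n. f (c *\<^sub>C s n)) \<longlonglongrightarrow> g (c *\<^sub>C x)"
      using fscale s by (intro lim tendsto_scaleC) auto
    moreover have "(\<lambda>n. f (c *\<^sub>C s n)) \<longlonglongrightarrow> c * g x"
      using fscale[OF s(1)] tendsto_mult[OF tendsto_const lim[OF s]] by simp
    ultimately show "g (c *\<^sub>C x) = c * g x" by (rule LIMSEQ_unique)
    have "(\<lambda>n. f (star (s n) * s n)) \<longlonglongrightarrow> g (star x * x)"
      using fpos s by (intro lim tendsto_mult tendsto_star) auto
    then show "g (star x * x) \<in> \<real>\<^sub>\<ge>\<^sub>0"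
      using fpos[OF s(1)] closed_sequentially[OF closed_nonneg_Reals_complex, of "\<lambda>n. f (star (s n) * s n)"]
      by simp
  next
    have "1 \<in> Cl (H 0)" by (intro Cl_intros)
    then show "g 1 = 1" using gf[of 1] f[of 1 0] state_on_one[OF \<psi>, of 0] by (auto simp: X_def)
  qed
  moreover have "g x = \<psi> n x" if "x \<in> Cl (H n)" for n x
  proof -
    have "x \<in> X" using that by (auto simp: X_def)
    then show ?thesis using gf f[OF that] by simp
  qed
  ultimately show ?thesis using that clX by simp
qed

section \<open>Existence for arbitrary regions by truncation\<close>

lemma tendsto_prod_list:
  assumes "\<And>i. i \<in> set xs \<Longrightarrow> (\<lambda>n. s i n) \<longlonglongrightarrow> A i"
  shows "(\<lambda>n. prod_list (map (\<lambda>i. s i n) xs)) \<longlonglongrightarrow> (prod_list (map A xs) :: 'a)"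
  using assms by (induction xs) (simp_all add: tendsto_mult)

text \<open>Stage \<open>n\<close> keeps only the subsystems and the generators below
  \<open>n\<close>, so it is finite in both respects. Uniqueness makes the stages coherent. The
  limit state has the product property for truncated factors, and continuity of all states involved
  extends it to arbitrary ones.\<close>

lemma product_state_exists_infinite:
  assumes disj: "disjoint_family_on G (subsystems N)"
    and \<phi>: "\<And>i. i \<in> subsystems N \<Longrightarrow> state_on (Cl (G i)) (\<phi> i)"
    and even: "\<And>i l. i \<in> subsystems N \<Longrightarrow> l \<in> subsystems N \<Longrightarrow> i \<noteq> l \<Longrightarrow>
      even_state (G i) (\<phi> i) \<or> even_state (G l) (\<phi> l)"
  shows "\<exists>\<psi>. product_state N G \<phi> \<psi>"
proof -
  define J where "J n i = G i \<inter> {..<n}" for n i :: nat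
  define M where "M n = min (enat n) N" for n
  have MN: "M n \<le> N" for n by (simp add: M_def)
  have Mmono: "M n \<le> M p" if "n \<le> p" for n p using that unfolding M_def by (intro min.mono) simp_all
  have subM: "i \<in> subsystems N" if "i \<in> subsystems (M n)" for i n
    using that order_less_le_trans[OF _ MN[of n]] by (simp add: subsystems_def)
  have JG: "Cl (J n i) \<subseteq> Cl (G i)" for n i by (rule Cl_mono) (auto simp: J_def)
  have Jmono: "Cl (J n i) \<subseteq> Cl (J p i)" if "n \<le> p" for n p i using that by (intro Cl_mono) (auto simp: J_def)
  have disjJ: "disjoint_family_on (J n) (subsystems (M n))" for n
    using disj subM[of _ n] by (force simp: disjoint_family_on_def J_def)
  have "\<exists>\<psi>. product_state (M n) (J n) \<phi> \<psi>" for n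
  proof -
    obtain k where k: "M n = enat k" unfolding M_def by (metis enat_ile min.cobounded1)
    have sub: "i \<in> subsystems N" if "i < k" for i using that subM[of i n] by (simp add: k subsystems_enat)
    have "\<exists>\<psi>. product_state (enat k) (J n) \<phi> \<psi>"
    proof (rule product_state_exists_finite)
      show "disjoint_family_on (J n) {..<k}" using disjJ[of n] by (simp add: k subsystems_enat)
      show "finite (J n i)" for i by (simp add: J_def)
      show "state_on (Cl (J n i)) (\<phi> i)" if "i < k" for i
        using state_on_subset[OF \<phi>[OF sub[OF that]] JG] .
      show "even_state (J n i) (\<phi> i) \<or> even_state (J n l) (\<phi> l)" if "i < k" "l < k" "i \<noteq> l" for i l
        using even[OF sub[OF that(1)] sub[OF that(2)] that(3)] JG[of n] unfolding even_state_def by blast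
    qed
    then show ?thesis by (simp add: k)
  qed
  then obtain \<psi> where \<psi>: "\<And>n. product_state (M n) (J n) \<phi> (\<psi> n)" by metis
  define F where "F n = region (M n) (J n)" for n
  have Fmono: "F n \<subseteq> F p" if "n \<le> p" for n p
  proof
    fix j assume "j \<in> F n"
    then obtain i where i: "i \<in> subsystems (M n)" "j \<in> J n i" by (auto simp: F_def region_def)
    have "i \<in> subsystems (M p)"
      using i(1) order_less_le_trans[OF _ Mmono[OF that]] by (simp add: subsystems_def)
    moreover have "j \<in> J p i" using i(2) that by (simp add: J_def)
    ultimately show "j \<in> F p" by (auto simp: F_def region_def)
  qed
  have FU: "(\<Union>n. F n) = region N G"
  proof (intro equalityI subsetI)
    fix j assume "j \<in> (\<Union>n. F n)"
    then show "j \<in> region N G" using subM by (fastforce simp: F_def region_def J_def)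
  next
    fix j assume "j \<in> region N G"
    then obtain i where i: "i \<in> subsystems N" "j \<in> G i" by (auto simp: region_def)
    \<comment> \<open>The stage must exceed both the subsystem \<open>i\<close> and the generator
      \<open>j\<close>.\<close>
    then have "i \<in> subsystems (M (Suc (max i j)))" by (auto simp: subsystems_def M_def)
    moreover have "j \<in> J (Suc (max i j)) i" using i by (auto simp: J_def)
    ultimately show "j \<in> (\<Union>n. F n)" by (auto simp: F_def region_def)
  qed
  have st: "state_on (Cl (F n)) (\<psi> n)" for n using product_stateD(1)[OF \<psi>] by (simp add: F_def)
  have coh: "\<psi> p x = \<psi> n x" if "n \<le> p" "x \<in> Cl (F n)" for n p x
  proof -
    have "product_state (M n) (J n) \<phi> (\<psi> p)"
      unfolding product_state_def
    proof (intro conjI allI impI)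
      show "state_on (Cl (region (M n) (J n))) (\<psi> p)"
        using state_on_subset[OF st Cl_mono[OF Fmono[OF that(1)]]] by (simp add: F_def)
      fix k A assume "enat k \<le> M n \<and> (\<forall>i<k. A i \<in> Cl (J n i))"
      then show "\<psi> p (prod_list (map A [0..<k])) = (\<Prod>i<k. \<phi> i (A i))"
        using Jmono[OF that(1)] Mmono[OF that(1)] by (intro product_stateD(2)[OF \<psi>]) auto
    qed
    then show ?thesis
      using product_state_unique[OF disjJ _ \<psi>] that(2) by (auto simp: states_eq_on_def F_def)
  qed
  obtain g where g: "state_on (Cl (region N G)) g" and g\<psi>: "\<And>n x. x \<in> Cl (F n) \<Longrightarrow> g x = \<psi> n x"
    using state_on_directed_Union[of F \<psi>, OF Fmono st coh] unfolding FU by blast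
  have "product_state N G \<phi> g"
    unfolding product_state_def
  proof (intro conjI allI impI)
    show "state_on (Cl (region N G)) g" by (fact g)
    fix k A assume kA: "enat k \<le> N \<and> (\<forall>i<k. A i \<in> Cl (G i))"
    have "\<exists>s. (\<forall>n. s n \<in> (\<Union>n. Cl (J n i))) \<and> s \<longlonglongrightarrow> A i" if "i < k" for i
    proof -
      have "closure (\<Union>n. Cl (J n i)) = Cl (\<Union>n. J n i)"
        by (rule Cl_directed_Union) (auto simp: J_def)
      also have "(\<Union>n. J n i) = G i" by (auto simp: J_def)
      finally have "A i \<in> closure (\<Union>n. Cl (J n i))" using kA that by simp
      then show ?thesis by (simp add: closure_sequential)
    qed
    then obtain s where s: "\<And>i n. i < k \<Longrightarrow> s i n \<in> (\<Union>n. Cl (J n i))" "\<And>i. i < k \<Longrightarrow> s i \<longlonglongrightarrow> A i"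
      by metis
    have eq: "g (prod_list (map (\<lambda>i. s i n) [0..<k])) = (\<Prod>i<k. \<phi> i (s i n))"
      and mem: "prod_list (map (\<lambda>i. s i n) [0..<k]) \<in> Cl (region N G)" for n
    proof -
      have "\<forall>i<k. \<exists>p. s i n \<in> Cl (J p i)" using s(1) by blast
      then obtain q where q: "\<And>i. i < k \<Longrightarrow> s i n \<in> Cl (J (q i) i)" by metis
      \<comment> \<open>A stage that admits \<open>k\<close> subsystems and contains all
        \<open>k\<close> approximating factors.\<close>
      define p where "p = k + (\<Sum>i<k. q i)"
      have "q i \<le> p" if "i < k" for i
        using that member_le_sum[of i "{..<k}" q] by (simp add: p_def)
      then have sp: "s i n \<in> Cl (J p i)" if "i < k" for i using q[OF that] Jmono that by blast
      have kM: "enat k \<le> M p" using kA by (simp add: M_def p_def)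
      have mF: "prod_list (map (\<lambda>i. s i n) [0..<k]) \<in> Cl (F p)"
        using sp mem_subsystems_less[OF kM]
        by (intro prod_list_mem_Cl[of _ _ "J p"]) (auto simp: F_def region_def)
      then show "g (prod_list (map (\<lambda>i. s i n) [0..<k])) = (\<Prod>i<k. \<phi> i (s i n))"
        using g\<psi>[OF mF] product_stateD(2)[OF \<psi> kM sp] by simp
      show "prod_list (map (\<lambda>i. s i n) [0..<k]) \<in> Cl (region N G)"
        using mF Cl_mono[of "F p" "region N G"] FU by blast
    qed
    have "(\<lambda>n. prod_list (map (\<lambda>i. s i n) [0..<k])) \<longlonglongrightarrow> prod_list (map A [0..<k])"
      using s(2) by (intro tendsto_prod_list) auto
    then have "(\<lambda>n. g (prod_list (map (\<lambda>i. s i n) [0..<k]))) \<longlonglongrightarrow> g (prod_list (map A [0..<k]))"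
      by (intro state_on_tendsto[OF Cl_subalgebra g] mem)
    then have l1: "(\<lambda>n. \<Prod>i<k. \<phi> i (s i n)) \<longlonglongrightarrow> g (prod_list (map A [0..<k]))"
      unfolding eq .
    have "(\<lambda>n. \<phi> i (s i n)) \<longlonglongrightarrow> \<phi> i (A i)" if "i < k" for i
    proof (rule state_on_tendsto[OF Cl_subalgebra \<phi>])
      show "i \<in> subsystems N" using mem_subsystems_less[of k N i] kA that by blast
      show "s i n \<in> Cl (G i)" for n using s(1)[OF that] JG by blast
      show "s i \<longlonglongrightarrow> A i" using s(2)[OF that] .
    qed
    then have "(\<lambda>n. \<Prod>i<k. \<phi> i (s i n)) \<longlonglongrightarrow> (\<Prod>i<k. \<phi> i (A i))"
      by (intro tendsto_prod) auto
    with l1 show "g (prod_list (map A [0..<k])) = (\<Prod>i<k. \<phi> i (A i))" by (rule LIMSEQ_unique)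
  qed
  then show ?thesis by blast
qed


text \<open>An element on which \<open>\<phi>\<close> is not invariant yields the odd element
  \<open>z - theta z\<close> with nonzero value; its real or its imaginary part keeps a nonzero
  value.\<close>

lemma odd_selfadjoint_witness:
  assumes \<phi>: "state_on (Cl H) \<phi>" and "\<not> even_state H \<phi>"
  obtains x where "x \<in> Cl H" "theta x = - x" "star x = x" "\<phi> x \<noteq> 0"
proof -
  note P = state_on_positive[OF \<phi>]
  obtain z where z: "z \<in> Cl H" "\<phi> (theta z) \<noteq> \<phi> z" using assms(2) by (auto simp: even_state_def)
  define w where "w = z - theta z"
  have w: "w \<in> Cl H" unfolding w_def using z(1) by (intro Cl_intros theta_Cl)
  have tw: "theta w = - w" by (simp add: w_def theta_diff)
  have "\<phi> w \<noteq> 0"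
    using z by (simp add: w_def positive_on_diff[OF Cl_subalgebra P] theta_Cl)
  then consider "Re (\<phi> w) \<noteq> 0" | "Im (\<phi> w) \<noteq> 0" by (auto simp: complex_eq_iff)
  then show ?thesis
  proof cases
    case 1
    have "\<phi> (w + star w) = \<phi> w + cnj (\<phi> w)"
      using w by (simp add: positive_on_add[OF P] positive_on_star[OF Cl_subalgebra P] subalg_star[OF Cl_subalgebra])
    then have "\<phi> (w + star w) \<noteq> 0" using 1 by (simp add: complex_eq_iff)
    moreover have "w + star w \<in> Cl H" using w by (intro Cl_intros)
    ultimately show ?thesis
      by (intro that[of "w + star w"]) (simp_all add: theta_add theta_star tw star_add star_star add.commute)
  next
    case 2
    have "\<phi> (\<i> *\<^sub>C (w - star w)) = \<i> * (\<phi> w - cnj (\<phi> w))"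
      using w by (simp add: positive_on_scaleC[OF P] positive_on_diff[OF Cl_subalgebra P]
          positive_on_star[OF Cl_subalgebra P] subalg_star[OF Cl_subalgebra] subalg_diff[OF Cl_subalgebra])
    then have "\<phi> (\<i> *\<^sub>C (w - star w)) \<noteq> 0" using 2 by (simp add: complex_eq_iff)
    moreover have "\<i> *\<^sub>C (w - star w) \<in> Cl H" using w by (intro Cl_intros)
    ultimately show ?thesis
      by (intro that[of "\<i> *\<^sub>C (w - star w)"])
         (simp_all add: theta_scaleC theta_diff theta_star tw star_scaleC star_diff star_star
           flip: scaleC_minus_right)
  qed
qed

text \<open>Odd self-adjoint elements of disjoint regions anticommute, so their product is
  anti-self-adjoint and has imaginary expectation, whereas a product state makes it real and nonzero.\<close>

lemma product_state_at_most_one_noneven: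
  assumes disj: "disjoint_family_on G (subsystems N)"
    and \<phi>: "\<And>i. i \<in> subsystems N \<Longrightarrow> state_on (Cl (G i)) (\<phi> i)"
    and \<psi>: "product_state N G \<phi> \<psi>"
    and il: "i \<in> subsystems N" "l \<in> subsystems N" "i < l"
  shows "even_state (G i) (\<phi> i) \<or> even_state (G l) (\<phi> l)"
proof (rule ccontr)
  assume "\<not> ?thesis"
  then have ni: "\<not> even_state (G i) (\<phi> i)" and nl: "\<not> even_state (G l) (\<phi> l)" by auto
  obtain x where x: "x \<in> Cl (G i)" "theta x = - x" "star x = x" "\<phi> i x \<noteq> 0"
    using odd_selfadjoint_witness[OF \<phi>[OF il(1)] ni] .
  obtain y where y: "y \<in> Cl (G l)" "theta y = - y" "star y = y" "\<phi> l y \<noteq> 0"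
    using odd_selfadjoint_witness[OF \<phi>[OF il(2)] nl] .
  define A where "A p = (if p = i then x else if p = l then y else 1)" for p
  have lN: "enat (Suc l) \<le> N" using il(2) by (simp add: subsystems_def Suc_ile_eq)
  have val: "\<psi> (prod_list (map A [0..<Suc l])) = (\<Prod>p<Suc l. \<phi> p (A p))"
    by (rule product_stateD(2)[OF \<psi> lN]) (auto simp: A_def x y subalg_one[OF Cl_subalgebra])
  have split: "[0..<Suc l] = [0..<i] @ i # [Suc i..<l] @ [l]"
  proof -
    have "[0..<l] = [0..<i] @ [i..<l]"
      using il(3) upt_add_eq_append[of 0 i "l - i"] by simp
    also have "[i..<l] = i # [Suc i..<l]" using il(3) by (rule upt_conv_Cons)
    finally show ?thesis by simp
  qed
  have one: "prod_list (map A [0..<i]) = 1" "prod_list (map A [Suc i..<l]) = 1"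
    by (rule prod_list_eq_one; use il(3) in \<open>auto simp: A_def\<close>)+
  have Ail: "A i = x" "A l = y" using il(3) by (auto simp: A_def)
  have "prod_list (map A [0..<Suc l]) = x * y"
    unfolding split by (simp add: one Ail)
  moreover have "(\<Prod>p<Suc l. \<phi> p (A p)) = (\<Prod>p\<in>{i, l}. \<phi> p (A p))"
  proof (rule prod.mono_neutral_right)
    show "\<forall>p\<in>{..<Suc l} - {i, l}. \<phi> p (A p) = 1"
    proof
      fix p assume p: "p \<in> {..<Suc l} - {i, l}"
      then have "p \<in> subsystems N" using mem_subsystems_less[OF lN] by auto
      then show "\<phi> p (A p) = 1" using p state_on_one[OF \<phi>] by (simp add: A_def)
    qed
  qed (use il in auto)
  ultimately have xy: "\<psi> (x * y) = \<phi> i x * \<phi> l y" using val il(3) Ail by simp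
  have "G i \<inter> G l = {}" using disj il by (auto simp: disjoint_family_on_def)
  then have anti: "y * x = - (x * y)"
    using Cl_commute_odd[OF x(1,2) y(1)] by (simp add: y)
  have sub: "G i \<subseteq> region N G" "G l \<subseteq> region N G" using il subset_region by auto
  then have mem: "x * y \<in> Cl (region N G)"
    using x(1) y(1) Cl_mono by (intro Cl_intros) blast+
  note P = state_on_positive[OF product_stateD(1)[OF \<psi>]]
  have "\<psi> (star (x * y)) = - \<psi> (x * y)"
    using positive_on_minus[OF P mem] by (simp add: star_mult x y anti)
  then have "cnj (\<psi> (x * y)) = - \<psi> (x * y)"
    using positive_on_star[OF Cl_subalgebra P mem] by simp
  moreover have "cnj (\<phi> i x) = \<phi> i x" "cnj (\<phi> l y) = \<phi> l y"
    using positive_on_star[OF Cl_subalgebra state_on_positive[OF \<phi>[OF il(1)]] x(1)]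
      positive_on_star[OF Cl_subalgebra state_on_positive[OF \<phi>[OF il(2)]] y(1)] x(3) y(3) by simp_all
  ultimately show False using xy x(4) y(4) by simp
qed

section \<open>Joint extensions of pure states\<close>

text \<open>The part of \<open>Cl K\<close> that commutes with the algebra of every disjoint region.
  Being a closed subalgebra, it contains the square roots used in the commuting case.\<close>

definition evens :: "nat set \<Rightarrow> 'a set" where
  "evens K = {y \<in> Cl K. theta y = y}"

lemma evens_subalgebra: "cstar_subalgebra (evens K)"
proof (rule cstar_subalgebraI)
  have "closed (Cl K \<inter> {y. theta y = y})"
    by (intro closed_Int subalg_closed[OF Cl_subalgebra] closed_Collect_eq continuous_intros continuous_on_theta)
  then show "closed (evens K)" by (simp add: evens_def Collect_conj_eq)
qed (auto simp: evens_def theta_add theta_mult theta_scaleC theta_star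
    subalg_one[OF Cl_subalgebra] subalg_add[OF Cl_subalgebra] subalg_mult[OF Cl_subalgebra]
    subalg_scaleC[OF Cl_subalgebra] subalg_star[OF Cl_subalgebra])

lemma pure_state_product_evens:
  assumes "H \<inter> K = {}" "H \<union> K \<subseteq> R" "state_on (Cl R) \<psi>" "pure_on (Cl H) \<phi>"
    "states_eq_on (Cl H) \<psi> \<phi>" "x \<in> Cl H" "y \<in> evens K"
  shows "\<psi> (x * y) = \<phi> x * \<psi> y"
proof (rule pure_on_product_commuting[OF Cl_subalgebra Cl_subalgebra _ evens_subalgebra _ _ assms(3-7)])
  show "Cl H \<subseteq> Cl R" using assms(2) by (intro Cl_mono) auto
  have "Cl K \<subseteq> Cl R" using assms(2) by (intro Cl_mono) auto
  then show "evens K \<subseteq> Cl R" by (auto simp: evens_def)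
  show "x * y = y * x" if "x \<in> Cl H" "y \<in> evens K" for x y
    using that Cl_commute[of y K x H] assms(1) by (auto simp: evens_def Int_commute)
qed

text \<open>The even part of \<open>y\<close> falls under the commuting case. For odd self-adjoint
  \<open>h\<close> one has \<open>h * x * h = theta x * (h * h)\<close> with \<open>h * h\<close>
  even, so the commuting case and evenness of \<open>\<phi>\<close> give the proportionality that
  the anticommuting case requires.\<close>

lemma pure_even_state_product:
  assumes HK: "H \<inter> K = {}" "H \<union> K \<subseteq> R" and \<psi>: "state_on (Cl R) \<psi>" and pure: "pure_on (Cl H) \<phi>"
    and even: "even_state H \<phi>" and eq: "states_eq_on (Cl H) \<psi> \<phi>" and x: "x \<in> Cl H" and y: "y \<in> Cl K"
  shows "\<psi> (x * y) = \<phi> x * \<psi> y" and "\<psi> (y * x) = \<phi> x * \<psi> y"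
proof -
  note P = state_on_positive[OF \<psi>]
  have HR: "Cl H \<subseteq> Cl R" and KR: "Cl K \<subseteq> Cl R" using HK(2) by (auto intro!: Cl_mono)
  have KH: "K \<inter> H = {}" using HK(1) by auto
  note evens = pure_state_product_evens[OF HK \<psi> pure eq]
  have odd_sa: "\<psi> (x * h) = \<phi> x * \<psi> h"
    if x: "x \<in> Cl H" and h: "h \<in> Cl K" "theta h = - h" "star h = h" for x h
  proof (rule pure_on_product_anticommuting[OF Cl_subalgebra Cl_subalgebra HR \<psi> pure eq _ h(3) _ x])
    show "h \<in> Cl R" using h KR by auto
    fix x assume x: "x \<in> Cl H"
    have "h * x = theta x * h" using Cl_commute_odd[OF h(1,2) x KH] .
    then have "h * x * h = theta x * (h * h)" by (simp add: mult.assoc)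
    moreover have "h * h \<in> evens K"
      using h by (simp add: evens_def theta_mult subalg_mult[OF Cl_subalgebra])
    ultimately have "\<psi> (h * x * h) = \<phi> (theta x) * \<psi> (h * h)"
      using evens[OF theta_Cl[OF x]] by simp
    then show "\<psi> (h * x * h) = \<psi> (h * h) * \<phi> x"
      using even x by (simp add: even_state_def)
  qed
  have main: "\<psi> (x * y) = \<phi> x * \<psi> y" if x: "x \<in> Cl H" and y: "y \<in> Cl K" for x y
  proof -
    define w where "w = y - theta y"
    define e where "e = y + theta y"
    define h1 h2 where "h1 = w + star w" and "h2 = \<i> *\<^sub>C (star w - w)"
    have w: "w \<in> Cl K" unfolding w_def using y by (intro Cl_intros theta_Cl)
    have tw: "theta w = - w" by (simp add: w_def theta_diff)
    have h: "h1 \<in> Cl K" "h2 \<in> Cl K" using w by (simp_all add: h1_def h2_def Cl_intros)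
    have th: "theta h1 = - h1" "theta h2 = - h2"
      by (simp_all add: h1_def h2_def theta_add theta_diff theta_scaleC theta_star tw flip: scaleC_minus_right)
    have sh: "star h1 = h1" "star h2 = h2"
      by (simp_all add: h1_def h2_def star_add star_diff star_scaleC star_star add.commute flip: scaleC_minus_right)
    have e: "e \<in> evens K"
      using y by (simp add: e_def evens_def theta_add theta_Cl subalg_add[OF Cl_subalgebra] add.commute)
    have hs: "h1 + \<i> *\<^sub>C h2 = 2 *\<^sub>C w"
      using scaleC_add_left[of 1 1 w] by (simp add: h1_def h2_def scaleC_scaleC scaleC_diff_right)
    \<comment> \<open>Two unnormalised splittings, into even and odd and into real and imaginary
      part, each contribute a factor 2.\<close>
    have dec: "4 *\<^sub>C y = 2 *\<^sub>C e + (h1 + \<i> *\<^sub>C h2)"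
    proof -
      have "e + w = 2 *\<^sub>C y" using scaleC_add_left[of 1 1 y] by (simp add: e_def w_def)
      then have "2 *\<^sub>C (e + w) = 4 *\<^sub>C y" by (simp add: scaleC_scaleC)
      then show ?thesis by (simp add: hs scaleC_add_right)
    qed
    have mem: "x \<in> Cl R" "y \<in> Cl R" "e \<in> Cl R" "h1 \<in> Cl R" "h2 \<in> Cl R"
      using x y e h HR KR by (auto simp: evens_def)
    have prods: "x * y \<in> Cl R" "x * e \<in> Cl R" "x * h1 \<in> Cl R" "x * h2 \<in> Cl R"
      using mem by (simp_all add: subalg_mult[OF Cl_subalgebra])
    have lin: "\<psi> (2 *\<^sub>C a + (b + \<i> *\<^sub>C c)) = 2 * \<psi> a + (\<psi> b + \<i> * \<psi> c)"
      if "a \<in> Cl R" "b \<in> Cl R" "c \<in> Cl R" for a b c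
      using that by (simp add: positive_on_add[OF P] positive_on_scaleC[OF P]
          subalg_add[OF Cl_subalgebra] subalg_scaleC[OF Cl_subalgebra])
    have "4 * \<psi> (x * y) = \<psi> (x * (4 *\<^sub>C y))"
      using prods by (simp add: mult_scaleC_right positive_on_scaleC[OF P])
    also have "x * (4 *\<^sub>C y) = 2 *\<^sub>C (x * e) + (x * h1 + \<i> *\<^sub>C (x * h2))"
      unfolding dec by (simp add: distrib_left mult_scaleC_right)
    also have "\<psi> \<dots> = 2 * \<psi> (x * e) + (\<psi> (x * h1) + \<i> * \<psi> (x * h2))"
      using prods by (intro lin)
    also have "\<dots> = \<phi> x * (2 * \<psi> e + (\<psi> h1 + \<i> * \<psi> h2))"
      using evens[OF x e] odd_sa[OF x h(1) th(1) sh(1)] odd_sa[OF x h(2) th(2) sh(2)]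
      by (simp add: algebra_simps)
    also have "2 * \<psi> e + (\<psi> h1 + \<i> * \<psi> h2) = \<psi> (4 *\<^sub>C y)"
      unfolding dec using mem by (intro lin[symmetric])
    also have "\<dots> = 4 * \<psi> y" using mem by (simp add: positive_on_scaleC[OF P])
    finally show ?thesis by simp
  qed
  show "\<psi> (x * y) = \<phi> x * \<psi> y" using main x y .
  have "star x * star y \<in> Cl R" using x y HR KR by (intro Cl_intros) auto
  then have "\<psi> (star (star x * star y)) = cnj (\<psi> (star x * star y))"
    by (rule positive_on_star[OF Cl_subalgebra P])
  also have "\<psi> (star x * star y) = \<phi> (star x) * \<psi> (star y)"
    using x y by (intro main) (simp_all add: subalg_star[OF Cl_subalgebra])
  also have "\<psi> (star y) = cnj (\<psi> y)"
    using y KR by (intro positive_on_star[OF Cl_subalgebra P]) auto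
  also have "\<phi> (star x) = cnj (\<phi> x)"
    using pure x by (intro positive_on_star[OF Cl_subalgebra state_on_positive]) (auto simp: pure_on_def)
  finally show "\<psi> (y * x) = \<phi> x * \<psi> y" by (simp add: star_mult star_star)
qed

text \<open>If \<open>\<phi>\<^sub>1\<close> is not even, choose an odd self-adjoint \<open>x\<close> with \<open>p = \<phi>\<^sub>1 x \<noteq> 0\<close>. With
  \<open>c = \<phi>\<^sub>1 (x\<^sup>2)\<close>, \<open>\<epsilon> = - p / (2 c)\<close> and \<open>d = p\<^sup>2 / (4 c)\<close> the positive functional
  \<open>y \<mapsto> \<psi> ((1 + \<epsilon> x) y (1 + \<epsilon> x))\<close> equals \<open>(1 - 2 d) \<phi>\<^sub>2 - d \<phi>\<^sub>2 \<circ> \<Theta>\<close>, so that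
  \<open>\<phi>\<^sub>2 \<circ> \<Theta>\<close> is dominated by a multiple of \<open>\<phi>\<^sub>2\<close>.\<close>

lemma pure_noneven_imp_even:
  assumes HK: "H \<inter> K = {}" "H \<union> K \<subseteq> R" and \<psi>: "state_on (Cl R) \<psi>"
    and pure1: "pure_on (Cl H) \<phi>1" and eq1: "states_eq_on (Cl H) \<psi> \<phi>1"
    and pure2: "pure_on (Cl K) \<phi>2" and eq2: "states_eq_on (Cl K) \<psi> \<phi>2"
    and noneven: "\<not> even_state H \<phi>1"
  shows "even_state K \<phi>2"
proof -
  note P = state_on_positive[OF \<psi>]
  have HR: "Cl H \<subseteq> Cl R" and KR: "Cl K \<subseteq> Cl R" using HK(2) by (auto intro!: Cl_mono)
  have KH: "K \<inter> H = {}" "K \<union> H \<subseteq> R" using HK by auto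
  have \<phi>1: "state_on (Cl H) \<phi>1" and \<phi>2: "state_on (Cl K) \<phi>2" using pure1 pure2 by (auto simp: pure_on_def)
  note P1 = state_on_positive[OF \<phi>1] and P2 = state_on_positive[OF \<phi>2]
  obtain x where x: "x \<in> Cl H" "theta x = - x" "star x = x" "\<phi>1 x \<noteq> 0"
    using odd_selfadjoint_witness[OF \<phi>1 noneven] .
  obtain p where p: "\<phi>1 x = complex_of_real p"
    using positive_on_selfadjoint[OF Cl_subalgebra P1 x(1,3)] by (auto elim: Reals_cases)
  have xxH: "x * x \<in> Cl H" using x(1) by (intro Cl_intros)
  define c where "c = Re (\<phi>1 (x * x))"
  have c: "\<phi>1 (x * x) = of_real c"
    using positive_on_star_mult[OF P1 x(1)] x(3) by (auto simp: complex_nonneg_Reals_iff complex_eq_iff c_def)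
  have pc: "p\<^sup>2 \<le> c"
    using norm_state_on_square_le[OF Cl_subalgebra \<phi>1 x(1)] x(3) by (simp add: c_def p)
  have p0: "p\<^sup>2 > 0" using x(4) p by simp
  then have c0: "c > 0" using pc by linarith
  \<comment> \<open>In the perturbed functional \<open>\<phi>2\<close> after \<open>theta\<close>
    has coefficient \<open>r * p + r * r * c\<close>; this \<open>r\<close> minimises it, with
    minimum \<open>- d\<close>. The variance inequality \<open>pc\<close> gives \<open>d\<close> at
    most 1/4, so the value at 1, namely \<open>1 - 3 * d\<close>, stays positive.\<close>
  define r d where "r = - p / (2 * c)" and "d = p\<^sup>2 / (4 * c)"
  have d: "d > 0" "d \<le> 1 / 4" using p0 c0 pc by (auto simp: d_def field_simps)
  have rp: "r * p = - 2 * d" "r * r * c = d"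
    using c0 by (auto simp: r_def d_def power2_eq_square field_simps)
  define z where "z = 1 + complex_of_real r *\<^sub>C x"
  have zR: "z \<in> Cl R" unfolding z_def using x(1) HR by (intro Cl_intros) auto
  have F: "\<psi> (star z * y * z) = of_real (1 - 2 * d) * \<phi>2 y - of_real d * \<phi>2 (theta y)"
    if y: "y \<in> Cl K" for y
  proof -
    have xy: "x * y = theta y * x" using Cl_commute_odd[OF x(1,2) y HK(1)] .
    \<comment> \<open>By \<open>x * y = theta y * x\<close> the linear term contains only this even
      element, so purity of \<open>\<phi>1\<close> evaluates it. The quadratic term contains the
      even \<open>x * x\<close>, and there purity of \<open>\<phi>2\<close> is used.\<close>
    define e where "e = y + theta y"
    have e: "e \<in> evens K"
      using y by (simp add: e_def evens_def theta_add theta_Cl subalg_add[OF Cl_subalgebra] add.commute)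
    have eK: "e \<in> Cl K" using e by (simp add: evens_def)
    have ex: "e * x = x * e" using Cl_commute[OF eK _ x(1) KH(1)] e by (simp add: evens_def)
    have "star z * y * z = y + complex_of_real r *\<^sub>C (y * x + x * y) + complex_of_real (r * r) *\<^sub>C (x * y * x)"
      by (simp add: z_def star_add star_scaleC x(3) mult_scaleC_left mult_scaleC_right scaleC_scaleC
          algebra_simps scaleC_add_right)
    also have "y * x + x * y = x * e" unfolding xy ex[symmetric] by (simp add: e_def distrib_right)
    also have "x * y * x = theta y * (x * x)" unfolding xy by (simp add: mult.assoc)
    finally have zyz: "star z * y * z = y + complex_of_real r *\<^sub>C (x * e) + complex_of_real (r * r) *\<^sub>C (theta y * (x * x))" .
    have mem: "y \<in> Cl R" "x * e \<in> Cl R" "theta y * (x * x) \<in> Cl R"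
      using y x(1) eK xxH theta_Cl[OF y] HR KR by (auto intro!: subalg_mult[OF Cl_subalgebra])
    have xx: "x * x \<in> evens H" using xxH x(2) by (simp add: evens_def theta_mult)
    have "\<psi> (x * e) = of_real p * (\<phi>2 y + \<phi>2 (theta y))"
    proof -
      have "\<psi> (x * e) = \<phi>1 x * \<psi> e"
        by (rule pure_state_product_evens[OF HK \<psi> pure1 eq1 x(1) e])
      also have "\<psi> e = \<phi>2 e" using eq2 eK by (simp add: states_eq_on_def)
      also have "\<dots> = \<phi>2 y + \<phi>2 (theta y)" using y by (simp add: e_def positive_on_add[OF P2] theta_Cl)
      finally show ?thesis by (simp add: p)
    qed
    moreover have "\<psi> (theta y * (x * x)) = \<phi>2 (theta y) * of_real c"
      using pure_state_product_evens[OF KH \<psi> pure2 eq2 theta_Cl[OF y] xx] eq1 xxH c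
      by (simp add: states_eq_on_def)
    moreover have "\<psi> y = \<phi>2 y" using eq2 y by (simp add: states_eq_on_def)
    ultimately have "\<psi> (star z * y * z)
      = \<phi>2 y + of_real r * (of_real p * (\<phi>2 y + \<phi>2 (theta y))) + of_real (r * r) * (\<phi>2 (theta y) * of_real c)"
      unfolding zyz using mem
      by (simp add: positive_on_add[OF P] positive_on_scaleC[OF P] subalg_add[OF Cl_subalgebra] subalg_scaleC[OF Cl_subalgebra])
    also have "\<dots> = \<phi>2 y + of_real (r * p) * (\<phi>2 y + \<phi>2 (theta y)) + of_real (r * r * c) * \<phi>2 (theta y)"
      by (simp add: mult_ac)
    also have "\<dots> = of_real (1 - 2 * d) * \<phi>2 y - of_real d * \<phi>2 (theta y)"
      unfolding rp by (simp add: algebra_simps)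
    finally show ?thesis .
  qed
  have dom: "of_real d * \<phi>2 (theta y) = (of_real d * \<phi>2 (theta 1)) * \<phi>2 y" if y: "y \<in> Cl K" for y
  proof (rule pure_on_dominated[OF Cl_subalgebra pure2 _ _ _ _ _ y])
    show "positive_on (Cl K) (\<lambda>y. of_real d * \<phi>2 (theta y))"
      using d by (intro positive_on_scale[OF Cl_subalgebra] state_on_positive[OF state_on_theta[OF \<phi>2]]) simp
    show "positive_on (Cl K) (\<lambda>y. \<psi> (star z * y * z))"
      by (rule positive_on_conjugate[OF Cl_subalgebra P KR zR])
    show "of_real d * \<phi>2 (theta y) + \<psi> (star z * y * z) = of_real (1 - 2 * d) * \<phi>2 y" if "y \<in> Cl K" for y
      unfolding F[OF that] by simp
    show "0 < Re (of_real d * \<phi>2 (theta 1))" using d state_on_one[OF \<phi>2] by simp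
    show "0 < Re (\<psi> (star z * 1 * z))"
      unfolding F[OF subalg_one[OF Cl_subalgebra]] using d state_on_one[OF \<phi>2] by simp
  qed
  show ?thesis
    unfolding even_state_def
  proof
    fix y assume "y \<in> Cl K"
    then show "\<phi>2 (theta y) = \<phi>2 y" using dom d state_on_one[OF \<phi>2] by fastforce
  qed
qed

section \<open>From two regions to arbitrarily many\<close>

definition joint_state ::
  "enat \<Rightarrow> (nat \<Rightarrow> nat set) \<Rightarrow> (nat \<Rightarrow> 'a \<Rightarrow> complex) \<Rightarrow> ('a \<Rightarrow> complex) \<Rightarrow> bool" where
  "joint_state N G \<phi> \<psi> \<longleftrightarrow> state_on (Cl (region N G)) \<psi> \<and>
     (\<forall>i\<in>subsystems N. states_eq_on (Cl (G i)) \<psi> (\<phi> i))"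

lemma joint_state_at_most_one_noneven:
  assumes disj: "disjoint_family_on G (subsystems N)"
    and pure: "\<And>i. i \<in> subsystems N \<Longrightarrow> pure_on (Cl (G i)) (\<phi> i)"
    and \<psi>: "joint_state N G \<phi> \<psi>"
    and il: "i \<in> subsystems N" "l \<in> subsystems N" "i \<noteq> l"
  shows "even_state (G i) (\<phi> i) \<or> even_state (G l) (\<phi> l)"
proof -
  have "G i \<inter> G l = {}" using disj il by (auto simp: disjoint_family_on_def)
  moreover have "G i \<union> G l \<subseteq> region N G" using subset_region il by blast
  ultimately show ?thesis
    using pure_noneven_imp_even[of "G i" "G l" "region N G" \<psi> "\<phi> i" "\<phi> l"] pure il \<psi>
    unfolding joint_state_def by blast
qed

text \<open>Of two distinct end points of an interval of indices at least one carries an even state,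
  and its factor can be split off from the left or from the right. Stripping on both sides forces
  the induction to run over intervals instead of initial segments.\<close>

lemma joint_state_product:
  assumes disj: "disjoint_family_on G (subsystems N)"
    and pure: "\<And>i. i \<in> subsystems N \<Longrightarrow> pure_on (Cl (G i)) (\<phi> i)"
    and even: "\<And>i l. i \<in> subsystems N \<Longrightarrow> l \<in> subsystems N \<Longrightarrow> i \<noteq> l \<Longrightarrow>
      even_state (G i) (\<phi> i) \<or> even_state (G l) (\<phi> l)"
    and \<psi>: "joint_state N G \<phi> \<psi>"
  shows "product_state N G \<phi> \<psi>"
proof -
  define R where "R = region N G"
  have st: "state_on (Cl R) \<psi>" and eq: "\<And>i. i \<in> subsystems N \<Longrightarrow> states_eq_on (Cl (G i)) \<psi> (\<phi> i)"
    using \<psi> by (auto simp: joint_state_def R_def)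
  have interval: "\<psi> (prod_list (map A [a..<b])) = (\<Prod>i\<in>{a..<b}. \<phi> i (A i))"
    if "{a..<b} \<subseteq> subsystems N" "\<And>i. i \<in> {a..<b} \<Longrightarrow> A i \<in> Cl (G i)" for a b A
    using that
  proof (induction "b - a" arbitrary: a b)
    case 0
    then show ?case using state_on_one[OF st] by simp
  next
    case (Suc n)
    have ab: "a < b" using Suc.hyps(2) by simp
    have aN: "a \<in> subsystems N" using Suc.prems(1) ab by auto
    define c where "c = b - 1"
    have bc: "b = Suc c" "a \<le> c" using ab by (auto simp: c_def)
    have cN: "c \<in> subsystems N" using Suc.prems(1) bc by auto
    have factor: "\<psi> (A i * prod_list (map A xs)) = \<phi> i (A i) * \<psi> (prod_list (map A xs))"
      "\<psi> (prod_list (map A xs) * A i) = \<phi> i (A i) * \<psi> (prod_list (map A xs))"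
      if ev: "even_state (G i) (\<phi> i)" and i: "i \<in> {a..<b}" "i \<notin> set xs" and xs: "set xs \<subseteq> {a..<b}" for i xs
    proof -
      define K where "K = (\<Union>l\<in>set xs. G l)"
      have iN: "i \<in> subsystems N" and xsN: "set xs \<subseteq> subsystems N" using i xs Suc.prems(1) by auto
      have 1: "G i \<inter> K = {}"
        unfolding K_def using disj iN xsN i(2) by (fastforce simp: disjoint_family_on_def)
      have 2: "G i \<union> K \<subseteq> R" unfolding K_def R_def using subset_region iN xsN by blast
      have 3: "prod_list (map A xs) \<in> Cl K"
        using Suc.prems(2) xs by (intro prod_list_mem_Cl[of _ A G]) (auto simp: K_def)
      have 4: "A i \<in> Cl (G i)" using Suc.prems(2) i by blast
      show "\<psi> (A i * prod_list (map A xs)) = \<phi> i (A i) * \<psi> (prod_list (map A xs))"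
        "\<psi> (prod_list (map A xs) * A i) = \<phi> i (A i) * \<psi> (prod_list (map A xs))"
        by (rule pure_even_state_product[OF 1 2 st pure[OF iN] ev eq[OF iN] 4 3])+
    qed
    consider "even_state (G a) (\<phi> a)" | "even_state (G c) (\<phi> c)" | "c = a"
      using even[OF aN cN] by blast
    then show ?case
    proof cases
      case 1
      have "\<psi> (prod_list (map A [a..<b])) = \<phi> a (A a) * \<psi> (prod_list (map A [Suc a..<b]))"
        using factor(1)[OF 1, of "[Suc a..<b]"] ab by (simp add: upt_conv_Cons)
      also have "\<psi> (prod_list (map A [Suc a..<b])) = (\<Prod>i\<in>{Suc a..<b}. \<phi> i (A i))"
        using Suc.hyps Suc.prems by (intro Suc.hyps(1)) auto
      also have "\<phi> a (A a) * (\<Prod>i\<in>{Suc a..<b}. \<phi> i (A i)) = (\<Prod>i\<in>{a..<b}. \<phi> i (A i))"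
        using ab by (simp add: prod.atLeast_Suc_lessThan)
      finally show ?thesis .
    next
      case 2
      have "\<psi> (prod_list (map A [a..<b])) = \<phi> c (A c) * \<psi> (prod_list (map A [a..<c]))"
        using factor(2)[OF 2, of "[a..<c]"] bc by simp
      also have "\<psi> (prod_list (map A [a..<c])) = (\<Prod>i\<in>{a..<c}. \<phi> i (A i))"
        using Suc.hyps Suc.prems bc by (intro Suc.hyps(1)) auto
      also have "\<phi> c (A c) * (\<Prod>i\<in>{a..<c}. \<phi> i (A i)) = (\<Prod>i\<in>{a..<b}. \<phi> i (A i))"
        using bc by (simp add: mult.commute)
      finally show ?thesis .
    next
      case 3
      then have "{a..<b} = {a}" "[a..<b] = [a]" using bc by auto
      then show ?thesis using eq[OF aN] Suc.prems(2) by (simp add: states_eq_on_def)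
    qed
  qed
  show ?thesis
    unfolding product_state_def
  proof (intro conjI allI impI)
    show "state_on (Cl (region N G)) \<psi>" using st by (simp add: R_def)
    fix k A assume kA: "enat k \<le> N \<and> (\<forall>i<k. A i \<in> Cl (G i))"
    then have "{0..<k} \<subseteq> subsystems N" using mem_subsystems_less by auto
    then show "\<psi> (prod_list (map A [0..<k])) = (\<Prod>i<k. \<phi> i (A i))"
      using interval[of 0 k A] kA by (simp add: atLeast0LessThan)
  qed
qed

text \<open>Purity of each \<open>\<phi> i\<close> makes both components of a convex decomposition
  restrict to \<open>\<phi> i\<close>. Hence they are joint extensions, therefore product states,
  and uniqueness identifies them with \<open>\<psi>\<close>.\<close>

lemma product_state_pure:
  assumes disj: "disjoint_family_on G (subsystems N)"
    and pure: "\<And>i. i \<in> subsystems N \<Longrightarrow> pure_on (Cl (G i)) (\<phi> i)"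
    and even: "\<And>i l. i \<in> subsystems N \<Longrightarrow> l \<in> subsystems N \<Longrightarrow> i \<noteq> l \<Longrightarrow>
      even_state (G i) (\<phi> i) \<or> even_state (G l) (\<phi> l)"
    and \<psi>: "product_state N G \<phi> \<psi>"
  shows "pure_on (Cl (region N G)) \<psi>"
  unfolding pure_on_def
proof (intro conjI allI impI)
  let ?R = "Cl (region N G)"
  show "state_on ?R \<psi>" using product_stateD(1)[OF \<psi>] .
  fix \<psi>1 \<psi>2 t
  assume A: "state_on ?R \<psi>1 \<and> state_on ?R \<psi>2 \<and> 0 < t \<and> t < 1 \<and>
    states_eq_on ?R \<psi> (\<lambda>x. complex_of_real t * \<psi>1 x + complex_of_real (1 - t) * \<psi>2 x)"
  have \<phi>: "state_on (Cl (G i)) (\<phi> i)" if "i \<in> subsystems N" for i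
    using pure[OF that] by (simp add: pure_on_def)
  have "states_eq_on (Cl (G i)) \<psi>1 (\<phi> i) \<and> states_eq_on (Cl (G i)) \<psi>2 (\<phi> i)" if i: "i \<in> subsystems N" for i
  proof -
    have sub: "Cl (G i) \<subseteq> ?R" using subset_region[OF i] by (rule Cl_mono)
    have "states_eq_on (Cl (G i)) (\<phi> i) (\<lambda>x. complex_of_real t * \<psi>1 x + complex_of_real (1 - t) * \<psi>2 x)"
      using A sub product_state_restrict[OF \<psi> \<phi> i] unfolding states_eq_on_def by (metis subsetD)
    moreover have "state_on (Cl (G i)) \<psi>1" "state_on (Cl (G i)) \<psi>2"
      using A sub state_on_subset by blast+
    ultimately show ?thesis using pure[OF i] A unfolding pure_on_def by blast
  qed
  then have "joint_state N G \<phi> \<psi>1" "joint_state N G \<phi> \<psi>2"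
    using A by (auto simp: joint_state_def)
  then have "product_state N G \<phi> \<psi>1" "product_state N G \<phi> \<psi>2"
    using joint_state_product[OF disj pure even] by blast+
  then show "states_eq_on ?R \<psi>1 \<psi>" "states_eq_on ?R \<psi>2 \<psi>"
    using product_state_unique[OF disj _ \<psi>] by blast+
qed

end

section \<open>The CAR algebra as a Clifford algebra\<close>

text \<open>Mode \<open>i\<close> owns the generators \<open>2 * i\<close> and
  \<open>2 * i + 1\<close>, so a set \<open>I\<close> of modes becomes the index set
  \<open>{j. j div 2 \<in> I}\<close>.\<close>

definition majorana :: "(nat \<Rightarrow> 'a::cstar_algebra) \<Rightarrow> nat \<Rightarrow> 'a" where
  "majorana a n = (let x = a (n div 2) in if even n then x + star x else \<i> *\<^sub>C (x - star x))"

lemma majorana_double: "majorana a (2 * i) = a i + star (a i)"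
  and majorana_Suc_double: "majorana a (Suc (2 * i)) = \<i> *\<^sub>C (a i - star (a i))"
  by (simp_all add: majorana_def Let_def)

lemma annihilator_majorana: "a i = (1/2) *\<^sub>C (majorana a (2 * i) - \<i> *\<^sub>C majorana a (Suc (2 * i)))"
proof -
  have "majorana a (2 * i) - \<i> *\<^sub>C majorana a (Suc (2 * i)) = a i + a i"
    by (simp add: majorana_double majorana_Suc_double scaleC_scaleC)
  then show ?thesis by (simp add: scaleC_add_right flip: scaleC_add_left)
qed

lemma hull_majorana: "cstar_subalgebra hull (majorana a ` {j. j div 2 \<in> I}) = cstar_subalgebra hull (a ` I)"
proof
  note A = cstar_subalgebra_hull[of "a ` I"] and B = cstar_subalgebra_hull[of "majorana a ` {j. j div 2 \<in> I}"]
  show "cstar_subalgebra hull (majorana a ` {j. j div 2 \<in> I}) \<subseteq> cstar_subalgebra hull (a ` I)"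
  proof (rule hull_minimal[where S = cstar_subalgebra])
    have "majorana a j \<in> cstar_subalgebra hull (a ` I)" if "j div 2 \<in> I" for j
    proof -
      have "a (j div 2) \<in> cstar_subalgebra hull (a ` I)" using that by (intro hull_inc) auto
      then show ?thesis
        by (simp add: majorana_def Let_def subalg_intros[OF A])
    qed
    then show "majorana a ` {j. j div 2 \<in> I} \<subseteq> cstar_subalgebra hull (a ` I)" by auto
  qed (rule A)
  show "cstar_subalgebra hull (a ` I) \<subseteq> cstar_subalgebra hull (majorana a ` {j. j div 2 \<in> I})"
  proof (rule hull_minimal[where S = cstar_subalgebra])
    have "a i \<in> cstar_subalgebra hull (majorana a ` {j. j div 2 \<in> I})" if "i \<in> I" for i
    proof -
      have "majorana a (2 * i) \<in> cstar_subalgebra hull (majorana a ` {j. j div 2 \<in> I})"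
        "majorana a (Suc (2 * i)) \<in> cstar_subalgebra hull (majorana a ` {j. j div 2 \<in> I})"
        using that by (auto intro!: hull_inc imageI)
      then show ?thesis
        unfolding annihilator_majorana[of a i] by (intro subalg_scaleC[OF B] subalg_diff[OF B])
    qed
    then show "a ` I \<subseteq> cstar_subalgebra hull (majorana a ` {j. j div 2 \<in> I})" by auto
  qed (rule B)
qed

lemma double_eq_zero: "x + x = 0 \<Longrightarrow> x = (0::'a::cstar_algebra)"
  using scaleR_2[of x] by simp

lemma clifford_majorana:
  assumes "car_algebra a"
  shows "clifford (majorana a)"
proof
  have car: "star (a i) * a j + a j * star (a i) = (if i = j then 1 else 0)"
    "star (a i) * star (a j) + star (a j) * star (a i) = 0" "a i * a j + a j * a i = 0" for i j
    using assms by (auto simp: car_algebra_def anticommutator_def)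
  have sq: "a i * a i = 0" "star (a i) * star (a i) = 0" for i
    using car(2,3)[of i i] double_eq_zero by auto
  have same: "star (a i) * a i + a i * star (a i) = 1" for i using car(1)[of i i] by simp
  have anti: "a i * a j = - (a j * a i)" "star (a i) * star (a j) = - (star (a j) * star (a i))"
    "star (a i) * a j = - (a j * star (a i))" "a i * star (a j) = - (star (a j) * a i)" if "i \<noteq> j" for i j
    using car(1)[of i j] car(1)[of j i] car(2,3)[of i j] that
    by (simp_all add: eq_neg_iff_add_eq_0 add.commute)
  show "star (majorana a n) = majorana a n" for n
    by (simp add: majorana_def Let_def star_add star_scaleC star_diff star_star add.commute
        flip: scaleC_minus_right)
  show "majorana a n * majorana a n = 1" for n
  proof -
    define x where "x = a (n div 2)"
    have "(x + star x) * (x + star x) = x * x + star x * star x + (star x * x + x * star x)"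
      "(\<i> *\<^sub>C (x - star x)) * (\<i> *\<^sub>C (x - star x)) = - (x * x) - star x * star x + (star x * x + x * star x)"
      by (simp_all add: algebra_simps mult_scaleC_left mult_scaleC_right scaleC_scaleC scaleC_diff_right)
    then show ?thesis
      by (simp add: majorana_def Let_def x_def sq same)
  qed
  show "majorana a p * majorana a q = - (majorana a q * majorana a p)" if "p \<noteq> q" for p q
  proof (cases "p div 2 = q div 2")
    case False
    define x y where "x = a (p div 2)" and "y = a (q div 2)"
    have xy: "x * y = - (y * x)" "star x * star y = - (star y * star x)"
      "star x * y = - (y * star x)" "x * star y = - (star y * x)"
      using anti[OF False] by (simp_all add: x_def y_def)
    \<comment> \<open>Linear combinations with arbitrary coefficients treat the four combinations of
      even and odd indices at once.\<close>
    have comb: "(c *\<^sub>C x + d *\<^sub>C star x) * (e *\<^sub>C y + f *\<^sub>C star y)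
        = - ((e *\<^sub>C y + f *\<^sub>C star y) * (c *\<^sub>C x + d *\<^sub>C star x))" for c d e f
      by (simp add: distrib_left distrib_right mult_scaleC_left mult_scaleC_right scaleC_scaleC xy
          scaleC_add_right scaleC_diff_right mult.commute add_ac)
    have form: "majorana a n = (if even n then 1 else \<i>) *\<^sub>C a (n div 2) + (if even n then 1 else - \<i>) *\<^sub>C star (a (n div 2))" for n
      by (simp add: majorana_def Let_def scaleC_diff_right)
    show ?thesis
      unfolding form x_def[symmetric] y_def[symmetric] by (rule comb)
  next
    case True
    define x where "x = a (p div 2)"
    have xx: "x * x = 0" "star x * star x = 0" by (simp_all add: x_def sq)
    have "even p \<noteq> even q"
      using that True by (metis dvd_mult_div_cancel odd_two_times_div_two_succ)
    moreover have "(x + star x) * (x - star x) + (x - star x) * (x + star x) = 0"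
      by (simp add: algebra_simps xx)
    then have "\<i> *\<^sub>C ((x + star x) * (x - star x)) = - (\<i> *\<^sub>C ((x - star x) * (x + star x)))"
      by (simp add: eq_neg_iff_add_eq_0 flip: scaleC_add_right)
    ultimately show ?thesis
      using True by (auto simp: majorana_def Let_def x_def mult_scaleC_left mult_scaleC_right)
  qed
  show "cstar_subalgebra hull range (majorana a) = UNIV"
    using hull_majorana[of a UNIV] assms by (simp add: car_algebra_def)
qed

lemma bounded_linear_cstar_automorphism:
  assumes "cstar_automorphism \<theta>"
  shows "bounded_linear \<theta>"
  using assms cstar_automorphism_contractive[OF assms]
  by (intro bounded_linear_intro[of _ 1]) (simp_all add: cstar_automorphism_def scaleR_conv_scaleC)

text \<open>The description in \<open>parity\<close> needs uniqueness as well as existence.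
  Automorphisms that agree on the annihilators agree on the closed subalgebra generated by them;
  closedness of the agreement set is where automatic contractivity is used.\<close>

lemma parity_eq_theta:
  assumes "car_algebra a"
  shows "parity a = clifford.theta (majorana a)"
proof -
  interpret clifford "majorana a" by (rule clifford_majorana[OF assms])
  have ta: "theta (a i) = - a i" for i
  proof -
    let ?x = "(1/2) *\<^sub>C (majorana a (2 * i) - \<i> *\<^sub>C majorana a (Suc (2 * i)))"
    have "theta ?x = - ?x"
      by (simp add: theta_scaleC theta_diff scaleC_diff_right scaleC_add_right)
    then show ?thesis unfolding annihilator_majorana[symmetric] .
  qed
  show ?thesis
    unfolding parity_def
  proof (rule the_equality)
    show "cstar_automorphism theta \<and> (\<forall>i. theta (a i) = - a i \<and> theta (star (a i)) = - star (a i))"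
      by (simp add: cstar_automorphism_theta ta theta_star)
    fix \<theta> assume \<theta>: "cstar_automorphism \<theta> \<and> (\<forall>i. \<theta> (a i) = - a i \<and> \<theta> (star (a i)) = - star (a i))"
    have hom: "\<theta> (x + y) = \<theta> x + \<theta> y" "\<theta> (c *\<^sub>C x) = c *\<^sub>C \<theta> x" "\<theta> (x * y) = \<theta> x * \<theta> y"
      "\<theta> (star x) = star (\<theta> x)" "surj \<theta>" for x y c
      using \<theta> by (auto simp: cstar_automorphism_def bij_def)
    have "\<theta> 1 = 1" by (metis hom(3,5) mult.left_neutral mult.right_neutral surjD)
    have "cstar_subalgebra hull range a \<subseteq> {x. \<theta> x = theta x}"
    proof (rule hull_minimal)
      show "cstar_subalgebra {x. \<theta> x = theta x}"
      proof (rule cstar_subalgebraI)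
        show "closed {x. \<theta> x = theta x}"
          using bounded_linear_cstar_automorphism[of \<theta>] \<theta>
          by (intro closed_Collect_eq linear_continuous_on bounded_linear_theta) auto
      qed (simp_all add: hom theta_add theta_mult theta_scaleC theta_star \<open>\<theta> 1 = 1\<close>)
      show "range a \<subseteq> {x. \<theta> x = theta x}" using \<theta> ta by auto
    qed
    then show "\<theta> = theta" using assms by (auto simp: car_algebra_def)
  qed
qed

theorem theorem1:
  fixes a :: "nat \<Rightarrow> 'a::cstar_algebra"
    and N :: enat
    and I :: "nat \<Rightarrow> nat set"
    and \<phi> :: "nat \<Rightarrow> 'a \<Rightarrow> complex"
  assumes "car_algebra a"
    and "disjoint_family_on I (subsystems N)"
    and "\<And>i. i \<in> subsystems N \<Longrightarrow> state_on (local_algebra a (I i)) (\<phi> i)"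
  shows
    "(((\<exists>\<psi>. product_extension a N I \<phi> \<psi>) \<longleftrightarrow>
         (\<exists>\<^sub>\<le>\<^sub>1 i. i \<in> subsystems N \<and> \<not> even_on a (I i) (\<phi> i))) \<and>
      (\<forall>\<psi> \<psi>'. product_extension a N I \<phi> \<psi> \<and> product_extension a N I \<phi> \<psi>' \<longrightarrow>
         states_eq_on (local_algebra a (region N I)) \<psi> \<psi>') \<and>
      (\<forall>\<psi>. product_extension a N I \<phi> \<psi> \<longrightarrow>
         (even_on a (region N I) \<psi> \<longleftrightarrow> (\<forall>i\<in>subsystems N. even_on a (I i) (\<phi> i))))) \<and>
     ((\<forall>i\<in>subsystems N. pure_on (local_algebra a (I i)) (\<phi> i)) \<longrightarrow>
      ((\<exists>\<psi>. joint_extension a N I \<phi> \<psi>) \<longrightarrow>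
         (\<exists>\<^sub>\<le>\<^sub>1 i. i \<in> subsystems N \<and> \<not> even_on a (I i) (\<phi> i))) \<and>
      ((\<exists>\<^sub>\<le>\<^sub>1 i. i \<in> subsystems N \<and> \<not> even_on a (I i) (\<phi> i)) \<longrightarrow>
         (\<exists>\<psi>. product_extension a N I \<phi> \<psi> \<and> joint_extension a N I \<phi> \<psi> \<and>
            pure_on (local_algebra a (region N I)) \<psi> \<and>
            (\<forall>\<psi>'. joint_extension a N I \<phi> \<psi>' \<longrightarrow>
               states_eq_on (local_algebra a (region N I)) \<psi>' \<psi>))))"
proof -
  interpret clifford "majorana a" by (rule clifford_majorana[OF assms(1)])
  define G where "G i = {j. j div 2 \<in> I i}" for i
  have local: "local_algebra a J = Cl {j. j div 2 \<in> J}" for J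
    unfolding local_algebra_def Cl_def by (rule hull_majorana[symmetric])
  have reg: "{j. j div 2 \<in> region N I} = region N G" by (auto simp: region_def G_def)
  have evn: "even_on a J \<psi> \<longleftrightarrow> even_state {j. j div 2 \<in> J} \<psi>" for J \<psi>
    by (simp add: even_on_def even_state_def local parity_eq_theta[OF assms(1)])
  have prd: "product_extension a N I \<phi> \<psi> \<longleftrightarrow> product_state N G \<phi> \<psi>" for \<psi>
    by (simp add: product_extension_def product_state_def local reg flip: G_def)
  have jnt: "joint_extension a N I \<phi> \<psi> \<longleftrightarrow> joint_state N G \<phi> \<psi>" for \<psi>
    by (simp add: joint_extension_def joint_state_def local reg flip: G_def)
  \<comment> \<open>"All but at most one are even" in pairwise form: of any two distinct subsystems,
    one is even. This is how existence and factorisation use it.\<close>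
  define E where "E \<longleftrightarrow> (\<forall>i l. i \<in> subsystems N \<longrightarrow> l \<in> subsystems N \<longrightarrow> i \<noteq> l \<longrightarrow>
    even_state (G i) (\<phi> i) \<or> even_state (G l) (\<phi> l))"
  have uniq: "(\<exists>\<^sub>\<le>\<^sub>1 i. i \<in> subsystems N \<and> \<not> even_state (G i) (\<phi> i)) \<longleftrightarrow> E"
    unfolding Uniq_def E_def by blast
  have disj: "disjoint_family_on G (subsystems N)"
    using assms(2) by (fastforce simp: disjoint_family_on_def G_def)
  have st: "state_on (Cl (G i)) (\<phi> i)" if "i \<in> subsystems N" for i
    using assms(3)[OF that] by (simp add: local G_def)
  have ex: "\<exists>\<psi>. product_state N G \<phi> \<psi>" if E
    using that product_state_exists_infinite[OF disj st] unfolding E_def by blast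
  have nec: E if "product_state N G \<phi> \<psi>" for \<psi>
    unfolding E_def
  proof (intro allI impI)
    fix i l assume il: "i \<in> subsystems N" "l \<in> subsystems N" "i \<noteq> l"
    then show "even_state (G i) (\<phi> i) \<or> even_state (G l) (\<phi> l)"
      using product_state_at_most_one_noneven[OF disj st that, of i l]
        product_state_at_most_one_noneven[OF disj st that, of l i] by (cases "i < l") auto
  qed
  have even: "even_state (region N G) \<psi> \<longleftrightarrow> (\<forall>i\<in>subsystems N. even_state (G i) (\<phi> i))"
    if \<psi>: "product_state N G \<phi> \<psi>" for \<psi>
  proof
    assume ev: "even_state (region N G) \<psi>"
    show "\<forall>i\<in>subsystems N. even_state (G i) (\<phi> i)"
    proof
      fix i assume i: "i \<in> subsystems N"
      have "Cl (G i) \<subseteq> Cl (region N G)" using subset_region[OF i] by (rule Cl_mono)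
      then show "even_state (G i) (\<phi> i)"
        using ev product_state_restrict[OF \<psi> st i] theta_Cl[of _ "G i"]
        unfolding even_state_def states_eq_on_def by (metis subsetD)
    qed
  qed (use product_state_even[OF disj \<psi>] in blast)
  have joint: "joint_state N G \<phi> \<psi>" if "product_state N G \<phi> \<psi>" for \<psi>
    unfolding joint_state_def using product_stateD(1)[OF that] product_state_restrict[OF that st] by blast
  have part2: "((\<exists>\<psi>. joint_state N G \<phi> \<psi>) \<longrightarrow> E) \<and>
    (E \<longrightarrow> (\<exists>\<psi>. product_state N G \<phi> \<psi> \<and> joint_state N G \<phi> \<psi> \<and> pure_on (Cl (region N G)) \<psi> \<and>
       (\<forall>\<psi>'. joint_state N G \<phi> \<psi>' \<longrightarrow> states_eq_on (Cl (region N G)) \<psi>' \<psi>)))"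
    if "\<forall>i\<in>subsystems N. pure_on (Cl (G i)) (\<phi> i)"
  proof (intro conjI impI)
    have pure: "\<And>i. i \<in> subsystems N \<Longrightarrow> pure_on (Cl (G i)) (\<phi> i)" using that by blast
    show E if "\<exists>\<psi>. joint_state N G \<phi> \<psi>"
      using that joint_state_at_most_one_noneven[OF disj pure] unfolding E_def by blast
    assume E
    then have ev: "\<And>i l. i \<in> subsystems N \<Longrightarrow> l \<in> subsystems N \<Longrightarrow> i \<noteq> l \<Longrightarrow>
        even_state (G i) (\<phi> i) \<or> even_state (G l) (\<phi> l)" unfolding E_def by blast
    obtain \<psi> where \<psi>: "product_state N G \<phi> \<psi>" using ex[OF \<open>E\<close>] by blast
    have "states_eq_on (Cl (region N G)) \<psi>' \<psi>" if "joint_state N G \<phi> \<psi>'" for \<psi>'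
      by (rule product_state_unique[OF disj joint_state_product[OF disj pure ev that] \<psi>])
    moreover have "pure_on (Cl (region N G)) \<psi>"
      by (rule product_state_pure[OF disj pure ev \<psi>])
    ultimately show "\<exists>\<psi>. product_state N G \<phi> \<psi> \<and> joint_state N G \<phi> \<psi> \<and> pure_on (Cl (region N G)) \<psi> \<and>
       (\<forall>\<psi>'. joint_state N G \<phi> \<psi>' \<longrightarrow> states_eq_on (Cl (region N G)) \<psi>' \<psi>)"
      using \<psi> joint[OF \<psi>] by blast
  qed
  show ?thesis
    unfolding prd jnt evn local reg G_def[symmetric] uniq
    using ex nec even part2 product_state_unique[OF disj] by blast
qed

end
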